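(* Let $A$ be a commutative algebra over $\mathbb{C}$, let $Y$ be a pointed simplicial finite set, let $N\geq 2$ and let $q\in\mathbb{C}$ be a primitive $N$-th root of unity. Let $D:A\longrightarrow A$ be a derivation on $A$. Then, for each $n\geq 0$, $D$ induces a morphism $L_D^{Y,n}:{}_qHH_n^Y(A)\longrightarrow {}_qHH_n^Y(A)$ of $q$-Hochschild homology groups of order $Y$; that is, the levelwise maps $L^Y_{D,i}:\mathcal{L}^Y(A)_i\longrightarrow\mathcal{L}^Y(A)_i$ ($i\geq 0$) defined in the context induce a well-defined linear map on the homology objects of the $N$-complex $(\mathcal{L}^Y(A),{}_qb)$. Additionally, if $\mathcal{H}=\mathcal{U}(Der(A))$ is the universal enveloping algebra of the Lie algebra $Der(A)$ of derivations on $A$, each ${}_qHH_n^Y(A)$ is a left $\mathcal{H}$-module, with each $D\in Der(A)\subseteq\mathcal{H}$ acting by $L_D^{Y,n}$; i.e., for any element $h\in\mathcal{H}$ there are morphisms $L_h^{Y,n}:{}_qHH_n^Y(A)\longrightarrow {}_qHH_n^Y(A)$, $n\ge 0$, giving the action of $h$.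
   Context: $Vect$ is the category of complex vector spaces; tensor products are over $\mathbb{C}$. A derivation on $A$ is a $\mathbb{C}$-linear map $D:A\to A$ with $D(aa')=D(a)a'+aD(a')$; $Der(A)$ is the Lie algebra of derivations with bracket $[D,D']=D\circ D'-D'\circ D$. $\Gamma$ is the category with objects $[n]=\{0,1,\dots,n\}$, $n\geq 0$, pointed at $0$, and morphisms the maps of sets preserving $0$. The functor $\mathcal{L}(A):\Gamma\to Vect$ sends $[n]$ to $A\otimes A^{\otimes n}$, and $\phi:[m]\to[n]$ to $\mathcal{L}(A)(\phi)(a_0\otimes\dots\otimes a_m)=b_0\otimes\dots\otimes b_n$ with $b_j=\prod_{\phi(i)=j}a_i$ (empty product $=1$). It is extended to the category $Fin_*$ of finite pointed sets by $\mathcal{L}(A)(T)=\mathrm{colim}_{\Gamma\ni T'\to T}\,\mathcal{L}(A)(T')$. A pointed simplicial finite set is a functor $Y:\Delta^{op}\to Fin_*$, with $\Delta$ the simplex category; $\mathcal{L}^Y(A)=\mathcal{L}(A)\circ Y:\Delta^{op}\to Vect$ is a simplicial vector space, with $i$-th component $\mathcal{L}^Y(A)_i=\mathcal{L}(A)(Y_i)$ and face maps $d_n^i:\mathcal{L}^Y(A)_n\to\mathcal{L}^Y(A)_{n-1}$, $0\leq i\leq n$. Set $\mathcal{L}^Y(A)_n=0$ for $n<0$ and ${}_qb_n=\sum_{i=0}^n q^i d_n^i:\mathcal{L}^Y(A)_n\to\mathcal{L}^Y(A)_{n-1}$ (with ${}_qb_n=0$ for $n\le 0$). It is known that ${}_qb^N=0$,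 i.e. $(\mathcal{L}^Y(A),{}_qb)$ is an $N$-complex (a sequence of objects and maps of degree $-1$, any $N$ consecutive ones composing to $0$). For an $N$-complex $(C_*,b)$ the homology object is $H_{\{n\}}(C_*,b)=\bigoplus_{i=1}^{N-1}H_{\{i,n\}}(C_*,b)$, where $H_{\{i,n\}}(C_*,b)=\mathrm{Ker}(b^i:C_n\to C_{n-i})/\mathrm{Im}(b^{N-i}:C_{n+N-i}\to C_n)$. The $q$-Hochschild homology groups of $A$ of order $Y$ are ${}_qHH_n^Y(A)=H_{\{n\}}(\mathcal{L}^Y(A),{}_qb)$, $n\geq 0$. Given $D\in Der(A)$, define $L_D([n]):\mathcal{L}(A)([n])\to\mathcal{L}(A)([n])$ by $a_0\otimes\dots\otimes a_n\mapsto\sum_{i=0}^n a_0\otimes\dots\otimes D(a_i)\otimes\dots\otimes a_n$. For $T\in Fin_*$, $L_D(T):\mathcal{L}(A)(T)\to\mathcal{L}(A)(T)$ is the map induced on the colimit by the maps $L_D(T')$, $T'\in\Gamma$; equivalently $L_D(T)=\mathcal{L}(A)(\sigma)\circ L_D([m])\circ\mathcal{L}(A)(\sigma)^{-1}$ for any pointed bijection $\sigma:[m]\to T$. Put $L^Y_{D,i}=L_D(Y_i):\mathcal{L}^Y(A)_i\to\mathcal{L}^Y(A)_i$. The map $L_D^{Y,n}$ on ${}_qHH^Y_n(A)$ is the one induced by $L^Y_{D,n}$ on each summand $H_{\{i,n\}}$. *)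

theory Defs
  imports "HOL-Algebra.Algebra" "HOL-Algebra.Algebraic_Closure_Type" "HOL-Library.FuncSet"
    Complex_Main
begin

section \<open>Complex vector spaces\<close>

text \<open>A complex vector space is a \<^term>\<open>M\<close> with \<^term>\<open>module \<C> M\<close>, for the ring \<open>\<C>\<close> below;
  the fields \<^term>\<open>monoid.mult\<close> and \<^term>\<open>monoid.one\<close> of the record are not used.
  A commutative \<open>\<C>\<close>-algebra is the library's \<^term>\<open>algebra \<C> A\<close>.\<close>

abbreviation complex_ring :: "complex ring" (\<open>\<C>\<close>)
  where "\<C> \<equiv> ring_of_type_algebra"

definition lin_maps ::
    "(complex, 'v, 'm) module_scheme \<Rightarrow> (complex, 'w, 'n) module_scheme \<Rightarrow> ('v \<Rightarrow> 'w) set"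
  where "lin_maps M N =
    {f \<in> carrier M \<rightarrow> carrier N.
      (\<forall>x\<in>carrier M. \<forall>y\<in>carrier M. f (x \<oplus>\<^bsub>M\<^esub> y) = f x \<oplus>\<^bsub>N\<^esub> f y) \<and>
      (\<forall>c. \<forall>x\<in>carrier M. f (c \<odot>\<^bsub>M\<^esub> x) = c \<odot>\<^bsub>N\<^esub> f x)}"

definition lin_span :: "(complex, 'v, 'm) module_scheme \<Rightarrow> 'v set \<Rightarrow> 'v set"
  where "lin_span M S = \<Inter> {W. submodule W \<C> M \<and> S \<subseteq> W}"

text \<open>The library's \<^term>\<open>M Quot W\<close> together with scalar multiplication. For a
  subspace \<open>W\<close> this is the quotient vector space, for a two-sided ideal \<open>W\<close> of an associative
  algebra it is the quotient algebra.\<close>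

definition quot_mod ::
    "(complex, 'v, 'm) module_scheme \<Rightarrow> 'v set \<Rightarrow> (complex, 'v set) module"
  where "quot_mod M W =
    \<lparr>carrier = a_rcosets\<^bsub>M\<^esub> W, monoid.mult = rcoset_mult M W, one = W +>\<^bsub>M\<^esub> \<one>\<^bsub>M\<^esub>,
     ring.zero = W, add = set_add M, module.smult = (\<lambda>c K. \<Union>x\<in>K. W +>\<^bsub>M\<^esub> (c \<odot>\<^bsub>M\<^esub> x))\<rparr>"

definition direct_sum ::
    "'i set \<Rightarrow> ('i \<Rightarrow> (complex, 'v, 'm) module_scheme) \<Rightarrow> (complex, 'i \<Rightarrow> 'v) module"
  where "direct_sum I M =
    \<lparr>carrier = {u \<in> (\<Pi>\<^sub>E i\<in>I. carrier (M i)). finite {i \<in> I. u i \<noteq> \<zero>\<^bsub>M i\<^esub>}},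
     monoid.mult = undefined, one = undefined,
     ring.zero = (\<lambda>i\<in>I. \<zero>\<^bsub>M i\<^esub>),
     add = (\<lambda>u v. \<lambda>i\<in>I. u i \<oplus>\<^bsub>M i\<^esub> v i),
     module.smult = (\<lambda>c u. \<lambda>i\<in>I. c \<odot>\<^bsub>M i\<^esub> u i)\<rparr>"

definition direct_sum_in ::
    "'i set \<Rightarrow> ('i \<Rightarrow> (complex, 'v, 'm) module_scheme) \<Rightarrow> 'i \<Rightarrow> 'v \<Rightarrow> 'i \<Rightarrow> 'v"
  where "direct_sum_in I M i x = (\<lambda>j\<in>I. if j = i then x else \<zero>\<^bsub>M j\<^esub>)"

definition free_space :: "'x set \<Rightarrow> (complex, 'x \<Rightarrow> complex) module"
  where "free_space S =
    \<lparr>carrier = {f. finite {x. f x \<noteq> 0} \<and> {x. f x \<noteq> 0} \<subseteq> S},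
     monoid.mult = undefined, one = undefined,
     ring.zero = (\<lambda>_. 0), add = (\<lambda>f g x. f x + g x), module.smult = (\<lambda>c f x. c * f x)\<rparr>"

definition free_basis :: "'x \<Rightarrow> 'x \<Rightarrow> complex"
  where "free_basis x = (\<lambda>y. if y = x then 1 else 0)"

section \<open>Colimits of vector spaces\<close>

text \<open>A diagram is given by its objects \<^term>\<open>M i\<close> (\<^term>\<open>i \<in> I\<close>) and a set \<open>J\<close> of
  arrows \<^term>\<open>(i, j, f)\<close> with \<open>f\<close> a linear map from \<^term>\<open>M i\<close> to \<^term>\<open>M j\<close>.\<close>

definition colim_rels ::
    "'i set \<Rightarrow> ('i \<Rightarrow> (complex, 'v, 'm) module_scheme) \<Rightarrow> ('i \<times> 'i \<times> ('v \<Rightarrow> 'v)) set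
      \<Rightarrow> ('i \<Rightarrow> 'v) set"
  where "colim_rels I M J = lin_span (direct_sum I M)
    {direct_sum_in I M i x \<ominus>\<^bsub>direct_sum I M\<^esub> direct_sum_in I M j (f x) | i j f x.
      (i, j, f) \<in> J \<and> x \<in> carrier (M i)}"

definition colim ::
    "'i set \<Rightarrow> ('i \<Rightarrow> (complex, 'v, 'm) module_scheme) \<Rightarrow> ('i \<times> 'i \<times> ('v \<Rightarrow> 'v)) set
      \<Rightarrow> (complex, ('i \<Rightarrow> 'v) set) module"
  where "colim I M J = quot_mod (direct_sum I M) (colim_rels I M J)"

definition colim_in ::
    "'i set \<Rightarrow> ('i \<Rightarrow> (complex, 'v, 'm) module_scheme) \<Rightarrow> ('i \<times> 'i \<times> ('v \<Rightarrow> 'v)) set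
      \<Rightarrow> 'i \<Rightarrow> 'v \<Rightarrow> ('i \<Rightarrow> 'v) set"
  where "colim_in I M J i x = colim_rels I M J +>\<^bsub>direct_sum I M\<^esub> direct_sum_in I M i x"

text \<open>The map out of the colimit given by a cocone of linear maps \<open>h i\<close> from \<^term>\<open>M i\<close> to \<open>N\<close>:
  it sends the class of \<open>u\<close> to the sum of the \<^term>\<open>h i (u i)\<close>. For a cocone this does not
  depend on the representative, so that the set passed to \<^const>\<open>the_elem\<close> is a singleton.\<close>

definition colim_lift ::
    "'i set \<Rightarrow> ('i \<Rightarrow> (complex, 'v, 'm) module_scheme) \<Rightarrow> ('i \<times> 'i \<times> ('v \<Rightarrow> 'v)) set
      \<Rightarrow> (complex, 'w, 'n) module_scheme \<Rightarrow> ('i \<Rightarrow> 'v \<Rightarrow> 'w) \<Rightarrow> ('i \<Rightarrow> 'v) set \<Rightarrow> 'w"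
  where "colim_lift I M J N h = (\<lambda>K\<in>carrier (colim I M J).
    the_elem ((\<lambda>u. \<Oplus>\<^bsub>N\<^esub>i\<in>{i \<in> I. u i \<noteq> \<zero>\<^bsub>M i\<^esub>}. h i (u i)) ` K))"

section \<open>Tensor powers\<close>

text \<open>\<open>tensor_power A n\<close> is \<open>A \<otimes> A\<^sup>\<otimes>\<^sup>n\<close>, with tensor factors numbered \<open>0, \<dots>, n\<close>:
  the vector space generated by the tuples \<open>(a\<^sub>0, \<dots>, a\<^sub>n)\<close> modulo multilinearity.\<close>

definition tuples :: "(complex, 'a, 'm) module_scheme \<Rightarrow> nat \<Rightarrow> (nat \<Rightarrow> 'a) set"
  where "tuples A n = {..n} \<rightarrow>\<^sub>E carrier A"

definition tensor_rels ::
    "(complex, 'a, 'm) module_scheme \<Rightarrow> nat \<Rightarrow> ((nat \<Rightarrow> 'a) \<Rightarrow> complex) set"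
  where "tensor_rels A n = (let F = free_space (tuples A n) in lin_span F
    ({free_basis (a(i := x \<oplus>\<^bsub>A\<^esub> y)) \<ominus>\<^bsub>F\<^esub> (free_basis (a(i := x)) \<oplus>\<^bsub>F\<^esub> free_basis (a(i := y)))
        | a i x y. a \<in> tuples A n \<and> i \<le> n \<and> x \<in> carrier A \<and> y \<in> carrier A} \<union>
     {free_basis (a(i := c \<odot>\<^bsub>A\<^esub> x)) \<ominus>\<^bsub>F\<^esub> (c \<odot>\<^bsub>F\<^esub> free_basis (a(i := x)))
        | a i c x. a \<in> tuples A n \<and> i \<le> n \<and> x \<in> carrier A}))"

type_synonym 'a tensor = "((nat \<Rightarrow> 'a) \<Rightarrow> complex) set"

definition tensor_power ::
    "(complex, 'a, 'm) module_scheme \<Rightarrow> nat \<Rightarrow> (complex, 'a tensor) module"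
  where "tensor_power A n = quot_mod (free_space (tuples A n)) (tensor_rels A n)"

definition pure_tensor :: "(complex, 'a, 'm) module_scheme \<Rightarrow> nat \<Rightarrow> (nat \<Rightarrow> 'a) \<Rightarrow> 'a tensor"
  where "pure_tensor A n a = tensor_rels A n +>\<^bsub>free_space (tuples A n)\<^esub> free_basis a"

text \<open>The linear map with \<open>a\<^sub>0 \<otimes> \<dots> \<otimes> a\<^sub>n \<mapsto> g a\<close>, for a multilinear map \<open>g\<close> to \<open>M\<close>; see the
  remark on \<^const>\<open>colim_lift\<close> for \<^const>\<open>the_elem\<close>.\<close>

definition tensor_lift ::
    "(complex, 'a, 'm) module_scheme \<Rightarrow> nat \<Rightarrow> (complex, 'w, 'n) module_scheme
      \<Rightarrow> ((nat \<Rightarrow> 'a) \<Rightarrow> 'w) \<Rightarrow> 'a tensor \<Rightarrow> 'w"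
  where "tensor_lift A n M g = (\<lambda>K\<in>carrier (tensor_power A n).
    the_elem ((\<lambda>f. \<Oplus>\<^bsub>M\<^esub>a\<in>{a. f a \<noteq> 0}. f a \<odot>\<^bsub>M\<^esub> g a) ` K))"

section \<open>The functor \<open>\<L>(A)\<close>\<close>

type_synonym 's pset = "'s set \<times> 's"

definition finite_pointed :: "'s pset \<Rightarrow> bool"
  where "finite_pointed T \<longleftrightarrow> finite (fst T) \<and> snd T \<in> fst T"

definition pointed_maps :: "'s pset \<Rightarrow> 't pset \<Rightarrow> ('s \<Rightarrow> 't) set"
  where "pointed_maps S T = {f \<in> fst S \<rightarrow>\<^sub>E fst T. f (snd S) = snd T}"

definition gamma_obj :: "nat \<Rightarrow> nat pset"
  where "gamma_obj n = ({..n}, 0)"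

definition loday_gamma ::
    "(complex, 'a, 'm) module_scheme \<Rightarrow> nat \<Rightarrow> nat \<Rightarrow> (nat \<Rightarrow> nat) \<Rightarrow> 'a tensor \<Rightarrow> 'a tensor"
  where "loday_gamma A m n \<phi> = tensor_lift A m (tensor_power A n)
    (\<lambda>a. pure_tensor A n (\<lambda>j\<in>{..n}. \<Otimes>\<^bsub>A\<^esub>i\<in>{i \<in> {..m}. \<phi> i = j}. a i))"

text \<open>The extension to finite pointed sets \<open>T\<close>: the colimit over the category of pairs
  \<open>(m, \<phi>)\<close>, \<open>\<phi>\<close> a pointed map from \<open>[m]\<close> to \<open>T\<close>, whose arrows \<open>(m, \<phi> \<circ> \<psi>) \<rightarrow> (n, \<phi>)\<close> are the
  pointed maps \<open>\<psi>\<close> from \<open>[m]\<close> to \<open>[n]\<close>.\<close>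

type_synonym 's gamma_over = "nat \<times> (nat \<Rightarrow> 's)"

definition over_objs :: "'s pset \<Rightarrow> 's gamma_over set"
  where "over_objs T = {(m, \<phi>). \<phi> \<in> pointed_maps (gamma_obj m) T}"

definition over_arrs ::
    "(complex, 'a, 'm) module_scheme \<Rightarrow> 's pset
      \<Rightarrow> ('s gamma_over \<times> 's gamma_over \<times> ('a tensor \<Rightarrow> 'a tensor)) set"
  where "over_arrs A T =
    {((m, compose {..m} \<phi> \<psi>), (n, \<phi>), loday_gamma A m n \<psi>) | m n \<phi> \<psi>.
      \<phi> \<in> pointed_maps (gamma_obj n) T \<and> \<psi> \<in> pointed_maps (gamma_obj m) (gamma_obj n)}"

type_synonym ('s, 'a) loday = "('s gamma_over \<Rightarrow> 'a tensor) set"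

definition loday ::
    "(complex, 'a, 'm) module_scheme \<Rightarrow> 's pset \<Rightarrow> (complex, ('s, 'a) loday) module"
  where "loday A T = colim (over_objs T) (\<lambda>(m, \<phi>). tensor_power A m) (over_arrs A T)"

definition loday_in ::
    "(complex, 'a, 'm) module_scheme \<Rightarrow> 's pset \<Rightarrow> 's gamma_over \<Rightarrow> 'a tensor \<Rightarrow> ('s, 'a) loday"
  where "loday_in A T = colim_in (over_objs T) (\<lambda>(m, \<phi>). tensor_power A m) (over_arrs A T)"

definition loday_lift ::
    "(complex, 'a, 'm) module_scheme \<Rightarrow> 's pset \<Rightarrow> (complex, 'w, 'n) module_scheme
      \<Rightarrow> ('s gamma_over \<Rightarrow> 'a tensor \<Rightarrow> 'w) \<Rightarrow> ('s, 'a) loday \<Rightarrow> 'w"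
  where "loday_lift A T =
    colim_lift (over_objs T) (\<lambda>(m, \<phi>). tensor_power A m) (over_arrs A T)"

definition loday_map ::
    "(complex, 'a, 'm) module_scheme \<Rightarrow> 's pset \<Rightarrow> 't pset \<Rightarrow> ('s \<Rightarrow> 't)
      \<Rightarrow> ('s, 'a) loday \<Rightarrow> ('t, 'a) loday"
  where "loday_map A S T f =
    loday_lift A S (loday A T) (\<lambda>(m, \<phi>). loday_in A T (m, compose {..m} f \<phi>))"

section \<open>Pointed simplicial finite sets\<close>

text \<open>\<open>sarr Y m n \<theta>\<close> is the map from \<open>Y\<^sub>n\<close> to \<open>Y\<^sub>m\<close> induced by the monotone map \<open>\<theta>\<close> from
  \<open>[m]\<close> to \<open>[n]\<close>.\<close>

record 's simplicial_pset =
  sobj :: "nat \<Rightarrow> 's pset"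
  sarr :: "nat \<Rightarrow> nat \<Rightarrow> (nat \<Rightarrow> nat) \<Rightarrow> 's \<Rightarrow> 's"

definition simplex_maps :: "nat \<Rightarrow> nat \<Rightarrow> (nat \<Rightarrow> nat) set"
  where "simplex_maps m n = {\<theta> \<in> {..m} \<rightarrow>\<^sub>E {..n}. mono_on {..m} \<theta>}"

locale pointed_simplicial_finite_set =
  fixes Y :: "'s simplicial_pset"
  assumes sobj: "finite_pointed (sobj Y n)"
    and sarr: "\<theta> \<in> simplex_maps m n \<Longrightarrow> sarr Y m n \<theta> \<in> pointed_maps (sobj Y n) (sobj Y m)"
    and sarr_id: "sarr Y n n (\<lambda>i\<in>{..n}. i) = (\<lambda>y\<in>fst (sobj Y n). y)"
    and sarr_comp: "\<lbrakk>\<theta> \<in> simplex_maps m n; \<eta> \<in> simplex_maps n p\<rbrakk> \<Longrightarrow>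
      sarr Y m p (compose {..m} \<eta> \<theta>) =
        compose (fst (sobj Y p)) (sarr Y m n \<theta>) (sarr Y n p \<eta>)"

text \<open>The injective monotone map from \<open>[n - 1]\<close> to \<open>[n]\<close> (\<open>n \<ge> 1\<close>) that misses \<open>i\<close>.\<close>

definition coface :: "nat \<Rightarrow> nat \<Rightarrow> nat \<Rightarrow> nat"
  where "coface n i = (\<lambda>j\<in>{..n - 1}. if j < i then j else Suc j)"

section \<open>\<open>q\<close>-Hochschild homology\<close>

definition loday_face ::
    "(complex, 'a, 'm) module_scheme \<Rightarrow> 's simplicial_pset \<Rightarrow> nat \<Rightarrow> nat
      \<Rightarrow> ('s, 'a) loday \<Rightarrow> ('s, 'a) loday"
  where "loday_face A Y n i =
    loday_map A (sobj Y n) (sobj Y (n - 1)) (sarr Y (n - 1) n (coface n i))"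

text \<open>In negative degrees we take the zero subspace of the space in degree \<open>0\<close>.\<close>

definition loday_complex ::
    "(complex, 'a, 'm) module_scheme \<Rightarrow> 's simplicial_pset \<Rightarrow> int
      \<Rightarrow> (complex, ('s, 'a) loday) module"
  where "loday_complex A Y n =
    (if n < 0 then (loday A (sobj Y 0))\<lparr>carrier := {\<zero>\<^bsub>loday A (sobj Y 0)\<^esub>}\<rparr>
     else loday A (sobj Y (nat n)))"

definition q_differential ::
    "(complex, 'a, 'm) module_scheme \<Rightarrow> 's simplicial_pset \<Rightarrow> complex \<Rightarrow> int
      \<Rightarrow> ('s, 'a) loday \<Rightarrow> ('s, 'a) loday"
  where "q_differential A Y q n x =
    (if n \<le> 0 then \<zero>\<^bsub>loday_complex A Y (n - 1)\<^esub>
     else \<Oplus>\<^bsub>loday_complex A Y (n - 1)\<^esub>i\<in>{..nat n}.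
       (q ^ i) \<odot>\<^bsub>loday_complex A Y (n - 1)\<^esub> loday_face A Y (nat n) i x)"

text \<open>\<open>b_power b k n\<close> is \<open>b\<^sup>k : C\<^sub>n \<rightarrow> C\<^bsub>n-k\<^esub>\<close>.\<close>

fun b_power :: "(int \<Rightarrow> 'v \<Rightarrow> 'v) \<Rightarrow> nat \<Rightarrow> int \<Rightarrow> 'v \<Rightarrow> 'v" where
  "b_power b 0 n x = x"
| "b_power b (Suc k) n x = b_power b k (n - 1) (b n x)"

definition b_ker ::
    "(int \<Rightarrow> (complex, 'v) module) \<Rightarrow> (int \<Rightarrow> 'v \<Rightarrow> 'v) \<Rightarrow> nat \<Rightarrow> int \<Rightarrow> 'v set"
  where "b_ker C b i n = {x \<in> carrier (C n). b_power b i n x = \<zero>\<^bsub>C (n - int i)\<^esub>}"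

definition b_im ::
    "(int \<Rightarrow> (complex, 'v) module) \<Rightarrow> (int \<Rightarrow> 'v \<Rightarrow> 'v) \<Rightarrow> nat \<Rightarrow> int \<Rightarrow> 'v set"
  where "b_im C b k n = b_power b k (n + int k) ` carrier (C (n + int k))"

definition homology_part ::
    "nat \<Rightarrow> (int \<Rightarrow> (complex, 'v) module) \<Rightarrow> (int \<Rightarrow> 'v \<Rightarrow> 'v) \<Rightarrow> int \<Rightarrow> nat
      \<Rightarrow> (complex, 'v set) module"
  where "homology_part N C b n i =
    quot_mod ((C n)\<lparr>carrier := b_ker C b i n\<rparr>) (b_im C b (N - i) n)"

definition homology ::
    "nat \<Rightarrow> (int \<Rightarrow> (complex, 'v) module) \<Rightarrow> (int \<Rightarrow> 'v \<Rightarrow> 'v) \<Rightarrow> int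
      \<Rightarrow> (complex, nat \<Rightarrow> 'v set) module"
  where "homology N C b n = direct_sum {1..N - 1} (homology_part N C b n)"

text \<open>The class of a family of elements \<^term>\<open>x i \<in> b_ker C b i n\<close>.\<close>

definition homology_class ::
    "nat \<Rightarrow> (int \<Rightarrow> (complex, 'v) module) \<Rightarrow> (int \<Rightarrow> 'v \<Rightarrow> 'v) \<Rightarrow> int \<Rightarrow> (nat \<Rightarrow> 'v)
      \<Rightarrow> nat \<Rightarrow> 'v set"
  where "homology_class N C b n x = (\<lambda>i\<in>{1..N - 1}. b_im C b (N - i) n +>\<^bsub>C n\<^esub> x i)"

text \<open>The map induced by \<open>f : C\<^sub>n \<rightarrow> C\<^sub>n\<close> on each summand. If \<open>f\<close> does not respect
  \<^const>\<open>b_ker\<close> and \<^const>\<open>b_im\<close>, it is meaningless.\<close>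

definition homology_map ::
    "nat \<Rightarrow> (int \<Rightarrow> (complex, 'v) module) \<Rightarrow> (int \<Rightarrow> 'v \<Rightarrow> 'v) \<Rightarrow> int \<Rightarrow> ('v \<Rightarrow> 'v)
      \<Rightarrow> (nat \<Rightarrow> 'v set) \<Rightarrow> nat \<Rightarrow> 'v set"
  where "homology_map N C b n f = (\<lambda>u\<in>carrier (homology N C b n). \<lambda>i\<in>{1..N - 1}.
    the_elem ((\<lambda>x. b_im C b (N - i) n +>\<^bsub>C n\<^esub> f x) ` u i))"

definition qHH ::
    "(complex, 'a, 'm) module_scheme \<Rightarrow> 's simplicial_pset \<Rightarrow> nat \<Rightarrow> complex \<Rightarrow> nat
      \<Rightarrow> (complex, nat \<Rightarrow> ('s, 'a) loday set) module"
  where "qHH A Y N q n = homology N (loday_complex A Y) (q_differential A Y q) (int n)"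

section \<open>Derivations\<close>

text \<open>Derivations are extensional functions on \<^term>\<open>carrier A\<close>, so that those agreeing on \<open>A\<close>
  are equal.\<close>

definition derivations :: "(complex, 'a, 'm) module_scheme \<Rightarrow> ('a \<Rightarrow> 'a) set"
  where "derivations A = {D \<in> lin_maps A A \<inter> extensional (carrier A).
    \<forall>x\<in>carrier A. \<forall>y\<in>carrier A. D (x \<otimes>\<^bsub>A\<^esub> y) = D x \<otimes>\<^bsub>A\<^esub> y \<oplus>\<^bsub>A\<^esub> x \<otimes>\<^bsub>A\<^esub> D y}"

record ('a, 'b) lie_algebra = "('a, 'b) module" +
  bracket :: "'b \<Rightarrow> 'b \<Rightarrow> 'b"

definition Der :: "(complex, 'a, 'm) module_scheme \<Rightarrow> (complex, 'a \<Rightarrow> 'a) lie_algebra"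
  where "Der A =
    \<lparr>carrier = derivations A, monoid.mult = undefined, one = undefined,
     ring.zero = (\<lambda>x\<in>carrier A. \<zero>\<^bsub>A\<^esub>),
     add = (\<lambda>D E. \<lambda>x\<in>carrier A. D x \<oplus>\<^bsub>A\<^esub> E x),
     module.smult = (\<lambda>c D. \<lambda>x\<in>carrier A. c \<odot>\<^bsub>A\<^esub> D x),
     bracket = (\<lambda>D E. \<lambda>x\<in>carrier A. D (E x) \<ominus>\<^bsub>A\<^esub> E (D x))\<rparr>"

definition L_gamma ::
    "(complex, 'a, 'm) module_scheme \<Rightarrow> ('a \<Rightarrow> 'a) \<Rightarrow> nat \<Rightarrow> 'a tensor \<Rightarrow> 'a tensor"
  where "L_gamma A D n = tensor_lift A n (tensor_power A n)
    (\<lambda>a. \<Oplus>\<^bsub>tensor_power A n\<^esub>i\<in>{..n}. pure_tensor A n (a(i := D (a i))))"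

definition L_fin ::
    "(complex, 'a, 'm) module_scheme \<Rightarrow> ('a \<Rightarrow> 'a) \<Rightarrow> 's pset \<Rightarrow> ('s, 'a) loday \<Rightarrow> ('s, 'a) loday"
  where "L_fin A D T =
    loday_lift A T (loday A T) (\<lambda>(m, \<phi>) x. loday_in A T (m, \<phi>) (L_gamma A D m x))"

definition L_level ::
    "(complex, 'a, 'm) module_scheme \<Rightarrow> 's simplicial_pset \<Rightarrow> ('a \<Rightarrow> 'a) \<Rightarrow> nat
      \<Rightarrow> ('s, 'a) loday \<Rightarrow> ('s, 'a) loday"
  where "L_level A Y D n = L_fin A D (sobj Y n)"

definition L_qHH ::
    "(complex, 'a, 'm) module_scheme \<Rightarrow> 's simplicial_pset \<Rightarrow> nat \<Rightarrow> complex \<Rightarrow> ('a \<Rightarrow> 'a) \<Rightarrow> nat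
      \<Rightarrow> (nat \<Rightarrow> ('s, 'a) loday set) \<Rightarrow> nat \<Rightarrow> ('s, 'a) loday set"
  where "L_qHH A Y N q D n =
    homology_map N (loday_complex A Y) (q_differential A Y q) (int n) (L_level A Y D n)"

section \<open>Universal enveloping algebras\<close>

text \<open>The free associative unital algebra on a set \<open>S\<close>; its basis is the words in \<open>S\<close>.\<close>

definition free_algebra :: "'x set \<Rightarrow> (complex, 'x list \<Rightarrow> complex) module"
  where "free_algebra S = (free_space (lists S))
    \<lparr>monoid.mult := (\<lambda>f g w. \<Sum>k\<le>length w. f (take k w) * g (drop k w)), one := free_basis []\<rparr>"

text \<open>The tensor algebra of a vector space: imposing linearity on the letters makes the span of
  the words of length \<open>n\<close> the \<open>n\<close>-th tensor power.\<close>

definition tensor_algebra_rels ::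
    "(complex, 'g, 'm) module_scheme \<Rightarrow> ('g list \<Rightarrow> complex) set"
  where "tensor_algebra_rels V = (let F = free_algebra (carrier V) in Idl\<^bsub>F\<^esub>
    ({free_basis [x \<oplus>\<^bsub>V\<^esub> y] \<ominus>\<^bsub>F\<^esub> (free_basis [x] \<oplus>\<^bsub>F\<^esub> free_basis [y])
        | x y. x \<in> carrier V \<and> y \<in> carrier V} \<union>
     {free_basis [c \<odot>\<^bsub>V\<^esub> x] \<ominus>\<^bsub>F\<^esub> (c \<odot>\<^bsub>F\<^esub> free_basis [x]) | c x. x \<in> carrier V}))"

definition tensor_algebra ::
    "(complex, 'g, 'm) module_scheme \<Rightarrow> (complex, ('g list \<Rightarrow> complex) set) module"
  where "tensor_algebra V = quot_mod (free_algebra (carrier V)) (tensor_algebra_rels V)"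

definition tensor_algebra_in ::
    "(complex, 'g, 'm) module_scheme \<Rightarrow> 'g \<Rightarrow> ('g list \<Rightarrow> complex) set"
  where "tensor_algebra_in V x =
    tensor_algebra_rels V +>\<^bsub>free_algebra (carrier V)\<^esub> free_basis [x]"

type_synonym 'g env = "('g list \<Rightarrow> complex) set set"

definition env_rels :: "(complex, 'g, 'm) lie_algebra_scheme \<Rightarrow> 'g env"
  where "env_rels L = (let T = tensor_algebra L; \<iota> = tensor_algebra_in L in Idl\<^bsub>T\<^esub>
    {(\<iota> x \<otimes>\<^bsub>T\<^esub> \<iota> y \<ominus>\<^bsub>T\<^esub> \<iota> y \<otimes>\<^bsub>T\<^esub> \<iota> x) \<ominus>\<^bsub>T\<^esub> \<iota> (bracket L x y)
      | x y. x \<in> carrier L \<and> y \<in> carrier L})"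

definition universal_env ::
    "(complex, 'g, 'm) lie_algebra_scheme \<Rightarrow> (complex, 'g env) module"
  where "universal_env L = quot_mod (tensor_algebra L) (env_rels L)"

definition env_in :: "(complex, 'g, 'm) lie_algebra_scheme \<Rightarrow> 'g \<Rightarrow> 'g env"
  where "env_in L x = env_rels L +>\<^bsub>tensor_algebra L\<^esub> tensor_algebra_in L x"

text \<open>The library's \<^locale>\<open>module\<close> is restricted to commutative rings.\<close>

locale left_module = R?: ring R + M?: abelian_group M
  for R :: "('r, 'm) ring_scheme" (structure) and M :: "('v, 'n) ring_scheme" (structure) +
  fixes act :: "'r \<Rightarrow> 'v \<Rightarrow> 'v"
  assumes act_closed: "\<lbrakk>r \<in> carrier R; x \<in> carrier M\<rbrakk> \<Longrightarrow> act r x \<in> carrier M"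
    and act_l_distr: "\<lbrakk>r \<in> carrier R; s \<in> carrier R; x \<in> carrier M\<rbrakk> \<Longrightarrow>
      act (r \<oplus>\<^bsub>R\<^esub> s) x = act r x \<oplus>\<^bsub>M\<^esub> act s x"
    and act_r_distr: "\<lbrakk>r \<in> carrier R; x \<in> carrier M; y \<in> carrier M\<rbrakk> \<Longrightarrow>
      act r (x \<oplus>\<^bsub>M\<^esub> y) = act r x \<oplus>\<^bsub>M\<^esub> act r y"
    and act_assoc: "\<lbrakk>r \<in> carrier R; s \<in> carrier R; x \<in> carrier M\<rbrakk> \<Longrightarrow>
      act (r \<otimes>\<^bsub>R\<^esub> s) x = act r (act s x)"
    and act_one: "x \<in> carrier M \<Longrightarrow> act \<one>\<^bsub>R\<^esub> x = x"

end

theory Submission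
  imports Defs
begin

text \<open>The maps \<open>L\<^sub>D\<close> on \<open>\<L>(A)([n])\<close> commute with \<open>\<L>(A)(\<phi>)\<close> by the Leibniz rule (\<open>L_gamma_natural\<close>). So
  they pass to the colimits \<open>\<L>(A)(T)\<close>, where they commute with all maps induced by pointed maps
  (\<open>L_fin_natural\<close>), in particular with the faces of \<open>\<L>\<^sup>Y(A)\<close> and with the \<open>q\<close>-differential. A linear
  endomorphism that commutes with \<open>b\<close> preserves \<open>Ker b\<^sup>i\<close> and \<open>Im b\<^bsup>N-i\<^esup>\<close>, and thus induces maps on
  the homology (\<open>homology_map_class\<close>, \<open>homology_map_lin\<close>).

  That the homology objects are defined at all rests on \<open>b\<^sup>N = 0\<close> (\<open>partial_sum_power\<close>). Let
  \<open>B\<^sub>j = \<Sum>\<^bsub>i\<ge>j\<^esub> q\<^sup>i d\<^sub>i\<close>, so that \<open>B\<^sub>0 = b\<close> and \<open>B\<^sub>j = B\<^bsub>j+1\<^esub> + Y\<close> with \<open>Y = q\<^sup>j d\<^sub>j\<close>. The simplicial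
  identities give \<open>Y B\<^bsub>j+1\<^esub> = q B\<^sub>j Y\<close>, and by induction on \<open>m\<close> this implies
  \<open>B\<^bsub>j+1\<^esub>\<^sup>m = B\<^sub>j\<^sup>m - [m]\<^sub>q B\<^sub>j\<^bsup>m-1\<^esup> Y\<close>. As \<open>[N]\<^sub>q = 0\<close>, all \<open>B\<^sub>j\<^sup>N\<close> agree, and in a fixed degree they vanish
  for large \<open>j\<close>.

  The assignment \<open>D \<mapsto> L\<^sub>D\<close> is linear and carries brackets to commutators: in \<open>L\<^sub>D L\<^sub>E - L\<^sub>E L\<^sub>D\<close> the terms
  in which \<open>D\<close> and \<open>E\<close> act on different tensor factors cancel (\<open>L_gamma_bracket\<close>). This carries over to
  the homology, which is therefore a representation of the Lie algebra \<open>Der(A)\<close>. It extends to the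
  free algebra on \<open>Der(A)\<close>, letting a word act by composition. The ideals that define the tensor
  algebra and then the enveloping algebra act by zero, because their generators do
  (\<open>universal_env_rep\<close>).\<close>

section \<open>Linear algebra over the complex numbers\<close>

lemma complex_ring_simps [simp]:
  "carrier \<C> = UNIV" "a \<oplus>\<^bsub>\<C>\<^esub> b = a + b" "a \<otimes>\<^bsub>\<C>\<^esub> b = a * b" "\<zero>\<^bsub>\<C>\<^esub> = 0" "\<one>\<^bsub>\<C>\<^esub> = 1"
  by (simp_all add: ring_of_type_algebra_def)

lemma complex_ring_minus [simp]: "\<ominus>\<^bsub>\<C>\<^esub> a = - (a::complex)"
proof -
  interpret cring \<C> by (rule cring_from_type_algebra)
  show ?thesis
    using minus_equality[of "- a" a] by simp
qed

text \<open>Negatives come for free: \<open>-x = (-1) x\<close>.\<close>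

lemma vector_spaceI:
  fixes M (structure)
  assumes "\<zero> \<in> carrier M"
    and "\<And>x y. \<lbrakk>x \<in> carrier M; y \<in> carrier M\<rbrakk> \<Longrightarrow> x \<oplus> y \<in> carrier M"
    and "\<And>c x. x \<in> carrier M \<Longrightarrow> c \<odot> x \<in> carrier M"
    and "\<And>x y z. \<lbrakk>x \<in> carrier M; y \<in> carrier M; z \<in> carrier M\<rbrakk> \<Longrightarrow> x \<oplus> y \<oplus> z = x \<oplus> (y \<oplus> z)"
    and "\<And>x y. \<lbrakk>x \<in> carrier M; y \<in> carrier M\<rbrakk> \<Longrightarrow> x \<oplus> y = y \<oplus> x"
    and "\<And>x. x \<in> carrier M \<Longrightarrow> \<zero> \<oplus> x = x"
    and "\<And>x. x \<in> carrier M \<Longrightarrow> (-1) \<odot> x \<oplus> x = \<zero>"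
    and "\<And>a b x. x \<in> carrier M \<Longrightarrow> (a + b) \<odot> x = a \<odot> x \<oplus> b \<odot> x"
    and "\<And>a x y. \<lbrakk>x \<in> carrier M; y \<in> carrier M\<rbrakk> \<Longrightarrow> a \<odot> (x \<oplus> y) = a \<odot> x \<oplus> a \<odot> y"
    and "\<And>a b x. x \<in> carrier M \<Longrightarrow> (a * b) \<odot> x = a \<odot> (b \<odot> x)"
    and "\<And>x. x \<in> carrier M \<Longrightarrow> 1 \<odot> x = x"
  shows "module \<C> M"
proof (rule moduleI)
  show "abelian_group M"
  proof (rule abelian_groupI)
    show "\<exists>y\<in>carrier M. y \<oplus> x = \<zero>" if "x \<in> carrier M" for x
      using assms(3,7) that by metis
  qed (fact assms(1,2,4,5,6))+
qed (use assms in \<open>auto intro: cring_from_type_algebra\<close>)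

lemma (in abelian_group) minus_eq_zero_iff:
  assumes "x \<in> carrier G" "y \<in> carrier G"
  shows "x \<ominus> y = \<zero> \<longleftrightarrow> x = y"
  using assms by (simp add: a_minus_def add.inv_solve_right' r_neg)

lemma submodule_additive_subgroup: "submodule W R M \<Longrightarrow> additive_subgroup W M"
  by (simp add: additive_subgroup_def submodule_def)

lemma submodule_abelian_subgroup:
  assumes "module \<C> M" and "submodule W \<C> M"
  shows "abelian_subgroup W M"
  using assms by (intro abelian_subgroupI3 submodule_additive_subgroup) (auto simp: module_def)

lemma submodule_subset: "submodule W R M \<Longrightarrow> W \<subseteq> carrier M"
  using additive_subgroup.a_subset submodule_additive_subgroup by blast

lemma submodule_smult: "submodule W \<C> M \<Longrightarrow> x \<in> W \<Longrightarrow> c \<odot>\<^bsub>M\<^esub> x \<in> W"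
  using submodule.smult_closed[of W \<C> M c x] by simp

lemma submoduleI_complex:
  assumes "module \<C> M" "W \<subseteq> carrier M" "\<zero>\<^bsub>M\<^esub> \<in> W"
    and "\<And>x y. x \<in> W \<Longrightarrow> y \<in> W \<Longrightarrow> x \<oplus>\<^bsub>M\<^esub> y \<in> W"
    and smult: "\<And>c x. x \<in> W \<Longrightarrow> c \<odot>\<^bsub>M\<^esub> x \<in> W"
  shows "submodule W \<C> M"
proof -
  interpret M: module \<C> M by fact
  have "\<ominus>\<^bsub>M\<^esub> x \<in> W" if "x \<in> W" for x
    using smult[OF that, of "-1"] M.smult_l_minus[of 1 x] M.smult_one[of x] that assms(2) by auto
  with assms show ?thesis by (intro M.submoduleI) auto
qed

subsection \<open>Linear maps\<close>

lemma lin_mapsI: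
  assumes "\<And>x. x \<in> carrier M \<Longrightarrow> f x \<in> carrier N"
    and "\<And>x y. \<lbrakk>x \<in> carrier M; y \<in> carrier M\<rbrakk> \<Longrightarrow> f (x \<oplus>\<^bsub>M\<^esub> y) = f x \<oplus>\<^bsub>N\<^esub> f y"
    and "\<And>c x. x \<in> carrier M \<Longrightarrow> f (c \<odot>\<^bsub>M\<^esub> x) = c \<odot>\<^bsub>N\<^esub> f x"
  shows "f \<in> lin_maps M N"
  using assms by (auto simp: lin_maps_def)

lemma lin_closed: "f \<in> lin_maps M N \<Longrightarrow> x \<in> carrier M \<Longrightarrow> f x \<in> carrier N"
  by (auto simp: lin_maps_def)

lemma lin_add: "f \<in> lin_maps M N \<Longrightarrow> x \<in> carrier M \<Longrightarrow> y \<in> carrier M \<Longrightarrow>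
    f (x \<oplus>\<^bsub>M\<^esub> y) = f x \<oplus>\<^bsub>N\<^esub> f y"
  by (auto simp: lin_maps_def)

lemma lin_smult: "f \<in> lin_maps M N \<Longrightarrow> x \<in> carrier M \<Longrightarrow> f (c \<odot>\<^bsub>M\<^esub> x) = c \<odot>\<^bsub>N\<^esub> f x"
  by (auto simp: lin_maps_def)

lemma lin_zero:
  assumes "module \<C> M" "module \<C> N" "f \<in> lin_maps M N"
  shows "f \<zero>\<^bsub>M\<^esub> = \<zero>\<^bsub>N\<^esub>"
proof -
  interpret M: module \<C> M by fact
  interpret N: module \<C> N by fact
  have "f (0 \<odot>\<^bsub>M\<^esub> \<zero>\<^bsub>M\<^esub>) = 0 \<odot>\<^bsub>N\<^esub> f \<zero>\<^bsub>M\<^esub>"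
    using assms(3) by (intro lin_smult) auto
  then show ?thesis
    using M.smult_l_null[of "\<zero>\<^bsub>M\<^esub>"] N.smult_l_null[of "f \<zero>\<^bsub>M\<^esub>"] lin_closed[OF assms(3)] by auto
qed

lemma lin_minus:
  assumes "module \<C> M" "module \<C> N" "f \<in> lin_maps M N" "x \<in> carrier M" "y \<in> carrier M"
  shows "f (x \<ominus>\<^bsub>M\<^esub> y) = f x \<ominus>\<^bsub>N\<^esub> f y"
proof -
  interpret M: module \<C> M by fact
  interpret N: module \<C> N by fact
  have "f (\<ominus>\<^bsub>M\<^esub> y) = \<ominus>\<^bsub>N\<^esub> f y"
    using M.smult_l_minus[of 1 y] N.smult_l_minus[of 1 "f y"] lin_smult[OF assms(3), of y "-1"]
      lin_closed[OF assms(3)] assms(4,5) M.smult_one[of y] N.smult_one[of "f y"] by simp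
  then show ?thesis using assms by (simp add: a_minus_def lin_add)
qed

lemma lin_finsum:
  assumes "module \<C> M" "module \<C> N" "f \<in> lin_maps M N" "g \<in> I \<rightarrow> carrier M"
  shows "f (\<Oplus>\<^bsub>M\<^esub>i\<in>I. g i) = (\<Oplus>\<^bsub>N\<^esub>i\<in>I. f (g i))"
proof -
  interpret M: module \<C> M by fact
  interpret N: module \<C> N by fact
  show ?thesis using assms(4)
  proof (induction I rule: infinite_finite_induct)
    case (insert i I)
    then show ?case using lin_closed[OF assms(3)]
      by (simp add: Pi_iff lin_add[OF assms(3)])
  qed (use lin_zero[OF assms(1-3)] in \<open>auto simp: M.finsum_infinite N.finsum_infinite\<close>)
qed

lemma lin_comp: "f \<in> lin_maps M N \<Longrightarrow> g \<in> lin_maps N P \<Longrightarrow> (\<lambda>x. g (f x)) \<in> lin_maps M P"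
  by (auto simp: lin_maps_def Pi_iff)

lemma lin_cong: "f \<in> lin_maps M N \<Longrightarrow> (\<And>x. x \<in> carrier M \<Longrightarrow> f x = g x) \<Longrightarrow> module \<C> M \<Longrightarrow> g \<in> lin_maps M N"
proof -
  assume a: "f \<in> lin_maps M N" "\<And>x. x \<in> carrier M \<Longrightarrow> f x = g x" "module \<C> M"
  interpret M: module \<C> M by fact
  from a M.smult_closed show ?thesis by (auto simp: lin_maps_def Pi_iff)
qed

lemma lin_id: "(\<lambda>x. x) \<in> lin_maps M M"
  by (auto simp: lin_maps_def)

lemma lin_const_zero: "module \<C> N \<Longrightarrow> (\<lambda>x. \<zero>\<^bsub>N\<^esub>) \<in> lin_maps M N"
proof -
  assume "module \<C> N"
  then interpret N: module \<C> N .
  show ?thesis using N.smult_r_null by (auto simp: lin_maps_def)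
qed

lemma lin_sum:
  assumes "module \<C> N" and f: "f \<in> lin_maps M N" and g: "g \<in> lin_maps M N"
  shows "(\<lambda>x. f x \<oplus>\<^bsub>N\<^esub> g x) \<in> lin_maps M N"
proof -
  interpret N: module \<C> N by fact
  show ?thesis
    by (rule lin_mapsI)
      (simp_all add: lin_add[OF f] lin_add[OF g] lin_smult[OF f] lin_smult[OF g]
        lin_closed[OF f] lin_closed[OF g] N.a_ac N.smult_r_distr)
qed

lemma lin_scale:
  assumes "module \<C> N" and f: "f \<in> lin_maps M N"
  shows "(\<lambda>x. c \<odot>\<^bsub>N\<^esub> f x) \<in> lin_maps M N"
proof -
  interpret N: module \<C> N by fact
  have "a \<odot>\<^bsub>N\<^esub> (b \<odot>\<^bsub>N\<^esub> x) = b \<odot>\<^bsub>N\<^esub> (a \<odot>\<^bsub>N\<^esub> x)" if "x \<in> carrier N" for a b x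
    using N.smult_assoc1[of a b x] N.smult_assoc1[of b a x] that by (simp add: mult.commute)
  then show ?thesis
    by (intro lin_mapsI)
      (simp_all add: lin_add[OF f] lin_smult[OF f] lin_closed[OF f] N.smult_r_distr)
qed

lemma lin_diff:
  assumes "module \<C> M" "module \<C> N" and f: "f \<in> lin_maps M N" and g: "g \<in> lin_maps M N"
  shows "(\<lambda>x. f x \<ominus>\<^bsub>N\<^esub> g x) \<in> lin_maps M N"
proof -
  interpret N: module \<C> N by fact
  have "(\<lambda>x. f x \<oplus>\<^bsub>N\<^esub> (-1) \<odot>\<^bsub>N\<^esub> g x) \<in> lin_maps M N"
    by (intro lin_sum lin_scale assms)
  moreover have "f x \<ominus>\<^bsub>N\<^esub> g x = f x \<oplus>\<^bsub>N\<^esub> (-1) \<odot>\<^bsub>N\<^esub> g x" if "x \<in> carrier M" for x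
    using N.smult_l_minus[of 1 "g x"] N.smult_one[of "g x"] lin_closed[OF g that]
    by (simp add: a_minus_def)
  ultimately show ?thesis
    using assms(1) by (rule lin_cong[OF _ sym])
qed

lemma lin_finsum_maps:
  assumes "module \<C> M" "module \<C> N" "\<And>i. i \<in> I \<Longrightarrow> f i \<in> lin_maps M N"
  shows "(\<lambda>x. \<Oplus>\<^bsub>N\<^esub>i\<in>I. f i x) \<in> lin_maps M N"
proof -
  interpret N: module \<C> N by fact
  show ?thesis using assms(3)
  proof (induction I rule: infinite_finite_induct)
    case (insert i I)
    have eq: "f i x \<oplus>\<^bsub>N\<^esub> (\<Oplus>\<^bsub>N\<^esub>j\<in>I. f j x) = (\<Oplus>\<^bsub>N\<^esub>j\<in>insert i I. f j x)"
      if "x \<in> carrier M" for x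
      using insert that lin_closed[of _ M N x] by (intro N.finsum_insert[symmetric]) auto
    have "(\<lambda>x. f i x \<oplus>\<^bsub>N\<^esub> (\<Oplus>\<^bsub>N\<^esub>j\<in>I. f j x)) \<in> lin_maps M N"
      using insert by (intro lin_sum assms(2)) auto
    then show ?case
      using eq assms(1) by (rule lin_cong)
  qed (auto simp: N.finsum_infinite lin_const_zero[OF assms(2)])
qed

subsection \<open>Spans\<close>

lemma submodule_lin_span:
  assumes "module \<C> M" "S \<subseteq> carrier M"
  shows "submodule (lin_span M S) \<C> M"
proof -
  interpret M: module \<C> M by fact
  have sub: "lin_span M S \<subseteq> carrier M"
    using M.carrier_is_submodule assms(2) by (auto simp: lin_span_def)
  show ?thesis
  proof (rule submoduleI_complex[OF assms(1) sub])
    show "\<zero>\<^bsub>M\<^esub> \<in> lin_span M S"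
      by (auto simp: lin_span_def intro: additive_subgroup.zero_closed submodule_additive_subgroup)
    show "x \<oplus>\<^bsub>M\<^esub> y \<in> lin_span M S" if "x \<in> lin_span M S" "y \<in> lin_span M S" for x y
      using that by (auto simp: lin_span_def intro: additive_subgroup.a_closed submodule_additive_subgroup)
    show "c \<odot>\<^bsub>M\<^esub> x \<in> lin_span M S" if "x \<in> lin_span M S" for c x
      using that by (auto simp: lin_span_def intro: submodule_smult)
  qed
qed

lemma lin_span_base: "x \<in> S \<Longrightarrow> x \<in> lin_span M S"
  by (auto simp: lin_span_def)

lemma lin_span_minimal: "submodule W \<C> M \<Longrightarrow> S \<subseteq> W \<Longrightarrow> lin_span M S \<subseteq> W"
  by (auto simp: lin_span_def)

lemma submodule_kernel:
  assumes "module \<C> M" "module \<C> N" and f: "f \<in> lin_maps M N"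
  shows "submodule {x \<in> carrier M. f x = \<zero>\<^bsub>N\<^esub>} \<C> M"
proof -
  interpret M: module \<C> M by fact
  interpret N: module \<C> N by fact
  show ?thesis
    using lin_zero[OF assms] N.smult_r_null
    by (intro submoduleI_complex[OF assms(1)]) (auto simp: lin_add[OF f] lin_smult[OF f])
qed

lemma submodule_image:
  assumes "module \<C> M" "module \<C> N" and f: "f \<in> lin_maps M N"
  shows "submodule (f ` carrier M) \<C> N"
proof -
  interpret M: module \<C> M by fact
  show ?thesis
  proof (rule submoduleI_complex[OF assms(2)])
    show "\<zero>\<^bsub>N\<^esub> \<in> f ` carrier M"
      using lin_zero[OF assms] M.zero_closed by (metis imageI)
    show "x \<oplus>\<^bsub>N\<^esub> y \<in> f ` carrier M" if "x \<in> f ` carrier M" "y \<in> f ` carrier M" for x y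
      using that by (auto simp flip: lin_add[OF f])
    show "c \<odot>\<^bsub>N\<^esub> x \<in> f ` carrier M" if "x \<in> f ` carrier M" for c x
      using that M.smult_closed by (auto simp flip: lin_smult[OF f])
  qed (use lin_closed[OF f] in auto)
qed

lemma lin_span_kernel:
  assumes "module \<C> M" "module \<C> N" "f \<in> lin_maps M N" "S \<subseteq> carrier M"
    and "\<And>s. s \<in> S \<Longrightarrow> f s = \<zero>\<^bsub>N\<^esub>" and "x \<in> lin_span M S"
  shows "f x = \<zero>\<^bsub>N\<^esub>"
  using lin_span_minimal[OF submodule_kernel[OF assms(1-3)], of S] assms(4-6) by auto

subsection \<open>Quotients\<close>

lemma quot_mod_simps:
  "carrier (quot_mod M W) = (\<lambda>x. W +>\<^bsub>M\<^esub> x) ` carrier M"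
  "\<zero>\<^bsub>quot_mod M W\<^esub> = W"
  "\<one>\<^bsub>quot_mod M W\<^esub> = W +>\<^bsub>M\<^esub> \<one>\<^bsub>M\<^esub>"
  "K \<oplus>\<^bsub>quot_mod M W\<^esub> K' = set_add M K K'"
  "K \<otimes>\<^bsub>quot_mod M W\<^esub> K' = rcoset_mult M W K K'"
  by (auto simp: quot_mod_def A_RCOSETS_def' )

lemma coset_carrier_update: "a_r_coset (M\<lparr>carrier := B\<rparr>) W x = W +>\<^bsub>M\<^esub> x"
  by (simp add: a_r_coset_def')

context
  fixes M :: "(complex, 'v, 'm) module_scheme" and W :: "'v set"
  assumes M: "module \<C> M" and W: "submodule W \<C> M"
begin

interpretation M: module \<C> M by (rule M)
interpretation W: abelian_subgroup W M by (rule submodule_abelian_subgroup[OF M W])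

lemma coset_eq_iff:
  assumes "x \<in> carrier M" "y \<in> carrier M"
  shows "W +>\<^bsub>M\<^esub> x = W +>\<^bsub>M\<^esub> y \<longleftrightarrow> x \<ominus>\<^bsub>M\<^esub> y \<in> W"
proof
  assume "W +>\<^bsub>M\<^esub> x = W +>\<^bsub>M\<^esub> y"
  then have "x \<in> W +>\<^bsub>M\<^esub> y" using W.a_rcos_self[OF assms(1)] by simp
  then show "x \<ominus>\<^bsub>M\<^esub> y \<in> W" using W.a_rcos_module_imp[OF assms(2)] by (simp add: a_minus_def)
next
  assume "x \<ominus>\<^bsub>M\<^esub> y \<in> W"
  then have "x \<in> W +>\<^bsub>M\<^esub> y" using W.a_rcos_module_rev[OF assms(2,1)] by (simp add: a_minus_def)
  then show "W +>\<^bsub>M\<^esub> x = W +>\<^bsub>M\<^esub> y" using W.a_repr_independence'[OF _ assms(2)] by simp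
qed

lemma coset_eq_zero_iff:
  assumes "x \<in> carrier M"
  shows "W +>\<^bsub>M\<^esub> x = W \<longleftrightarrow> x \<in> W"
  using W.a_rcos_const[of x] W.a_rcos_self[OF assms] by auto

lemma coset_member:
  assumes "x \<in> carrier M" "y \<in> W +>\<^bsub>M\<^esub> x"
  shows "y \<in> carrier M" "W +>\<^bsub>M\<^esub> y = W +>\<^bsub>M\<^esub> x" "y \<ominus>\<^bsub>M\<^esub> x \<in> W"
  using W.a_elemrcos_carrier[OF assms] W.a_repr_independence'[OF assms(2,1)]
    W.a_rcos_module_imp[OF assms]
  by (auto simp: a_minus_def)

lemma quot_mod_add:
  "x \<in> carrier M \<Longrightarrow> y \<in> carrier M \<Longrightarrow>
    (W +>\<^bsub>M\<^esub> x) \<oplus>\<^bsub>quot_mod M W\<^esub> (W +>\<^bsub>M\<^esub> y) = W +>\<^bsub>M\<^esub> (x \<oplus>\<^bsub>M\<^esub> y)"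
  by (simp add: quot_mod_simps W.a_rcos_sum)

lemma quot_mod_smult:
  assumes "x \<in> carrier M"
  shows "c \<odot>\<^bsub>quot_mod M W\<^esub> (W +>\<^bsub>M\<^esub> x) = W +>\<^bsub>M\<^esub> (c \<odot>\<^bsub>M\<^esub> x)"
proof -
  have "W +>\<^bsub>M\<^esub> (c \<odot>\<^bsub>M\<^esub> y) = W +>\<^bsub>M\<^esub> (c \<odot>\<^bsub>M\<^esub> x)" if y: "y \<in> W +>\<^bsub>M\<^esub> x" for y
  proof -
    note y' = coset_member[OF assms y]
    have "c \<odot>\<^bsub>M\<^esub> y \<ominus>\<^bsub>M\<^esub> c \<odot>\<^bsub>M\<^esub> x = c \<odot>\<^bsub>M\<^esub> (y \<ominus>\<^bsub>M\<^esub> x)"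
      using y' assms by (simp add: a_minus_def M.smult_r_distr M.smult_r_minus)
    with y' show ?thesis
      using assms by (subst coset_eq_iff) (auto intro: submodule_smult[OF W])
  qed
  then have "(\<Union>y\<in>W +>\<^bsub>M\<^esub> x. W +>\<^bsub>M\<^esub> (c \<odot>\<^bsub>M\<^esub> y)) = (\<Union>y\<in>W +>\<^bsub>M\<^esub> x. W +>\<^bsub>M\<^esub> (c \<odot>\<^bsub>M\<^esub> x))"
    by (rule SUP_cong[OF refl])
  also have "\<dots> = W +>\<^bsub>M\<^esub> (c \<odot>\<^bsub>M\<^esub> x)"
    using W.a_rcos_self[OF assms] by (metis UN_constant empty_iff)
  finally show ?thesis by (simp add: quot_mod_def)
qed

lemma coset_in_quot: "x \<in> carrier M \<Longrightarrow> W +>\<^bsub>M\<^esub> x \<in> carrier (quot_mod M W)"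
  by (auto simp: quot_mod_simps)

lemma quot_cases:
  assumes "K \<in> carrier (quot_mod M W)"
  obtains x where "x \<in> carrier M" "K = W +>\<^bsub>M\<^esub> x"
  using assms by (auto simp: quot_mod_simps)

lemma quot_zero_eq: "\<zero>\<^bsub>quot_mod M W\<^esub> = W +>\<^bsub>M\<^esub> \<zero>\<^bsub>M\<^esub>"
  using coset_eq_zero_iff[of "\<zero>\<^bsub>M\<^esub>"] by (simp add: quot_mod_simps)

lemma module_quot_mod: "module \<C> (quot_mod M W)"
proof (rule vector_spaceI, goal_cases)
  case 1 show ?case by (simp add: quot_zero_eq coset_in_quot)
next
  case (2 x y) then show ?case by (auto elim!: quot_cases simp: quot_mod_add coset_in_quot)
next
  case (3 c x) then show ?case by (auto elim!: quot_cases simp: quot_mod_smult coset_in_quot)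
next
  case (4 x y z) then show ?case by (auto elim!: quot_cases simp: quot_mod_add M.a_assoc)
next
  case (5 x y) then show ?case by (auto elim!: quot_cases simp: quot_mod_add M.a_comm)
next
  case (6 x) then show ?case by (auto elim!: quot_cases simp: quot_mod_add quot_zero_eq)
next
  case (7 x)
  have "(-1) \<odot>\<^bsub>M\<^esub> x \<oplus>\<^bsub>M\<^esub> x = \<zero>\<^bsub>M\<^esub>" if "x \<in> carrier M" for x
    using M.smult_l_minus[of 1 x] M.smult_one[of x] that by (simp add: M.l_neg)
  with 7 show ?case by (auto elim!: quot_cases simp: quot_mod_add quot_mod_smult quot_zero_eq)
next
  case (8 a b x) then show ?case
    using M.smult_l_distr[of a b] by (auto elim!: quot_cases simp: quot_mod_add quot_mod_smult)
next
  case (9 a x y) then show ?case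
    by (auto elim!: quot_cases simp: quot_mod_add quot_mod_smult M.smult_r_distr)
next
  case (10 a b x) then show ?case
    using M.smult_assoc1[of a b] by (auto elim!: quot_cases simp: quot_mod_smult)
next
  case (11 x) then show ?case
    using M.smult_one by (auto elim!: quot_cases simp: quot_mod_smult)
qed

lemma quot_proj_lin: "(\<lambda>x. W +>\<^bsub>M\<^esub> x) \<in> lin_maps M (quot_mod M W)"
  by (rule lin_mapsI) (simp_all add: coset_in_quot quot_mod_add quot_mod_smult)

text \<open>The value of \<^const>\<open>the_elem\<close> in a map out of a quotient that is given by representatives.\<close>

lemma image_coset:
  assumes N: "module \<C> N" and f: "f \<in> lin_maps M N" and "\<And>w. w \<in> W \<Longrightarrow> f w = \<zero>\<^bsub>N\<^esub>"
    and x: "x \<in> carrier M"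
  shows "f ` (W +>\<^bsub>M\<^esub> x) = {f x}"
proof -
  interpret N: module \<C> N by fact
  have "f y = f x" if y: "y \<in> W +>\<^bsub>M\<^esub> x" for y
  proof -
    note y' = coset_member[OF x y]
    have "f y \<ominus>\<^bsub>N\<^esub> f x = \<zero>\<^bsub>N\<^esub>"
      using assms(3)[OF y'(3)] lin_minus[OF M N f y'(1) x] by simp
    then show ?thesis using lin_closed[OF f] y'(1) x N.minus_eq_zero_iff by blast
  qed
  then have "f ` (W +>\<^bsub>M\<^esub> x) \<subseteq> {f x}" by blast
  then show ?thesis using W.a_rcos_self[OF x] by blast
qed

lemma lin_from_quot:
  assumes f: "f \<in> lin_maps M N" and F: "\<And>x. x \<in> carrier M \<Longrightarrow> F (W +>\<^bsub>M\<^esub> x) = f x"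
  shows "F \<in> lin_maps (quot_mod M W) N"
proof (rule lin_mapsI, goal_cases)
  case (1 x) then show ?case by (auto elim!: quot_cases simp: F lin_closed[OF f])
next
  case (2 x y) then show ?case by (auto elim!: quot_cases simp: F quot_mod_add lin_add[OF f])
next
  case (3 c x) then show ?case by (auto elim!: quot_cases simp: F quot_mod_smult lin_smult[OF f])
qed

end

subsection \<open>Free vector spaces\<close>

lemma free_space_simps:
  "f \<in> carrier (free_space S) \<longleftrightarrow> finite {x. f x \<noteq> 0} \<and> {x. f x \<noteq> 0} \<subseteq> S"
  "\<zero>\<^bsub>free_space S\<^esub> = (\<lambda>_. 0)"
  "f \<oplus>\<^bsub>free_space S\<^esub> g = (\<lambda>x. f x + g x)"
  "c \<odot>\<^bsub>free_space S\<^esub> f = (\<lambda>x. c * f x)"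
  by (auto simp: free_space_def)

lemma free_space_add_closed:
  assumes "f \<in> carrier (free_space S)" "g \<in> carrier (free_space S)"
  shows "(\<lambda>x. f x + g x) \<in> carrier (free_space S)"
proof -
  have "{x. f x + g x \<noteq> 0} \<subseteq> {x. f x \<noteq> 0} \<union> {x. g x \<noteq> 0}" by auto
  moreover have "finite ({x. f x \<noteq> 0} \<union> {x. g x \<noteq> 0})"
    using assms by (simp add: free_space_simps)
  ultimately show ?thesis
    using assms unfolding free_space_simps by (meson finite_subset le_sup_iff order_trans)
qed

lemma module_free_space: "module \<C> (free_space S)"
proof (rule vector_spaceI, goal_cases)
  case (3 c x)
  then have "finite {y. c * x y \<noteq> 0}"
    unfolding free_space_simps by (auto elim: finite_subset[rotated])
  with 3 show ?case by (auto simp: free_space_simps)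
qed (auto simp: free_space_simps(2-4) free_space_add_closed algebra_simps, auto simp: free_space_simps)

lemma free_basis_closed: "x \<in> S \<Longrightarrow> free_basis x \<in> carrier (free_space S)"
  by (auto simp: free_space_simps free_basis_def)

lemma free_space_induct [consumes 1, case_names zero basis add]:
  assumes "f \<in> carrier (free_space S)"
    and zero: "P \<zero>\<^bsub>free_space S\<^esub>"
    and basis: "\<And>c x. x \<in> S \<Longrightarrow> P (c \<odot>\<^bsub>free_space S\<^esub> free_basis x)"
    and add: "\<And>f g. \<lbrakk>f \<in> carrier (free_space S); g \<in> carrier (free_space S); P f; P g\<rbrakk>
      \<Longrightarrow> P (f \<oplus>\<^bsub>free_space S\<^esub> g)"
  shows "P f"
proof -
  interpret F: module \<C> "free_space S" by (rule module_free_space)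
  have "f \<in> carrier (free_space S) \<Longrightarrow> {x. f x \<noteq> 0} \<subseteq> B \<Longrightarrow> P f" if "finite B" for B
    using that
  proof (induction B arbitrary: f)
    case empty
    then have "f = (\<lambda>_. 0)" by auto
    then show ?case using zero by (simp add: free_space_simps)
  next
    case (insert x B)
    show ?case
    proof (cases "f x = 0")
      case False
      then have x: "x \<in> S" using insert.prems by (auto simp: free_space_simps)
      define g where "g = f(x := 0)"
      have "finite {y. g y \<noteq> 0}"
        using insert.prems(1) unfolding free_space_simps g_def by (auto elim: finite_subset[rotated])
      then have g: "g \<in> carrier (free_space S)" "{x. g x \<noteq> 0} \<subseteq> B"
        using insert.prems by (auto simp: free_space_simps g_def split: if_splits)
      have "f = f x \<odot>\<^bsub>free_space S\<^esub> free_basis x \<oplus>\<^bsub>free_space S\<^esub> g"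
        by (auto simp: free_space_simps g_def free_basis_def)
      then show ?thesis
        using add[OF F.smult_closed[OF _ free_basis_closed[OF x]] g(1) basis[OF x] insert.IH[OF g], of "f x"]
        by auto
    qed (use insert in auto)
  qed
  then show ?thesis
    using assms(1) by (auto simp: free_space_simps)
qed

lemma free_space_lin_ext:
  assumes "module \<C> N" and F: "F \<in> lin_maps (free_space S) N" and G: "G \<in> lin_maps (free_space S) N"
    and eq: "\<And>x. x \<in> S \<Longrightarrow> F (free_basis x) = G (free_basis x)"
    and f: "f \<in> carrier (free_space S)"
  shows "F f = G f"
  using f
proof (induction rule: free_space_induct)
  case zero
  then show ?case using lin_zero[OF module_free_space assms(1)] F G by metis
qed (simp_all add: lin_smult[OF F] lin_smult[OF G] lin_add[OF F] lin_add[OF G] free_basis_closed eq)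

lemma free_lift_lin:
  assumes N: "module \<C> N" and g: "g \<in> S \<rightarrow> carrier N"
  shows "(\<lambda>f. \<Oplus>\<^bsub>N\<^esub>a\<in>{a. f a \<noteq> 0}. f a \<odot>\<^bsub>N\<^esub> g a) \<in> lin_maps (free_space S) N"
proof -
  interpret N: module \<C> N by fact
  interpret F: module \<C> "free_space S" by (rule module_free_space)
  have sup: "(\<Oplus>\<^bsub>N\<^esub>a\<in>{a. f a \<noteq> 0}. f a \<odot>\<^bsub>N\<^esub> g a) = (\<Oplus>\<^bsub>N\<^esub>a\<in>B. f a \<odot>\<^bsub>N\<^esub> g a)"
    if "finite B" "B \<subseteq> S" "{a. f a \<noteq> 0} \<subseteq> B" for f B
    using that g N.smult_l_null
    by (intro N.add.finprod_mono_neutral_cong_left) (auto simp: Pi_iff)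
  show ?thesis
  proof (rule lin_mapsI, goal_cases)
    case (1 f)
    then show ?case using g by (intro N.finsum_closed) (auto simp: free_space_simps Pi_iff subset_iff)
  next
    case (2 f h)
    define B where "B = {a. f a \<noteq> 0} \<union> {a. h a \<noteq> 0}"
    have B: "finite B" "B \<subseteq> S" using 2 by (auto simp: free_space_simps B_def)
    have gX: "g a \<in> carrier N" if "a \<in> B" for a using B(2) g that by auto
    have "(\<Oplus>\<^bsub>N\<^esub>a\<in>B. (f a + h a) \<odot>\<^bsub>N\<^esub> g a) = (\<Oplus>\<^bsub>N\<^esub>a\<in>B. f a \<odot>\<^bsub>N\<^esub> g a \<oplus>\<^bsub>N\<^esub> h a \<odot>\<^bsub>N\<^esub> g a)"
      using gX N.smult_l_distr[of "f _" "h _" "g _"]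
      by (intro N.finsum_cong') auto
    also have "\<dots> = (\<Oplus>\<^bsub>N\<^esub>a\<in>B. f a \<odot>\<^bsub>N\<^esub> g a) \<oplus>\<^bsub>N\<^esub> (\<Oplus>\<^bsub>N\<^esub>a\<in>B. h a \<odot>\<^bsub>N\<^esub> g a)"
      using gX by (intro N.finsum_addf) auto
    finally show ?case
      using B by (subst (1 2 3) sup[of B]) (auto simp: B_def free_space_simps)
  next
    case (3 c f)
    define B where "B = {a. f a \<noteq> 0}"
    have B: "finite B" "B \<subseteq> S" using 3 by (auto simp: free_space_simps B_def)
    have gX: "g a \<in> carrier N" if "a \<in> B" for a using B(2) g that by auto
    have "(\<Oplus>\<^bsub>N\<^esub>a\<in>B. (c * f a) \<odot>\<^bsub>N\<^esub> g a) = (\<Oplus>\<^bsub>N\<^esub>a\<in>B. c \<odot>\<^bsub>N\<^esub> (f a \<odot>\<^bsub>N\<^esub> g a))"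
      using gX N.smult_assoc1[of c "f _" "g _"] by (intro N.finsum_cong') auto
    also have "\<dots> = c \<odot>\<^bsub>N\<^esub> (\<Oplus>\<^bsub>N\<^esub>a\<in>B. f a \<odot>\<^bsub>N\<^esub> g a)"
      using gX B by (intro N.finsum_smult_ldistr[symmetric]) auto
    finally show ?case
      using B by (subst (1 2) sup[of B]) (auto simp: B_def free_space_simps)
  qed
qed

lemma free_lift_basis:
  assumes N: "module \<C> N" and g: "g x \<in> carrier N"
  shows "(\<Oplus>\<^bsub>N\<^esub>a\<in>{a. free_basis x a \<noteq> 0}. free_basis x a \<odot>\<^bsub>N\<^esub> g a) = g x"
proof -
  interpret N: module \<C> N by fact
  have "{a. free_basis x a \<noteq> 0} = {x}" by (auto simp: free_basis_def)
  then show ?thesis using g N.smult_one[OF g] by (simp add: free_basis_def)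
qed

subsection \<open>Direct sums\<close>

lemma direct_sum_simps:
  "u \<in> carrier (direct_sum I M) \<longleftrightarrow>
    u \<in> (\<Pi>\<^sub>E i\<in>I. carrier (M i)) \<and> finite {i \<in> I. u i \<noteq> \<zero>\<^bsub>M i\<^esub>}"
  "\<zero>\<^bsub>direct_sum I M\<^esub> = (\<lambda>i\<in>I. \<zero>\<^bsub>M i\<^esub>)"
  "u \<oplus>\<^bsub>direct_sum I M\<^esub> v = (\<lambda>i\<in>I. u i \<oplus>\<^bsub>M i\<^esub> v i)"
  "c \<odot>\<^bsub>direct_sum I M\<^esub> u = (\<lambda>i\<in>I. c \<odot>\<^bsub>M i\<^esub> u i)"
  by (auto simp: direct_sum_def)

context
  fixes I :: "'i set" and M :: "'i \<Rightarrow> (complex, 'v, 'm) module_scheme"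
  assumes M_ball: "\<forall>i\<in>I. module \<C> (M i)"
begin

private lemma M: "i \<in> I \<Longrightarrow> module \<C> (M i)"
  using M_ball by blast

lemma direct_sum_ext:
  assumes "u \<in> carrier (direct_sum I M)" "v \<in> carrier (direct_sum I M)"
    and "\<And>i. i \<in> I \<Longrightarrow> u i = v i"
  shows "u = v"
  using assms by (auto simp: direct_sum_simps intro: PiE_ext)

lemma direct_sum_zero_closed: "\<zero>\<^bsub>direct_sum I M\<^esub> \<in> carrier (direct_sum I M)"
proof -
  have "{i \<in> I. (\<lambda>i\<in>I. \<zero>\<^bsub>M i\<^esub>) i \<noteq> \<zero>\<^bsub>M i\<^esub>} = {}" by auto
  then show ?thesis
    using module.axioms(2)[OF M] by (auto simp: direct_sum_simps abelian_group_def abelian_monoidE(2))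
qed

lemma direct_sum_add_closed:
  assumes u: "u \<in> carrier (direct_sum I M)" and v: "v \<in> carrier (direct_sum I M)"
  shows "u \<oplus>\<^bsub>direct_sum I M\<^esub> v \<in> carrier (direct_sum I M)"
proof -
  have c: "u i \<oplus>\<^bsub>M i\<^esub> v i \<in> carrier (M i)" if i: "i \<in> I" for i
  proof -
    interpret M: module \<C> "M i" by (rule M[OF i])
    show ?thesis using u v i by (auto simp: direct_sum_simps)
  qed
  have z: "\<zero>\<^bsub>M i\<^esub> \<oplus>\<^bsub>M i\<^esub> \<zero>\<^bsub>M i\<^esub> = \<zero>\<^bsub>M i\<^esub>" if i: "i \<in> I" for i
  proof -
    interpret M: module \<C> "M i" by (rule M[OF i])
    show ?thesis by simp
  qed
  have "{i \<in> I. (\<lambda>i\<in>I. u i \<oplus>\<^bsub>M i\<^esub> v i) i \<noteq> \<zero>\<^bsub>M i\<^esub>}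
      \<subseteq> {i \<in> I. u i \<noteq> \<zero>\<^bsub>M i\<^esub>} \<union> {i \<in> I. v i \<noteq> \<zero>\<^bsub>M i\<^esub>}"
    using z by auto
  then show ?thesis
    using u v c unfolding direct_sum_simps
    by (intro conjI restrict_PiE_iff[THEN iffD2] ballI; elim conjE) (blast, erule finite_subset, blast)
qed

lemma direct_sum_smult_closed:
  assumes u: "u \<in> carrier (direct_sum I M)"
  shows "c \<odot>\<^bsub>direct_sum I M\<^esub> u \<in> carrier (direct_sum I M)"
proof -
  have c: "c \<odot>\<^bsub>M i\<^esub> u i \<in> carrier (M i)" "c \<odot>\<^bsub>M i\<^esub> \<zero>\<^bsub>M i\<^esub> = \<zero>\<^bsub>M i\<^esub>" if i: "i \<in> I" for i
  proof -
    interpret M: module \<C> "M i" by (rule M[OF i])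
    show "c \<odot>\<^bsub>M i\<^esub> u i \<in> carrier (M i)"
      using u i M.smult_closed[of c "u i"] by (auto simp: direct_sum_simps)
    show "c \<odot>\<^bsub>M i\<^esub> \<zero>\<^bsub>M i\<^esub> = \<zero>\<^bsub>M i\<^esub>" using M.smult_r_null[of c] by simp
  qed
  have "{i \<in> I. (\<lambda>i\<in>I. c \<odot>\<^bsub>M i\<^esub> u i) i \<noteq> \<zero>\<^bsub>M i\<^esub>} \<subseteq> {i \<in> I. u i \<noteq> \<zero>\<^bsub>M i\<^esub>}"
    using c by auto
  then show ?thesis
    using u c unfolding direct_sum_simps
    by (intro conjI restrict_PiE_iff[THEN iffD2] ballI; elim conjE) (blast, erule finite_subset, blast)
qed

lemma module_direct_sum: "module \<C> (direct_sum I M)"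
proof -
  note cl = direct_sum_zero_closed direct_sum_add_closed direct_sum_smult_closed
  have mem: "u i \<in> carrier (M i)" if "u \<in> carrier (direct_sum I M)" "i \<in> I" for u i
    using that by (auto simp: direct_sum_simps)
  have ab: "abelian_group (M i)" if "i \<in> I" for i using M[OF that] by (simp add: module_def)
  note ag = abelian_groupE[OF ab]
  show ?thesis
  proof (rule vector_spaceI, goal_cases)
    case (4 x y z) then show ?case
      by (intro direct_sum_ext cl) (auto simp: direct_sum_simps(3) mem ag(1,3))
  next
    case (5 x y) then show ?case
      by (intro direct_sum_ext cl) (auto simp: direct_sum_simps(3) mem ag(4))
  next
    case (6 x) then show ?case
      by (intro direct_sum_ext cl) (auto simp: direct_sum_simps(2,3) mem ag(5) intro: PiE_ext)
  next
    case (7 x) 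
    have "(-1) \<odot>\<^bsub>M i\<^esub> x i \<oplus>\<^bsub>M i\<^esub> x i = \<zero>\<^bsub>M i\<^esub>" if i: "i \<in> I" for i
    proof -
      interpret M: module \<C> "M i" by (rule M[OF i])
      show ?thesis
        using M.smult_l_minus[of 1 "x i"] M.smult_one[of "x i"] mem[OF 7 i] by (simp add: M.l_neg)
    qed
    with 7 show ?case
      by (intro direct_sum_ext cl) (auto simp: direct_sum_simps(2-4))
  next
    case (8 a b x) then show ?case
      using module.smult_l_distr[OF M, of _ a b "x _"]
      by (intro direct_sum_ext cl) (auto simp: direct_sum_simps(3,4) mem)
  next
    case (9 a x y) then show ?case
      using module.smult_r_distr[OF M, of _ a "x _" "y _"]
      by (intro direct_sum_ext cl) (auto simp: direct_sum_simps(3,4) mem)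
  next
    case (10 a b x) then show ?case
      using module.smult_assoc1[OF M, of _ a b "x _"]
      by (intro direct_sum_ext cl) (auto simp: direct_sum_simps(3,4) mem)
  next
    case (11 x) then show ?case
      using module.smult_one[OF M, of _ "x _"]
      by (intro direct_sum_ext cl) (auto simp: direct_sum_simps(3,4) mem)
  qed (simp_all add: cl)
qed

lemma direct_sum_in_closed:
  assumes "i \<in> I" "x \<in> carrier (M i)"
  shows "direct_sum_in I M i x \<in> carrier (direct_sum I M)"
proof -
  have "{j \<in> I. direct_sum_in I M i x j \<noteq> \<zero>\<^bsub>M j\<^esub>} \<subseteq> {i}" by (auto simp: direct_sum_in_def)
  moreover have "\<zero>\<^bsub>M j\<^esub> \<in> carrier (M j)" if "j \<in> I" for j
    using module.axioms(2)[OF M[OF that]] by (auto simp: abelian_group_def abelian_monoidE(2))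
  ultimately show ?thesis
    using assms by (auto simp: direct_sum_simps direct_sum_in_def elim: finite_subset)
qed

lemma direct_sum_in_lin:
  assumes i: "i \<in> I"
  shows "direct_sum_in I M i \<in> lin_maps (M i) (direct_sum I M)"
proof (rule lin_mapsI)
  have z: "\<zero>\<^bsub>M j\<^esub> \<oplus>\<^bsub>M j\<^esub> \<zero>\<^bsub>M j\<^esub> = \<zero>\<^bsub>M j\<^esub>" "c \<odot>\<^bsub>M j\<^esub> \<zero>\<^bsub>M j\<^esub> = \<zero>\<^bsub>M j\<^esub>" if j: "j \<in> I" for j c
  proof -
    interpret M: module \<C> "M j" by (rule M[OF j])
    show "\<zero>\<^bsub>M j\<^esub> \<oplus>\<^bsub>M j\<^esub> \<zero>\<^bsub>M j\<^esub> = \<zero>\<^bsub>M j\<^esub>" "c \<odot>\<^bsub>M j\<^esub> \<zero>\<^bsub>M j\<^esub> = \<zero>\<^bsub>M j\<^esub>"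
      using M.smult_r_null[of c] by auto
  qed
  show "direct_sum_in I M i (x \<oplus>\<^bsub>M i\<^esub> y) =
      direct_sum_in I M i x \<oplus>\<^bsub>direct_sum I M\<^esub> direct_sum_in I M i y" for x y
    by (auto simp: direct_sum_simps direct_sum_in_def z)
  show "direct_sum_in I M i (c \<odot>\<^bsub>M i\<^esub> x) = c \<odot>\<^bsub>direct_sum I M\<^esub> direct_sum_in I M i x" for c x
    by (auto simp: direct_sum_simps direct_sum_in_def z)
qed (rule direct_sum_in_closed[OF i])

lemma direct_sum_induct [consumes 1, case_names zero inj add]:
  assumes "u \<in> carrier (direct_sum I M)"
    and zero: "P \<zero>\<^bsub>direct_sum I M\<^esub>"
    and inj: "\<And>i x. i \<in> I \<Longrightarrow> x \<in> carrier (M i) \<Longrightarrow> P (direct_sum_in I M i x)"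
    and add: "\<And>u v. \<lbrakk>u \<in> carrier (direct_sum I M); v \<in> carrier (direct_sum I M); P u; P v\<rbrakk>
      \<Longrightarrow> P (u \<oplus>\<^bsub>direct_sum I M\<^esub> v)"
  shows "P u"
proof -
  interpret F: module \<C> "direct_sum I M" by (rule module_direct_sum)
  have "u \<in> carrier (direct_sum I M) \<Longrightarrow> {i \<in> I. u i \<noteq> \<zero>\<^bsub>M i\<^esub>} \<subseteq> B \<Longrightarrow> P u" if "finite B" for B
    using that
  proof (induction B arbitrary: u)
    case empty
    then have "u = \<zero>\<^bsub>direct_sum I M\<^esub>"
      by (intro direct_sum_ext direct_sum_zero_closed) (auto simp: direct_sum_simps(2))
    then show ?case using zero by simp
  next
    case (insert i B)
    show ?case
    proof (cases "i \<in> I")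
      case True
      interpret M: module \<C> "M i" by (rule M[OF True])
      define g where "g = u(i := \<zero>\<^bsub>M i\<^esub>)"
      have "finite {j \<in> I. g j \<noteq> \<zero>\<^bsub>M j\<^esub>}"
        using insert.prems(1) unfolding direct_sum_simps g_def by (auto elim: finite_subset[rotated])
      then have g: "g \<in> carrier (direct_sum I M)" "{i \<in> I. g i \<noteq> \<zero>\<^bsub>M i\<^esub>} \<subseteq> B"
        using insert.prems True by (auto simp: direct_sum_simps(1) g_def split: if_splits)
      have ui: "u i \<in> carrier (M i)" using insert.prems True by (auto simp: direct_sum_simps)
      have "\<zero>\<^bsub>M j\<^esub> \<oplus>\<^bsub>M j\<^esub> u j = u j" if "j \<in> I" for j
      proof -
        interpret N: module \<C> "M j" by (rule M[OF that])
        have "u j \<in> carrier (M j)" using insert.prems(1) that by (auto simp: direct_sum_simps)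
        then show ?thesis by simp
      qed
      then have "u = direct_sum_in I M i (u i) \<oplus>\<^bsub>direct_sum I M\<^esub> g"
        using insert.prems(1) ui
        by (intro direct_sum_ext direct_sum_add_closed direct_sum_in_closed True g(1))
           (auto simp: direct_sum_simps(3) g_def direct_sum_in_def)
      then show ?thesis
        using add[OF direct_sum_in_closed[OF True ui] g(1) inj[OF True ui] insert.IH[OF g]]
        by simp
    qed (use insert in auto)
  qed
  then show ?thesis
    using assms(1) by (auto simp: direct_sum_simps)
qed

lemma direct_sum_lift_lin:
  fixes N :: "(complex, 'w, 'n) module_scheme"
  assumes N: "module \<C> N" and h_ball: "\<forall>i\<in>I. h i \<in> lin_maps (M i) N"
  shows "(\<lambda>u. \<Oplus>\<^bsub>N\<^esub>i\<in>{i \<in> I. u i \<noteq> \<zero>\<^bsub>M i\<^esub>}. h i (u i)) \<in> lin_maps (direct_sum I M) N"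
proof -
  interpret N: module \<C> N by fact
  have h: "h i \<in> lin_maps (M i) N" if "i \<in> I" for i using h_ball that by blast
  have mem: "u i \<in> carrier (M i)" if "u \<in> carrier (direct_sum I M)" "i \<in> I" for u i
    using that by (auto simp: direct_sum_simps)
  note hc = lin_closed[OF h]
  have sup: "(\<Oplus>\<^bsub>N\<^esub>i\<in>{i \<in> I. u i \<noteq> \<zero>\<^bsub>M i\<^esub>}. h i (u i)) = (\<Oplus>\<^bsub>N\<^esub>i\<in>B. h i (u i))"
    if "finite B" "B \<subseteq> I" "{i \<in> I. u i \<noteq> \<zero>\<^bsub>M i\<^esub>} \<subseteq> B" "u \<in> carrier (direct_sum I M)" for u B
    using that mem[OF that(4)] lin_zero[OF M N h]
    by (intro N.add.finprod_mono_neutral_cong_left) (auto simp: Pi_iff subset_iff hc)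
  show ?thesis
  proof (rule lin_mapsI, goal_cases)
    case (1 f)
    then show ?case using mem[OF 1] by (intro N.finsum_closed) (auto simp: hc)
  next
    case (2 u v)
    define B where "B = {i \<in> I. u i \<noteq> \<zero>\<^bsub>M i\<^esub>} \<union> {i \<in> I. v i \<noteq> \<zero>\<^bsub>M i\<^esub>}"
    have B: "finite B" "B \<subseteq> I" using 2 by (auto simp: direct_sum_simps B_def)
    have z: "\<zero>\<^bsub>M i\<^esub> \<oplus>\<^bsub>M i\<^esub> \<zero>\<^bsub>M i\<^esub> = \<zero>\<^bsub>M i\<^esub>" if i: "i \<in> I" for i
      using abelian_groupE[of "M i"] M[OF i] by (simp add: module_def)
    have c: "h i (u i) \<in> carrier N" "h i (v i) \<in> carrier N"
      "h i ((u \<oplus>\<^bsub>direct_sum I M\<^esub> v) i) = h i (u i) \<oplus>\<^bsub>N\<^esub> h i (v i)" if "i \<in> B" for i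
      using B(2) mem[OF 2(1)] mem[OF 2(2)] that
      by (auto simp: hc direct_sum_simps(3) lin_add[OF h] subset_iff)
    have su: "{i \<in> I. u i \<noteq> \<zero>\<^bsub>M i\<^esub>} \<subseteq> B" and sv: "{i \<in> I. v i \<noteq> \<zero>\<^bsub>M i\<^esub>} \<subseteq> B"
      by (auto simp: B_def)
    have sub: "{i \<in> I. (u \<oplus>\<^bsub>direct_sum I M\<^esub> v) i \<noteq> \<zero>\<^bsub>M i\<^esub>} \<subseteq> B"
      by (auto simp: B_def direct_sum_simps(3) z)
    have "(\<Oplus>\<^bsub>N\<^esub>i\<in>B. h i ((u \<oplus>\<^bsub>direct_sum I M\<^esub> v) i)) = (\<Oplus>\<^bsub>N\<^esub>i\<in>B. h i (u i) \<oplus>\<^bsub>N\<^esub> h i (v i))"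
      using c by (intro N.finsum_cong') auto
    also have "\<dots> = (\<Oplus>\<^bsub>N\<^esub>i\<in>B. h i (u i)) \<oplus>\<^bsub>N\<^esub> (\<Oplus>\<^bsub>N\<^esub>i\<in>B. h i (v i))"
      using c by (intro N.finsum_addf) auto
    finally show ?case
      unfolding sup[OF B sub direct_sum_add_closed[OF 2]] sup[OF B su 2(1)] sup[OF B sv 2(2)] .
  next
    case (3 c u)
    define B where "B = {i \<in> I. u i \<noteq> \<zero>\<^bsub>M i\<^esub>}"
    have B: "finite B" "B \<subseteq> I" using 3 by (auto simp: direct_sum_simps B_def)
    have c: "h i (u i) \<in> carrier N" 
      "h i ((c \<odot>\<^bsub>direct_sum I M\<^esub> u) i) = c \<odot>\<^bsub>N\<^esub> h i (u i)" if "i \<in> B" for i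
      using B(2) mem[OF 3] that
      by (auto simp: hc direct_sum_simps(4) lin_smult[OF h] subset_iff)
    have z: "c \<odot>\<^bsub>M i\<^esub> \<zero>\<^bsub>M i\<^esub> = \<zero>\<^bsub>M i\<^esub>" if i: "i \<in> I" for i
      using module.smult_r_null[OF M[OF i]] by simp
    have su: "{i \<in> I. u i \<noteq> \<zero>\<^bsub>M i\<^esub>} \<subseteq> B"
      by (auto simp: B_def)
    have sub: "{i \<in> I. (c \<odot>\<^bsub>direct_sum I M\<^esub> u) i \<noteq> \<zero>\<^bsub>M i\<^esub>} \<subseteq> B"
      by (auto simp: B_def direct_sum_simps(4) z)
    have "(\<Oplus>\<^bsub>N\<^esub>i\<in>B. h i ((c \<odot>\<^bsub>direct_sum I M\<^esub> u) i)) = (\<Oplus>\<^bsub>N\<^esub>i\<in>B. c \<odot>\<^bsub>N\<^esub> h i (u i))"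
      using c N.smult_closed by (intro N.finsum_cong') auto
    also have "\<dots> = c \<odot>\<^bsub>N\<^esub> (\<Oplus>\<^bsub>N\<^esub>i\<in>B. h i (u i))"
      using c B by (intro N.finsum_smult_ldistr[symmetric]) auto
    finally show ?case
      unfolding sup[OF B sub direct_sum_smult_closed[OF 3]] sup[OF B su 3] .
  qed
qed

lemma direct_sum_lift_in:
  fixes N :: "(complex, 'w, 'n) module_scheme"
  assumes N: "module \<C> N" and h: "h i \<in> lin_maps (M i) N"
    and i: "i \<in> I" and x: "x \<in> carrier (M i)"
  shows "(\<Oplus>\<^bsub>N\<^esub>j\<in>{j \<in> I. direct_sum_in I M i x j \<noteq> \<zero>\<^bsub>M j\<^esub>}. h j (direct_sum_in I M i x j)) = h i x"
proof -
  interpret N: module \<C> N by fact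
  have eq: "{j \<in> I. direct_sum_in I M i x j \<noteq> \<zero>\<^bsub>M j\<^esub>} = (if x = \<zero>\<^bsub>M i\<^esub> then {} else {i})"
    using i by (auto simp: direct_sum_in_def)
  show ?thesis unfolding eq
    using lin_zero[OF M[OF i] N h] lin_closed[OF h x] i by (auto simp: direct_sum_in_def)
qed

end

section \<open>Tensor powers\<close>

lemma tuples_upd: "a \<in> tuples A n \<Longrightarrow> i \<le> n \<Longrightarrow> x \<in> carrier A \<Longrightarrow> a(i := x) \<in> tuples A n"
  by (auto simp: tuples_def PiE_iff extensional_def)

lemma tuples_mem: "a \<in> tuples A n \<Longrightarrow> i \<le> n \<Longrightarrow> a i \<in> carrier A"
  by (auto simp: tuples_def)

text \<open>A map on tuples is multilinear if it is linear in each slot \<open>i \<le> n\<close>; the remaining slots are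
  filled by an arbitrary tuple \<open>a\<close>, whose own entry at \<open>i\<close> is overwritten.\<close>

definition multilinear ::
    "(complex, 'a, 'm) module_scheme \<Rightarrow> nat \<Rightarrow> (complex, 'w, 'n) module_scheme
      \<Rightarrow> ((nat \<Rightarrow> 'a) \<Rightarrow> 'w) \<Rightarrow> bool"
  where "multilinear A n N g \<longleftrightarrow> g \<in> tuples A n \<rightarrow> carrier N \<and>
    (\<forall>a\<in>tuples A n. \<forall>i\<le>n. (\<lambda>x. g (a(i := x))) \<in> lin_maps A N)"

text \<open>The generators of the subspace \<^const>\<open>tensor_rels\<close> of multilinearity relations.\<close>

definition tensor_gens ::
    "(complex, 'a, 'm) module_scheme \<Rightarrow> nat \<Rightarrow> ((nat \<Rightarrow> 'a) \<Rightarrow> complex) set"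
  where "tensor_gens A n = (let F = free_space (tuples A n) in
    {free_basis (a(i := x \<oplus>\<^bsub>A\<^esub> y)) \<ominus>\<^bsub>F\<^esub> (free_basis (a(i := x)) \<oplus>\<^bsub>F\<^esub> free_basis (a(i := y)))
        | a i x y. a \<in> tuples A n \<and> i \<le> n \<and> x \<in> carrier A \<and> y \<in> carrier A} \<union>
     {free_basis (a(i := c \<odot>\<^bsub>A\<^esub> x)) \<ominus>\<^bsub>F\<^esub> (c \<odot>\<^bsub>F\<^esub> free_basis (a(i := x)))
        | a i c x. a \<in> tuples A n \<and> i \<le> n \<and> x \<in> carrier A})"

lemma tensor_rels_eq: "tensor_rels A n = lin_span (free_space (tuples A n)) (tensor_gens A n)"
  by (simp add: tensor_rels_def tensor_gens_def Let_def)

context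
  fixes A :: "(complex, 'a, 'm) module_scheme"
  assumes A: "module \<C> A"
begin

interpretation A: module \<C> A by (rule A)

lemma tensor_gens_subset: "tensor_gens A n \<subseteq> carrier (free_space (tuples A n))"
proof -
  interpret F: module \<C> "free_space (tuples A n)" by (rule module_free_space)
  note [simp] = free_basis_closed tuples_upd A.smult_closed F.smult_closed
  show ?thesis by (auto simp: tensor_gens_def Let_def)
qed

lemma submodule_tensor_rels: "submodule (tensor_rels A n) \<C> (free_space (tuples A n))"
  unfolding tensor_rels_eq by (intro submodule_lin_span module_free_space tensor_gens_subset)

lemma module_tensor_power: "module \<C> (tensor_power A n)"
  unfolding tensor_power_def by (intro module_quot_mod module_free_space submodule_tensor_rels)

lemma pure_tensor_closed: "a \<in> tuples A n \<Longrightarrow> pure_tensor A n a \<in> carrier (tensor_power A n)"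
  unfolding tensor_power_def pure_tensor_def
  by (intro coset_in_quot module_free_space submodule_tensor_rels free_basis_closed)

lemma multilinear_pure_tensor: "multilinear A n (tensor_power A n) (pure_tensor A n)"
  unfolding multilinear_def
proof (intro conjI ballI allI impI)
  show "pure_tensor A n \<in> tuples A n \<rightarrow> carrier (tensor_power A n)"
    by (simp add: pure_tensor_closed)
  fix a i assume a: "a \<in> tuples A n" and i: "i \<le> n"
  let ?F = "free_space (tuples A n)" and ?W = "tensor_rels A n"
  interpret F: module \<C> ?F by (rule module_free_space)
  note W = module_free_space submodule_tensor_rels
  show "(\<lambda>x. pure_tensor A n (a(i := x))) \<in> lin_maps A (tensor_power A n)"
  proof (rule lin_mapsI)
    fix x assume x: "x \<in> carrier A"
    note cl = free_basis_closed[OF tuples_upd[OF a i]]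
    show "pure_tensor A n (a(i := x)) \<in> carrier (tensor_power A n)"
      using a i x by (intro pure_tensor_closed tuples_upd)
    show "pure_tensor A n (a(i := x \<oplus>\<^bsub>A\<^esub> y)) =
      pure_tensor A n (a(i := x)) \<oplus>\<^bsub>tensor_power A n\<^esub> pure_tensor A n (a(i := y))"
      if y: "y \<in> carrier A" for y
    proof -
      have "free_basis (a(i := x \<oplus>\<^bsub>A\<^esub> y)) \<ominus>\<^bsub>?F\<^esub> (free_basis (a(i := x)) \<oplus>\<^bsub>?F\<^esub> free_basis (a(i := y)))
        \<in> ?W"
        unfolding tensor_rels_eq using a i x y
        by (intro lin_span_base) (auto simp: tensor_gens_def Let_def)
      then show ?thesis
        unfolding tensor_power_def pure_tensor_def
        using x y by (simp add: quot_mod_add[OF W] coset_eq_iff[OF W] cl)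
    qed
    show "pure_tensor A n (a(i := c \<odot>\<^bsub>A\<^esub> x)) = c \<odot>\<^bsub>tensor_power A n\<^esub> pure_tensor A n (a(i := x))"
      for c
    proof -
      have "free_basis (a(i := c \<odot>\<^bsub>A\<^esub> x)) \<ominus>\<^bsub>?F\<^esub> (c \<odot>\<^bsub>?F\<^esub> free_basis (a(i := x))) \<in> ?W"
        unfolding tensor_rels_eq using a i x
        by (intro lin_span_base) (auto simp: tensor_gens_def Let_def)
      then show ?thesis
        unfolding tensor_power_def pure_tensor_def
        using x A.smult_closed[of c x] F.smult_closed[OF _ cl[OF x], of c]
        by (simp add: quot_mod_smult[OF W] coset_eq_iff[OF W] cl)
    qed
  qed
qed

lemma pure_tensor_lin:
  "a \<in> tuples A n \<Longrightarrow> i \<le> n \<Longrightarrow> (\<lambda>x. pure_tensor A n (a(i := x))) \<in> lin_maps A (tensor_power A n)"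
  using multilinear_pure_tensor by (auto simp: multilinear_def)

context
  fixes N :: "(complex, 'w, 'n) module_scheme" and g :: "(nat \<Rightarrow> 'a) \<Rightarrow> 'w" and n :: nat
  assumes N: "module \<C> N" and g: "multilinear A n N g"
begin

private lemma free_lift_rels:
  assumes "w \<in> tensor_rels A n"
  shows "(\<Oplus>\<^bsub>N\<^esub>a\<in>{a. w a \<noteq> 0}. w a \<odot>\<^bsub>N\<^esub> g a) = \<zero>\<^bsub>N\<^esub>" (is "?L w = _")
proof -
  let ?F = "free_space (tuples A n)"
  interpret F: module \<C> ?F by (rule module_free_space)
  interpret N: module \<C> N by (rule N)
  have gc: "g \<in> tuples A n \<rightarrow> carrier N" using g by (simp add: multilinear_def)
  have gl: "(\<lambda>x. g (a(i := x))) \<in> lin_maps A N" if "a \<in> tuples A n" "i \<le> n" for a i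
    using g that by (simp add: multilinear_def)
  note L = free_lift_lin[OF N gc]
  have Lb: "?L (free_basis a) = g a" if "a \<in> tuples A n" for a
    using gc that by (intro free_lift_basis N) auto
  show ?thesis
  proof (rule lin_span_kernel[OF module_free_space N L tensor_gens_subset _
        assms[unfolded tensor_rels_eq]])
    fix s assume "s \<in> tensor_gens A n"
    then consider
      (add) a i x y where "a \<in> tuples A n" "i \<le> n" "x \<in> carrier A" "y \<in> carrier A"
        "s = free_basis (a(i := x \<oplus>\<^bsub>A\<^esub> y)) \<ominus>\<^bsub>?F\<^esub> (free_basis (a(i := x)) \<oplus>\<^bsub>?F\<^esub> free_basis (a(i := y)))"
      | (smult) a i c x where "a \<in> tuples A n" "i \<le> n" "x \<in> carrier A"
        "s = free_basis (a(i := c \<odot>\<^bsub>A\<^esub> x)) \<ominus>\<^bsub>?F\<^esub> (c \<odot>\<^bsub>?F\<^esub> free_basis (a(i := x)))"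
      unfolding tensor_gens_def Let_def by blast
    then show "?L s = \<zero>\<^bsub>N\<^esub>"
    proof cases
      case add
      note up = tuples_upd[OF add(1,2)]
      note b = free_basis_closed[OF up]
      have "?L s = g (a(i := x \<oplus>\<^bsub>A\<^esub> y)) \<ominus>\<^bsub>N\<^esub> (g (a(i := x)) \<oplus>\<^bsub>N\<^esub> g (a(i := y)))"
        unfolding add(5) using add(3,4)
        by (simp only: lin_minus[OF module_free_space N L] lin_add[OF L] Lb up b
            A.a_closed F.a_closed)
      also have "g (a(i := x \<oplus>\<^bsub>A\<^esub> y)) = g (a(i := x)) \<oplus>\<^bsub>N\<^esub> g (a(i := y))"
        using lin_add[OF gl[OF add(1,2)] add(3,4)] .
      finally show ?thesis
        using N.minus_eq_zero_iff[of "g (a(i := x)) \<oplus>\<^bsub>N\<^esub> g (a(i := y))"]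
          lin_closed[OF gl[OF add(1,2)] add(3)] lin_closed[OF gl[OF add(1,2)] add(4)]
          N.a_closed by metis
    next
      case smult
      note up = tuples_upd[OF smult(1,2)]
      note b = free_basis_closed[OF up]
      have c: "c \<odot>\<^bsub>A\<^esub> x \<in> carrier A" using smult(3) A.smult_closed by simp
      have c': "c \<odot>\<^bsub>?F\<^esub> free_basis (a(i := x)) \<in> carrier ?F"
        using smult(3) b F.smult_closed by simp
      have "?L s = g (a(i := c \<odot>\<^bsub>A\<^esub> x)) \<ominus>\<^bsub>N\<^esub> c \<odot>\<^bsub>N\<^esub> g (a(i := x))"
        unfolding smult(4) using smult(3)
        by (simp only: lin_minus[OF module_free_space N L] lin_smult[OF L] Lb up b c c')
      also have "g (a(i := c \<odot>\<^bsub>A\<^esub> x)) = c \<odot>\<^bsub>N\<^esub> g (a(i := x))"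
        using lin_smult[OF gl[OF smult(1,2)] smult(3)] .
      finally show ?thesis
        using N.minus_eq_zero_iff[of "c \<odot>\<^bsub>N\<^esub> g (a(i := x))" "c \<odot>\<^bsub>N\<^esub> g (a(i := x))"]
          N.smult_closed[OF _ lin_closed[OF gl[OF smult(1,2)] smult(3)], of c]
        by (metis UNIV_I complex_ring_simps(1))
    qed
  qed
qed

lemma tensor_lift_coset:
  assumes f: "f \<in> carrier (free_space (tuples A n))"
  shows "tensor_lift A n N g (tensor_rels A n +>\<^bsub>free_space (tuples A n)\<^esub> f) =
    (\<Oplus>\<^bsub>N\<^esub>a\<in>{a. f a \<noteq> 0}. f a \<odot>\<^bsub>N\<^esub> g a)"
proof -
  have gc: "g \<in> tuples A n \<rightarrow> carrier N" using g by (simp add: multilinear_def)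
  note W = module_free_space submodule_tensor_rels
  show ?thesis
    unfolding tensor_lift_def tensor_power_def
    using coset_in_quot[OF W f]
      image_coset[OF W N free_lift_lin[OF N gc] free_lift_rels f]
    by simp
qed

lemma tensor_lift_lin: "tensor_lift A n N g \<in> lin_maps (tensor_power A n) N"
proof -
  have gc: "g \<in> tuples A n \<rightarrow> carrier N" using g by (simp add: multilinear_def)
  show ?thesis
    unfolding tensor_power_def
    by (rule lin_from_quot[OF module_free_space submodule_tensor_rels free_lift_lin[OF N gc]
          tensor_lift_coset])
qed

lemma tensor_lift_pure:
  assumes "a \<in> tuples A n"
  shows "tensor_lift A n N g (pure_tensor A n a) = g a"
  unfolding pure_tensor_def tensor_lift_coset[OF free_basis_closed[OF assms]]
  using assms g by (intro free_lift_basis N) (auto simp: multilinear_def)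

end

lemma tensor_lin_ext:
  assumes N: "module \<C> N"
    and F: "F \<in> lin_maps (tensor_power A n) N" and G: "G \<in> lin_maps (tensor_power A n) N"
    and eq: "\<And>a. a \<in> tuples A n \<Longrightarrow> F (pure_tensor A n a) = G (pure_tensor A n a)"
    and t: "t \<in> carrier (tensor_power A n)"
  shows "F t = G t"
proof -
  note W = module_free_space submodule_tensor_rels
  note P = quot_proj_lin[OF W, folded tensor_power_def]
  obtain f where f: "f \<in> carrier (free_space (tuples A n))"
    "t = tensor_rels A n +>\<^bsub>free_space (tuples A n)\<^esub> f"
    using quot_cases[OF W] t[unfolded tensor_power_def] by metis
  show ?thesis
    unfolding f(2)
    using free_space_lin_ext[OF N lin_comp[OF P F] lin_comp[OF P G] _ f(1)] eq
    by (simp add: pure_tensor_def)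
qed

end

section \<open>Colimits\<close>

context
  fixes I :: "'i set" and M :: "'i \<Rightarrow> (complex, 'v, 'm) module_scheme"
    and J :: "('i \<times> 'i \<times> ('v \<Rightarrow> 'v)) set"
  assumes M_ball: "\<forall>i\<in>I. module \<C> (M i)"
    and J_ball: "\<forall>(i, j, f)\<in>J. i \<in> I \<and> j \<in> I \<and> f \<in> lin_maps (M i) (M j)"
begin

interpretation S: module \<C> "direct_sum I M" by (rule module_direct_sum[OF M_ball])

private lemma J: "(i, j, f) \<in> J \<Longrightarrow> i \<in> I \<and> j \<in> I \<and> f \<in> lin_maps (M i) (M j)"
  using J_ball by blast

lemma submodule_colim_rels: "submodule (colim_rels I M J) \<C> (direct_sum I M)"
  unfolding colim_rels_def
proof (intro submodule_lin_span module_direct_sum M_ball, safe)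
  fix i j f x assume a: "(i, j, f) \<in> J" "x \<in> carrier (M i)"
  have "direct_sum_in I M i x \<in> carrier (direct_sum I M)"
    "direct_sum_in I M j (f x) \<in> carrier (direct_sum I M)"
    using J[OF a(1)] a(2) by (auto intro!: direct_sum_in_closed M_ball lin_closed[of f])
  then show "direct_sum_in I M i x \<ominus>\<^bsub>direct_sum I M\<^esub> direct_sum_in I M j (f x) \<in> carrier (direct_sum I M)"
    by simp
qed

lemma module_colim: "module \<C> (colim I M J)"
  unfolding colim_def by (intro module_quot_mod module_direct_sum M_ball submodule_colim_rels)

lemma colim_proj_lin:
  "(\<lambda>u. colim_rels I M J +>\<^bsub>direct_sum I M\<^esub> u) \<in> lin_maps (direct_sum I M) (colim I M J)"
  unfolding colim_def by (intro quot_proj_lin module_direct_sum M_ball submodule_colim_rels)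

lemma colim_in_lin: "i \<in> I \<Longrightarrow> colim_in I M J i \<in> lin_maps (M i) (colim I M J)"
  unfolding colim_in_def by (rule lin_comp[OF direct_sum_in_lin[OF M_ball] colim_proj_lin])

lemma colim_in_arrow:
  assumes a: "(i, j, f) \<in> J" and x: "x \<in> carrier (M i)"
  shows "colim_in I M J j (f x) = colim_in I M J i x"
proof -
  have "direct_sum_in I M i x \<in> carrier (direct_sum I M)"
    "direct_sum_in I M j (f x) \<in> carrier (direct_sum I M)"
    using J[OF a] x by (auto intro!: direct_sum_in_closed M_ball lin_closed[of f])
  moreover have "direct_sum_in I M i x \<ominus>\<^bsub>direct_sum I M\<^esub> direct_sum_in I M j (f x) \<in> colim_rels I M J"
    unfolding colim_rels_def using a x by (intro lin_span_base) blast
  ultimately show ?thesis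
    unfolding colim_in_def
    using coset_eq_iff[OF module_direct_sum[OF M_ball] submodule_colim_rels] by metis
qed

lemma colim_lin_ext:
  assumes N: "module \<C> N"
    and F: "F \<in> lin_maps (colim I M J) N" and G: "G \<in> lin_maps (colim I M J) N"
    and eq: "\<And>i x. i \<in> I \<Longrightarrow> x \<in> carrier (M i) \<Longrightarrow>
      F (colim_in I M J i x) = G (colim_in I M J i x)"
    and t: "t \<in> carrier (colim I M J)"
  shows "F t = G t"
proof -
  note W = module_direct_sum[OF M_ball] submodule_colim_rels
  obtain u where u: "u \<in> carrier (direct_sum I M)" "t = colim_rels I M J +>\<^bsub>direct_sum I M\<^esub> u"
    using quot_cases[OF W, of t thesis] t[unfolded colim_def] by blast
  let ?p = "\<lambda>u. colim_rels I M J +>\<^bsub>direct_sum I M\<^esub> u"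
  note FP = lin_comp[OF colim_proj_lin F] and GP = lin_comp[OF colim_proj_lin G]
  have "F (?p u) = G (?p u)"
  proof (rule direct_sum_induct[where P = "\<lambda>u. F (?p u) = G (?p u)", OF M_ball u(1)],
      goal_cases)
    case 1
    then show ?case
      using lin_zero[OF module_direct_sum[OF M_ball] N FP] lin_zero[OF module_direct_sum[OF M_ball] N GP] by simp
  next
    case (2 i x)
    then show ?case using eq by (simp add: colim_in_def)
  next
    case (3 u v)
    then show ?case using lin_add[OF FP 3(1,2)] lin_add[OF GP 3(1,2)] by simp
  qed
  then show ?thesis by (simp add: u(2))
qed

context
  fixes N :: "(complex, 'w, 'n) module_scheme" and h :: "'i \<Rightarrow> 'v \<Rightarrow> 'w"
  assumes N: "module \<C> N" and h_ball: "\<forall>i\<in>I. h i \<in> lin_maps (M i) N"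
    and cocone_ball: "\<forall>(i, j, f)\<in>J. \<forall>x\<in>carrier (M i). h j (f x) = h i x"
begin

private lemma h: "i \<in> I \<Longrightarrow> h i \<in> lin_maps (M i) N"
  using h_ball by blast

private lemma cocone: "(i, j, f) \<in> J \<Longrightarrow> x \<in> carrier (M i) \<Longrightarrow> h j (f x) = h i x"
  using cocone_ball by blast

private lemma sum_lift_rels:
  assumes "w \<in> colim_rels I M J"
  shows "(\<Oplus>\<^bsub>N\<^esub>i\<in>{i \<in> I. w i \<noteq> \<zero>\<^bsub>M i\<^esub>}. h i (w i)) = \<zero>\<^bsub>N\<^esub>" (is "?L w = _")
proof -
  interpret N: module \<C> N by (rule N)
  note L = direct_sum_lift_lin[OF M_ball N h_ball]
  have cl: "direct_sum_in I M i x \<in> carrier (direct_sum I M)" "direct_sum_in I M j (f x) \<in> carrier (direct_sum I M)"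
    if "(i, j, f) \<in> J" "x \<in> carrier (M i)" for i j f x
    using J[OF that(1)] that(2) by (auto intro!: direct_sum_in_closed M_ball lin_closed[of f])
  show ?thesis
  proof (rule lin_span_kernel[OF module_direct_sum[OF M_ball] N L _ _ assms[unfolded colim_rels_def]])
    fix s assume "s \<in> {direct_sum_in I M i x \<ominus>\<^bsub>direct_sum I M\<^esub> direct_sum_in I M j (f x) | i j f x.
      (i, j, f) \<in> J \<and> x \<in> carrier (M i)}"
    then obtain i j f x where s: "s = direct_sum_in I M i x \<ominus>\<^bsub>direct_sum I M\<^esub> direct_sum_in I M j (f x)"
      "(i, j, f) \<in> J" "x \<in> carrier (M i)" by blast
    have fx: "f x \<in> carrier (M j)" using J[OF s(2)] s(3) lin_closed by metis
    have ij: "i \<in> I" "j \<in> I" using J[OF s(2)] by auto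
    have "?L s = h i x \<ominus>\<^bsub>N\<^esub> h j (f x)"
      unfolding s(1) lin_minus[OF module_direct_sum[OF M_ball] N L cl[OF s(2,3)]]
        direct_sum_lift_in[where h = h, OF M_ball N h[OF ij(1)] ij(1) s(3)] direct_sum_lift_in[where h = h, OF M_ball N h[OF ij(2)] ij(2) fx]
      ..
    then show "?L s = \<zero>\<^bsub>N\<^esub>"
      using cocone[OF s(2,3)] lin_closed[OF h[OF ij(1)] s(3)] by (simp add: N.minus_eq_zero_iff)
  qed (use cl S.minus_closed in blast)
qed

lemma colim_lift_coset:
  assumes u: "u \<in> carrier (direct_sum I M)"
  shows "colim_lift I M J N h (colim_rels I M J +>\<^bsub>direct_sum I M\<^esub> u) =
    (\<Oplus>\<^bsub>N\<^esub>i\<in>{i \<in> I. u i \<noteq> \<zero>\<^bsub>M i\<^esub>}. h i (u i))"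
proof -
  note W = module_direct_sum[OF M_ball] submodule_colim_rels
  show ?thesis
    unfolding colim_lift_def colim_def
    using coset_in_quot[OF W u] image_coset[OF W N direct_sum_lift_lin[OF M_ball N h_ball] sum_lift_rels u]
    by simp
qed

lemma colim_lift_lin: "colim_lift I M J N h \<in> lin_maps (colim I M J) N"
  unfolding colim_def
  by (rule lin_from_quot[OF module_direct_sum[OF M_ball] submodule_colim_rels
        direct_sum_lift_lin[OF M_ball N h_ball] colim_lift_coset])

lemma colim_lift_in:
  assumes "i \<in> I" "x \<in> carrier (M i)"
  shows "colim_lift I M J N h (colim_in I M J i x) = h i x"
  unfolding colim_in_def colim_lift_coset[OF direct_sum_in_closed[OF M_ball assms]]
  by (rule direct_sum_lift_in[where h = h, OF M_ball N h[OF assms(1)] assms])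

end

end

section \<open>Derivations and the Loday functor\<close>

subsection \<open>Finite sums\<close>

lemma (in abelian_monoid) finsum_swap:
  assumes "\<And>i j. i \<in> I \<Longrightarrow> j \<in> J \<Longrightarrow> f i j \<in> carrier G" "finite I" "finite J"
  shows "(\<Oplus>i\<in>I. \<Oplus>j\<in>J. f i j) = (\<Oplus>j\<in>J. \<Oplus>i\<in>I. f i j)"
  using assms(2,1)
proof (induction I rule: finite_induct)
  case (insert k I)
  have "(\<Oplus>i\<in>insert k I. \<Oplus>j\<in>J. f i j) = (\<Oplus>j\<in>J. f k j) \<oplus> (\<Oplus>j\<in>J. \<Oplus>i\<in>I. f i j)"
    using insert by (subst finsum_insert) (auto intro!: finsum_closed)
  also have "\<dots> = (\<Oplus>j\<in>J. f k j \<oplus> (\<Oplus>i\<in>I. f i j))"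
    using insert.prems by (intro finsum_addf[symmetric]) (auto intro!: finsum_closed)
  also have "\<dots> = (\<Oplus>j\<in>J. \<Oplus>i\<in>insert k I. f i j)"
    using insert by (intro finsum_cong' refl finsum_insert[symmetric]) (auto intro!: finsum_closed)
  finally show ?case .
qed simp

lemma (in abelian_group) finsum_diff:
  assumes "f \<in> I \<rightarrow> carrier G" "g \<in> I \<rightarrow> carrier G"
  shows "(\<Oplus>i\<in>I. f i) \<ominus> (\<Oplus>i\<in>I. g i) = (\<Oplus>i\<in>I. f i \<ominus> g i)"
proof -
  have "(\<Oplus>i\<in>I. f i \<ominus> g i) \<oplus> (\<Oplus>i\<in>I. g i) = (\<Oplus>i\<in>I. f i \<ominus> g i \<oplus> g i)"
    using assms by (intro finsum_addf[symmetric]) auto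
  also have "\<dots> = (\<Oplus>i\<in>I. f i)"
    using assms by (intro finsum_cong') (auto simp: a_minus_def a_assoc l_neg Pi_iff)
  finally have eq: "(\<Oplus>i\<in>I. f i) = (\<Oplus>i\<in>I. f i \<ominus> g i) \<oplus> (\<Oplus>i\<in>I. g i)" ..
  have "(\<Oplus>i\<in>I. f i \<ominus> g i) \<in> carrier G" "(\<Oplus>i\<in>I. g i) \<in> carrier G"
    using assms by (auto intro!: finsum_closed)
  then show ?thesis
    unfolding eq by (simp add: a_minus_def a_assoc r_neg)
qed

subsection \<open>Derivations\<close>

lemma Der_simps:
  "carrier (Der A) = derivations A"
  "\<zero>\<^bsub>Der A\<^esub> = (\<lambda>x\<in>carrier A. \<zero>\<^bsub>A\<^esub>)"
  "D \<oplus>\<^bsub>Der A\<^esub> E = (\<lambda>x\<in>carrier A. D x \<oplus>\<^bsub>A\<^esub> E x)"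
  "c \<odot>\<^bsub>Der A\<^esub> D = (\<lambda>x\<in>carrier A. c \<odot>\<^bsub>A\<^esub> D x)"
  "bracket (Der A) D E = (\<lambda>x\<in>carrier A. D (E x) \<ominus>\<^bsub>A\<^esub> E (D x))"
  by (simp_all add: Der_def)

lemma derivation_lin: "D \<in> derivations A \<Longrightarrow> D \<in> lin_maps A A"
  by (simp add: derivations_def)

lemma derivation_closed: "D \<in> derivations A \<Longrightarrow> x \<in> carrier A \<Longrightarrow> D x \<in> carrier A"
  by (rule lin_closed[OF derivation_lin])

lemma derivation_mult: "D \<in> derivations A \<Longrightarrow> x \<in> carrier A \<Longrightarrow> y \<in> carrier A \<Longrightarrow>
    D (x \<otimes>\<^bsub>A\<^esub> y) = D x \<otimes>\<^bsub>A\<^esub> y \<oplus>\<^bsub>A\<^esub> x \<otimes>\<^bsub>A\<^esub> D y"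
  by (simp add: derivations_def)

text \<open>The tuple \<open>b\<close> in \<open>\<L>(A)(\<phi>)(a\<^sub>0 \<otimes> \<dots> \<otimes> a\<^sub>m) = b\<^sub>0 \<otimes> \<dots> \<otimes> b\<^sub>n\<close>.\<close>

definition push_tuple ::
    "(complex, 'a, 'm) module_scheme \<Rightarrow> nat \<Rightarrow> nat \<Rightarrow> (nat \<Rightarrow> nat) \<Rightarrow> (nat \<Rightarrow> 'a) \<Rightarrow> nat \<Rightarrow> 'a"
  where "push_tuple A m n \<phi> a = (\<lambda>j\<in>{..n}. \<Otimes>\<^bsub>A\<^esub>i\<in>{i \<in> {..m}. \<phi> i = j}. a i)"

lemma loday_gamma_eq:
  "loday_gamma A m n \<phi> = tensor_lift A m (tensor_power A n) (\<lambda>a. pure_tensor A n (push_tuple A m n \<phi> a))"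
  by (simp add: loday_gamma_def push_tuple_def)

lemma pointed_maps_gammaD: "\<psi> \<in> pointed_maps (gamma_obj m) (gamma_obj n) \<Longrightarrow> \<psi> \<in> {..m} \<rightarrow> {..n}"
  by (auto simp: pointed_maps_def gamma_obj_def)

context
  fixes A :: "(complex, 'a, 'm) module_scheme"
  assumes alg: "algebra \<C> A"
begin

interpretation A: cring A using alg by (simp add: algebra_def)
interpretation V: module \<C> A using alg by (simp add: algebra_def)

private lemma mod: "module \<C> A" by (rule V.module_axioms)

lemma algebra_smult_left: "x \<in> carrier A \<Longrightarrow> y \<in> carrier A \<Longrightarrow>
    (c \<odot>\<^bsub>A\<^esub> x) \<otimes>\<^bsub>A\<^esub> y = c \<odot>\<^bsub>A\<^esub> (x \<otimes>\<^bsub>A\<^esub> y)"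
  using algebra.smult_assoc2[OF alg, of c x y] by simp

lemma algebra_smult_right: "x \<in> carrier A \<Longrightarrow> y \<in> carrier A \<Longrightarrow>
    x \<otimes>\<^bsub>A\<^esub> (c \<odot>\<^bsub>A\<^esub> y) = c \<odot>\<^bsub>A\<^esub> (x \<otimes>\<^bsub>A\<^esub> y)"
  using algebra_smult_left[of y x c] V.smult_closed[of c y] by (simp add: A.m_comm)

lemma mult_right_lin: "r \<in> carrier A \<Longrightarrow> (\<lambda>x. x \<otimes>\<^bsub>A\<^esub> r) \<in> lin_maps A A"
  by (rule lin_mapsI) (auto simp: algebra_smult_left A.l_distr)

lemma derivationI:
  assumes "D \<in> lin_maps A A"
    and "\<And>x y. x \<in> carrier A \<Longrightarrow> y \<in> carrier A \<Longrightarrow>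
      D (x \<otimes>\<^bsub>A\<^esub> y) = D x \<otimes>\<^bsub>A\<^esub> y \<oplus>\<^bsub>A\<^esub> x \<otimes>\<^bsub>A\<^esub> D y"
  shows "(\<lambda>x\<in>carrier A. D x) \<in> derivations A"
proof -
  have "(\<lambda>x\<in>carrier A. D x) \<in> lin_maps A A"
    by (rule lin_cong[OF assms(1) _ mod]) simp
  then show ?thesis using assms(2) by (simp add: derivations_def)
qed

lemma derivation_add:
  assumes D: "D \<in> derivations A" and E: "E \<in> derivations A"
  shows "D \<oplus>\<^bsub>Der A\<^esub> E \<in> derivations A"
  unfolding Der_simps
proof (rule derivationI)
  fix x y assume [simp]: "x \<in> carrier A" "y \<in> carrier A"
  have [simp]: "D x \<in> carrier A" "D y \<in> carrier A" "E x \<in> carrier A" "E y \<in> carrier A"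
    using D E by (auto intro: derivation_closed)
  show "D (x \<otimes>\<^bsub>A\<^esub> y) \<oplus>\<^bsub>A\<^esub> E (x \<otimes>\<^bsub>A\<^esub> y) =
      (D x \<oplus>\<^bsub>A\<^esub> E x) \<otimes>\<^bsub>A\<^esub> y \<oplus>\<^bsub>A\<^esub> x \<otimes>\<^bsub>A\<^esub> (D y \<oplus>\<^bsub>A\<^esub> E y)"
    by (simp add: derivation_mult[OF D] derivation_mult[OF E] A.l_distr A.r_distr A.a_ac)
qed (intro lin_sum mod derivation_lin D E)

lemma derivation_smult:
  assumes D: "D \<in> derivations A"
  shows "c \<odot>\<^bsub>Der A\<^esub> D \<in> derivations A"
  unfolding Der_simps
proof (rule derivationI)
  fix x y assume [simp]: "x \<in> carrier A" "y \<in> carrier A"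
  have [simp]: "D x \<in> carrier A" "D y \<in> carrier A"
    using D by (auto intro: derivation_closed)
  show "c \<odot>\<^bsub>A\<^esub> D (x \<otimes>\<^bsub>A\<^esub> y) = (c \<odot>\<^bsub>A\<^esub> D x) \<otimes>\<^bsub>A\<^esub> y \<oplus>\<^bsub>A\<^esub> x \<otimes>\<^bsub>A\<^esub> (c \<odot>\<^bsub>A\<^esub> D y)"
    by (simp add: derivation_mult[OF D] algebra_smult_left algebra_smult_right V.smult_r_distr)
qed (intro lin_scale mod derivation_lin D)

lemma derivation_bracket:
  assumes D: "D \<in> derivations A" and E: "E \<in> derivations A"
  shows "bracket (Der A) D E \<in> derivations A"
  unfolding Der_simps
proof (rule derivationI)
  fix x y assume [simp]: "x \<in> carrier A" "y \<in> carrier A"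
  have [simp]: "D x \<in> carrier A" "D y \<in> carrier A" "E x \<in> carrier A" "E y \<in> carrier A"
    using D E by (auto intro: derivation_closed)
  have [simp]: "D (E x) \<in> carrier A" "D (E y) \<in> carrier A" "E (D x) \<in> carrier A" "E (D y) \<in> carrier A"
    using D E by (auto intro: derivation_closed)
  have "D (E (x \<otimes>\<^bsub>A\<^esub> y)) = D (E x) \<otimes>\<^bsub>A\<^esub> y \<oplus>\<^bsub>A\<^esub> E x \<otimes>\<^bsub>A\<^esub> D y \<oplus>\<^bsub>A\<^esub> (D x \<otimes>\<^bsub>A\<^esub> E y \<oplus>\<^bsub>A\<^esub> x \<otimes>\<^bsub>A\<^esub> D (E y))"
    "E (D (x \<otimes>\<^bsub>A\<^esub> y)) = E (D x) \<otimes>\<^bsub>A\<^esub> y \<oplus>\<^bsub>A\<^esub> D x \<otimes>\<^bsub>A\<^esub> E y \<oplus>\<^bsub>A\<^esub> (E x \<otimes>\<^bsub>A\<^esub> D y \<oplus>\<^bsub>A\<^esub> x \<otimes>\<^bsub>A\<^esub> E (D y))"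
    by (simp_all add: derivation_mult[OF D] derivation_mult[OF E] lin_add[OF derivation_lin[OF D]]
        lin_add[OF derivation_lin[OF E]])
  moreover have "(p \<oplus>\<^bsub>A\<^esub> q \<oplus>\<^bsub>A\<^esub> (r \<oplus>\<^bsub>A\<^esub> s)) \<ominus>\<^bsub>A\<^esub> (t \<oplus>\<^bsub>A\<^esub> r \<oplus>\<^bsub>A\<^esub> (q \<oplus>\<^bsub>A\<^esub> u)) = (p \<ominus>\<^bsub>A\<^esub> t) \<oplus>\<^bsub>A\<^esub> (s \<ominus>\<^bsub>A\<^esub> u)"
    if c: "p \<in> carrier A" "q \<in> carrier A" "r \<in> carrier A" "s \<in> carrier A" "t \<in> carrier A" "u \<in> carrier A"
    for p q r s t u
  proof -
    have p: "p = (p \<ominus>\<^bsub>A\<^esub> t) \<oplus>\<^bsub>A\<^esub> t" and s: "s = (s \<ominus>\<^bsub>A\<^esub> u) \<oplus>\<^bsub>A\<^esub> u"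
      using c by (simp_all add: a_minus_def A.a_assoc A.l_neg)
    have "p \<ominus>\<^bsub>A\<^esub> t \<in> carrier A" "s \<ominus>\<^bsub>A\<^esub> u \<in> carrier A" using c by simp_all
    then have "p \<oplus>\<^bsub>A\<^esub> q \<oplus>\<^bsub>A\<^esub> (r \<oplus>\<^bsub>A\<^esub> s) = ((p \<ominus>\<^bsub>A\<^esub> t) \<oplus>\<^bsub>A\<^esub> (s \<ominus>\<^bsub>A\<^esub> u)) \<oplus>\<^bsub>A\<^esub> (t \<oplus>\<^bsub>A\<^esub> r \<oplus>\<^bsub>A\<^esub> (q \<oplus>\<^bsub>A\<^esub> u))"
      using c by (subst p, subst s) (simp add: A.a_ac)
    then show ?thesis
      using c by (simp add: a_minus_def A.a_assoc A.r_neg)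
  qed
  ultimately have "D (E (x \<otimes>\<^bsub>A\<^esub> y)) \<ominus>\<^bsub>A\<^esub> E (D (x \<otimes>\<^bsub>A\<^esub> y)) =
      (D (E x) \<otimes>\<^bsub>A\<^esub> y \<ominus>\<^bsub>A\<^esub> E (D x) \<otimes>\<^bsub>A\<^esub> y) \<oplus>\<^bsub>A\<^esub> (x \<otimes>\<^bsub>A\<^esub> D (E y) \<ominus>\<^bsub>A\<^esub> x \<otimes>\<^bsub>A\<^esub> E (D y))"
    by simp
  also have "\<dots> = (D (E x) \<ominus>\<^bsub>A\<^esub> E (D x)) \<otimes>\<^bsub>A\<^esub> y \<oplus>\<^bsub>A\<^esub> x \<otimes>\<^bsub>A\<^esub> (D (E y) \<ominus>\<^bsub>A\<^esub> E (D y))"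
    by (simp add: a_minus_def A.l_distr A.r_distr A.l_minus A.r_minus)
  finally show "D (E (x \<otimes>\<^bsub>A\<^esub> y)) \<ominus>\<^bsub>A\<^esub> E (D (x \<otimes>\<^bsub>A\<^esub> y)) =
      (D (E x) \<ominus>\<^bsub>A\<^esub> E (D x)) \<otimes>\<^bsub>A\<^esub> y \<oplus>\<^bsub>A\<^esub> x \<otimes>\<^bsub>A\<^esub> (D (E y) \<ominus>\<^bsub>A\<^esub> E (D y))" .
qed (rule lin_diff[OF mod mod lin_comp[OF derivation_lin[OF E] derivation_lin[OF D]]
      lin_comp[OF derivation_lin[OF D] derivation_lin[OF E]]])

lemma derivation_finprod:
  assumes D: "D \<in> derivations A" and "finite S" "a \<in> S \<rightarrow> carrier A"
  shows "D (\<Otimes>\<^bsub>A\<^esub>i\<in>S. a i) = (\<Oplus>\<^bsub>A\<^esub>i\<in>S. D (a i) \<otimes>\<^bsub>A\<^esub> (\<Otimes>\<^bsub>A\<^esub>k\<in>S - {i}. a k))"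
  using assms(2,3)
proof (induction S rule: finite_induct)
  case empty
  have c: "D \<one>\<^bsub>A\<^esub> \<in> carrier A"
    using derivation_closed[OF D] by simp
  have "D \<one>\<^bsub>A\<^esub> = D \<one>\<^bsub>A\<^esub> \<oplus>\<^bsub>A\<^esub> D \<one>\<^bsub>A\<^esub>"
    using derivation_mult[OF D, of "\<one>\<^bsub>A\<^esub>" "\<one>\<^bsub>A\<^esub>"] c by simp
  then have "D \<one>\<^bsub>A\<^esub> = \<zero>\<^bsub>A\<^esub>"
    using A.add.r_cancel_one'[OF c c] by simp
  then show ?case by simp
next
  case (insert k S)
  let ?P = "\<lambda>S. \<Otimes>\<^bsub>A\<^esub>i\<in>S. a i"
  have a: "a i \<in> carrier A" if "i \<in> insert k S" for i using insert.prems that by auto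
  have P: "?P T \<in> carrier A" if "T \<subseteq> insert k S" for T
    using a that by (intro A.finprod_closed) auto
  have Da: "D (a i) \<in> carrier A" if "i \<in> insert k S" for i
    using a[OF that] derivation_closed[OF D] by blast
  have ins: "?P (insert k S - {i}) = a k \<otimes>\<^bsub>A\<^esub> ?P (S - {i})" if "i \<in> S" for i
  proof -
    have "insert k S - {i} = insert k (S - {i})" using that insert.hyps by auto
    then show ?thesis using insert.hyps a by (simp add: A.finprod_insert Pi_iff)
  qed
  have "D (?P (insert k S)) = D (a k) \<otimes>\<^bsub>A\<^esub> ?P S \<oplus>\<^bsub>A\<^esub> a k \<otimes>\<^bsub>A\<^esub> D (?P S)"
    using insert.hyps a P[of S] by (simp add: A.finprod_insert Pi_iff derivation_mult[OF D] subset_insertI)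
  also have "a k \<otimes>\<^bsub>A\<^esub> D (?P S) = (\<Oplus>\<^bsub>A\<^esub>i\<in>S. a k \<otimes>\<^bsub>A\<^esub> (D (a i) \<otimes>\<^bsub>A\<^esub> ?P (S - {i})))"
    using insert a Da P by (subst insert.IH) (auto intro!: A.finsum_rdistr simp: Pi_iff)
  also have "\<dots> = (\<Oplus>\<^bsub>A\<^esub>i\<in>S. D (a i) \<otimes>\<^bsub>A\<^esub> ?P (insert k S - {i}))"
  proof (rule A.finsum_cong'[OF refl])
    fix i assume i: "i \<in> S"
    have "?P (S - {i}) \<in> carrier A" by (rule P) auto
    then show "a k \<otimes>\<^bsub>A\<^esub> (D (a i) \<otimes>\<^bsub>A\<^esub> ?P (S - {i})) = D (a i) \<otimes>\<^bsub>A\<^esub> ?P (insert k S - {i})"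
      using a[of k] Da[of i] i by (simp add: ins A.m_lcomm)
  qed (use Da P in \<open>auto simp: Pi_iff\<close>)
  also have "D (a k) \<otimes>\<^bsub>A\<^esub> ?P S = D (a k) \<otimes>\<^bsub>A\<^esub> ?P (insert k S - {k})"
    using insert.hyps by simp
  also have "D (a k) \<otimes>\<^bsub>A\<^esub> ?P (insert k S - {k}) \<oplus>\<^bsub>A\<^esub> (\<Oplus>\<^bsub>A\<^esub>i\<in>S. D (a i) \<otimes>\<^bsub>A\<^esub> ?P (insert k S - {i})) =
      (\<Oplus>\<^bsub>A\<^esub>i\<in>insert k S. D (a i) \<otimes>\<^bsub>A\<^esub> ?P (insert k S - {i}))"
    using insert.hyps Da P by (intro A.finsum_insert[symmetric]) (auto simp: Pi_iff)
  finally show ?case .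
qed

subsection \<open>The functor on \<open>\<Gamma>\<close>\<close>

lemma push_tuple_closed: "a \<in> tuples A m \<Longrightarrow> push_tuple A m n \<phi> a \<in> tuples A n"
  by (auto simp: push_tuple_def tuples_def intro!: A.finprod_closed)

text \<open>Changing the entry \<open>a\<^sub>i\<close> to \<open>x\<close> changes only \<open>b\<^sub>j\<close> for \<open>j = \<phi>(i)\<close>, which becomes \<open>x\<close> times the
  product of the other entries over \<open>j\<close>; hence \<open>a \<mapsto> b\<^sub>0 \<otimes> \<dots> \<otimes> b\<^sub>n\<close> is
  multilinear.\<close>

lemma push_tuple_upd:
  assumes a: "a \<in> tuples A m" and i: "i \<le> m" and \<phi>: "\<phi> \<in> {..m} \<rightarrow> {..n}" and x: "x \<in> carrier A"
  shows "push_tuple A m n \<phi> (a(i := x)) =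
    (push_tuple A m n \<phi> a)(\<phi> i := x \<otimes>\<^bsub>A\<^esub> (\<Otimes>\<^bsub>A\<^esub>k\<in>{k \<in> {..m}. \<phi> k = \<phi> i} - {i}. a k))"
proof
  fix j
  have am: "a k \<in> carrier A" if "k \<le> m" for k using a that by (rule tuples_mem)
  show "push_tuple A m n \<phi> (a(i := x)) j =
    ((push_tuple A m n \<phi> a)(\<phi> i := x \<otimes>\<^bsub>A\<^esub> (\<Otimes>\<^bsub>A\<^esub>k\<in>{k \<in> {..m}. \<phi> k = \<phi> i} - {i}. a k))) j"
  proof (cases "j = \<phi> i")
    case True
    define S where "S = {k \<in> {..m}. \<phi> k = \<phi> i} - {i}"
    have S: "{k \<in> {..m}. \<phi> k = \<phi> i} = insert i S" "i \<notin> S" "finite S" "S \<subseteq> {..m}"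
      using i by (auto simp: S_def)
    have "(\<Otimes>\<^bsub>A\<^esub>k\<in>insert i S. (a(i := x)) k) = x \<otimes>\<^bsub>A\<^esub> (\<Otimes>\<^bsub>A\<^esub>k\<in>S. (a(i := x)) k)"
      using S x am by (subst A.finprod_insert) auto
    also have "(\<Otimes>\<^bsub>A\<^esub>k\<in>S. (a(i := x)) k) = (\<Otimes>\<^bsub>A\<^esub>k\<in>S. a k)"
      using S x am by (intro A.finprod_cong') auto
    finally have "(\<Otimes>\<^bsub>A\<^esub>k\<in>insert i S. (a(i := x)) k) = x \<otimes>\<^bsub>A\<^esub> (\<Otimes>\<^bsub>A\<^esub>k\<in>S. a k)" .
    moreover have "push_tuple A m n \<phi> (a(i := x)) j = (\<Otimes>\<^bsub>A\<^esub>k\<in>{k \<in> {..m}. \<phi> k = \<phi> i}. (a(i := x)) k)"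
      using True \<phi> i by (auto simp: push_tuple_def Pi_iff)
    ultimately show ?thesis
      by (simp only: True fun_upd_same S(1) Diff_insert_absorb[OF S(2)])
  next
    case False
    then show ?thesis
      using x am by (auto simp: push_tuple_def intro!: A.finprod_cong')
  qed
qed

lemma multilinear_push:
  assumes \<phi>: "\<phi> \<in> {..m} \<rightarrow> {..n}"
  shows "multilinear A m (tensor_power A n) (\<lambda>a. pure_tensor A n (push_tuple A m n \<phi> a))"
  unfolding multilinear_def
proof (intro conjI ballI allI impI)
  show "(\<lambda>a. pure_tensor A n (push_tuple A m n \<phi> a)) \<in> tuples A m \<rightarrow> carrier (tensor_power A n)"
    by (simp add: pure_tensor_closed[OF mod] push_tuple_closed)
  fix a i assume a: "a \<in> tuples A m" and i: "i \<le> m"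
  let ?r = "\<Otimes>\<^bsub>A\<^esub>k\<in>{k \<in> {..m}. \<phi> k = \<phi> i} - {i}. a k"
  have r: "?r \<in> carrier A" using tuples_mem[OF a] by (intro A.finprod_closed) auto
  have "\<phi> i \<le> n" using \<phi> i by auto
  then have "(\<lambda>x. pure_tensor A n ((push_tuple A m n \<phi> a)(\<phi> i := x \<otimes>\<^bsub>A\<^esub> ?r))) \<in> lin_maps A (tensor_power A n)"
    using pure_tensor_lin[OF mod push_tuple_closed[OF a]] by (intro lin_comp[OF mult_right_lin[OF r]])
  then show "(\<lambda>x. pure_tensor A n (push_tuple A m n \<phi> (a(i := x)))) \<in> lin_maps A (tensor_power A n)"
    by (rule lin_cong[OF _ _ mod]) (simp add: push_tuple_upd[OF a i \<phi>])
qed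

lemma loday_gamma_lin:
  "\<phi> \<in> {..m} \<rightarrow> {..n} \<Longrightarrow> loday_gamma A m n \<phi> \<in> lin_maps (tensor_power A m) (tensor_power A n)"
  unfolding loday_gamma_eq
  by (intro tensor_lift_lin mod module_tensor_power multilinear_push)

lemma loday_gamma_pure:
  "\<phi> \<in> {..m} \<rightarrow> {..n} \<Longrightarrow> a \<in> tuples A m \<Longrightarrow>
    loday_gamma A m n \<phi> (pure_tensor A m a) = pure_tensor A n (push_tuple A m n \<phi> a)"
  unfolding loday_gamma_eq
  by (rule tensor_lift_pure[OF mod module_tensor_power[OF mod] multilinear_push])

lemma multilinear_derivation:
  assumes D: "D \<in> lin_maps A A"
  shows "multilinear A n (tensor_power A n)
    (\<lambda>a. \<Oplus>\<^bsub>tensor_power A n\<^esub>i\<in>{..n}. pure_tensor A n (a(i := D (a i))))"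
  unfolding multilinear_def
proof (intro conjI ballI allI impI)
  interpret T: module \<C> "tensor_power A n" by (rule module_tensor_power[OF mod])
  show "(\<lambda>a. \<Oplus>\<^bsub>tensor_power A n\<^esub>i\<in>{..n}. pure_tensor A n (a(i := D (a i)))) \<in> tuples A n \<rightarrow> carrier (tensor_power A n)"
    by (auto intro!: T.finsum_closed pure_tensor_closed[OF mod] tuples_upd lin_closed[OF D] tuples_mem)
  fix a k assume a: "a \<in> tuples A n" and k: "k \<le> n"
  show "(\<lambda>x. \<Oplus>\<^bsub>tensor_power A n\<^esub>i\<in>{..n}. pure_tensor A n ((a(k := x))(i := D ((a(k := x)) i))))
    \<in> lin_maps A (tensor_power A n)"
  proof (rule lin_finsum_maps[OF mod T.module_axioms])
    fix i assume "i \<in> {..n}"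
    then have i: "i \<le> n" by simp
    show "(\<lambda>x. pure_tensor A n ((a(k := x))(i := D ((a(k := x)) i)))) \<in> lin_maps A (tensor_power A n)"
    proof (cases "i = k")
      case True
      then show ?thesis
        using lin_comp[OF D pure_tensor_lin[OF mod a k]] by simp
    next
      case False
      have "a(i := D (a i)) \<in> tuples A n"
        using a i by (intro tuples_upd lin_closed[OF D] tuples_mem)
      from pure_tensor_lin[OF mod this k] show ?thesis
        using False by (simp add: fun_upd_twist)
    qed
  qed
qed

lemma L_gamma_lin: "D \<in> lin_maps A A \<Longrightarrow> L_gamma A D n \<in> lin_maps (tensor_power A n) (tensor_power A n)"
  unfolding L_gamma_def
  by (intro tensor_lift_lin mod module_tensor_power multilinear_derivation)

lemma L_gamma_pure: "D \<in> lin_maps A A \<Longrightarrow> a \<in> tuples A n \<Longrightarrow>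
    L_gamma A D n (pure_tensor A n a) =
      (\<Oplus>\<^bsub>tensor_power A n\<^esub>i\<in>{..n}. pure_tensor A n (a(i := D (a i))))"
  unfolding L_gamma_def
  by (rule tensor_lift_pure[OF mod module_tensor_power[OF mod] multilinear_derivation])

text \<open>\<open>L\<^sub>D\<close> is natural on \<open>\<Gamma>\<close>. On a pure tensor, the Leibniz rule writes \<open>D(b\<^sub>j)\<close> as a sum over the fibre
  \<open>\<phi>\<^sup>-\<^sup>1(j)\<close>, and the fibres partition \<open>[m]\<close>.\<close>

lemma L_gamma_natural:
  assumes D: "D \<in> derivations A" and \<phi>: "\<phi> \<in> {..m} \<rightarrow> {..n}" and t: "t \<in> carrier (tensor_power A m)"
  shows "L_gamma A D n (loday_gamma A m n \<phi> t) = loday_gamma A m n \<phi> (L_gamma A D m t)"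
proof (rule tensor_lin_ext[OF mod module_tensor_power[OF mod] _ _ _ t])
  note Dl = derivation_lin[OF D]
  show "(\<lambda>t. L_gamma A D n (loday_gamma A m n \<phi> t)) \<in> lin_maps (tensor_power A m) (tensor_power A n)"
    "(\<lambda>t. loday_gamma A m n \<phi> (L_gamma A D m t)) \<in> lin_maps (tensor_power A m) (tensor_power A n)"
    by (intro lin_comp[OF loday_gamma_lin[OF \<phi>] L_gamma_lin[OF Dl]]
        lin_comp[OF L_gamma_lin[OF Dl] loday_gamma_lin[OF \<phi>]])+
  fix a assume a: "a \<in> tuples A m"
  interpret T: module \<C> "tensor_power A n" by (rule module_tensor_power[OF mod])
  let ?T = "tensor_power A n" and ?b = "push_tuple A m n \<phi> a"
  define F where "F = (\<lambda>j. {i \<in> {..m}. \<phi> i = j})"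
  define G where "G = (\<lambda>i. pure_tensor A n (push_tuple A m n \<phi> (a(i := D (a i)))))"
  have am: "a k \<in> carrier A" "D (a k) \<in> carrier A" if "k \<le> m" for k
    using tuples_mem[OF a that] derivation_closed[OF D] by auto
  have G: "G i \<in> carrier ?T" if "i \<le> m" for i
    unfolding G_def by (intro pure_tensor_closed mod push_tuple_closed tuples_upd a am that)
  have slot: "pure_tensor A n (?b(j := D (?b j))) = (\<Oplus>\<^bsub>?T\<^esub>i\<in>F j. G i)" if j: "j \<le> n" for j
  proof -
    let ?r = "\<lambda>i. \<Otimes>\<^bsub>A\<^esub>k\<in>F j - {i}. a k"
    have r: "?r i \<in> carrier A" for i using am by (intro A.finprod_closed) (auto simp: F_def)
    have "D (?b j) = (\<Oplus>\<^bsub>A\<^esub>i\<in>F j. D (a i) \<otimes>\<^bsub>A\<^esub> ?r i)"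
      using j am by (subst derivation_finprod[OF D, symmetric]) (auto simp: push_tuple_def F_def)
    then have "pure_tensor A n (?b(j := D (?b j))) =
        (\<Oplus>\<^bsub>?T\<^esub>i\<in>F j. pure_tensor A n (?b(j := D (a i) \<otimes>\<^bsub>A\<^esub> ?r i)))"
      using am r
      by (simp only:) (rule lin_finsum[OF mod T.module_axioms pure_tensor_lin[OF mod push_tuple_closed[OF a] j]],
          auto simp: F_def)
    also have "\<dots> = (\<Oplus>\<^bsub>?T\<^esub>i\<in>F j. G i)"
    proof (rule T.finsum_cong'[OF refl])
      show "pure_tensor A n (?b(j := D (a i) \<otimes>\<^bsub>A\<^esub> ?r i)) = G i" if "i \<in> F j" for i
        using that am by (simp add: G_def push_tuple_upd[OF a _ \<phi>] F_def)
    qed (use G in \<open>auto simp: F_def\<close>)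
    finally show ?thesis .
  qed
  have "L_gamma A D n (loday_gamma A m n \<phi> (pure_tensor A m a)) =
      (\<Oplus>\<^bsub>?T\<^esub>j\<in>{..n}. pure_tensor A n (?b(j := D (?b j))))"
    by (simp add: loday_gamma_pure[OF \<phi> a] L_gamma_pure[OF Dl push_tuple_closed[OF a]])
  also have "\<dots> = (\<Oplus>\<^bsub>?T\<^esub>j\<in>{..n}. \<Oplus>\<^bsub>?T\<^esub>i\<in>F j. G i)"
    using G by (intro T.finsum_cong') (auto simp: slot F_def intro!: T.finsum_closed)
  also have "\<dots> = (\<Oplus>\<^bsub>?T\<^esub>i\<in>\<Union>(F ` {..n}). G i)"
    using G by (intro T.add.finprod_UN_disjoint[symmetric]) (auto simp: F_def pairwise_def disjnt_def)
  also have "\<Union>(F ` {..n}) = {..m}" using \<phi> by (auto simp: F_def)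
  also have "(\<Oplus>\<^bsub>?T\<^esub>i\<in>{..m}. G i) = (\<Oplus>\<^bsub>?T\<^esub>i\<in>{..m}. loday_gamma A m n \<phi> (pure_tensor A m (a(i := D (a i)))))"
    using G am by (intro T.finsum_cong') (auto simp: G_def loday_gamma_pure[OF \<phi>] tuples_upd[OF a])
  also have "\<dots> = loday_gamma A m n \<phi> (\<Oplus>\<^bsub>tensor_power A m\<^esub>i\<in>{..m}. pure_tensor A m (a(i := D (a i))))"
    using am by (intro lin_finsum[symmetric] module_tensor_power mod loday_gamma_lin \<phi>)
      (auto intro!: pure_tensor_closed[OF mod] tuples_upd[OF a])
  also have "\<dots> = loday_gamma A m n \<phi> (L_gamma A D m (pure_tensor A m a))"
    by (simp add: L_gamma_pure[OF Dl a])
  finally show "L_gamma A D n (loday_gamma A m n \<phi> (pure_tensor A m a)) = loday_gamma A m n \<phi> (L_gamma A D m (pure_tensor A m a))" .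
qed

lemma L_gamma_add:
  assumes D: "D \<in> derivations A" and E: "E \<in> derivations A" and t: "t \<in> carrier (tensor_power A n)"
  shows "L_gamma A (D \<oplus>\<^bsub>Der A\<^esub> E) n t = L_gamma A D n t \<oplus>\<^bsub>tensor_power A n\<^esub> L_gamma A E n t"
proof (rule tensor_lin_ext[OF mod module_tensor_power[OF mod] _ _ _ t])
  let ?T = "tensor_power A n"
  interpret T: module \<C> ?T by (rule module_tensor_power[OF mod])
  note l = derivation_lin[OF D] derivation_lin[OF E] derivation_lin[OF derivation_add[OF D E]]
  show "L_gamma A (D \<oplus>\<^bsub>Der A\<^esub> E) n \<in> lin_maps ?T ?T"
    "(\<lambda>t. L_gamma A D n t \<oplus>\<^bsub>?T\<^esub> L_gamma A E n t) \<in> lin_maps ?T ?T"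
    by (intro lin_sum T.module_axioms L_gamma_lin l)+
  fix a assume a: "a \<in> tuples A n"
  note cl = pure_tensor_closed[OF mod tuples_upd[OF a]] derivation_closed[OF D] derivation_closed[OF E] tuples_mem[OF a]
  have "(\<Oplus>\<^bsub>?T\<^esub>i\<in>{..n}. pure_tensor A n (a(i := (D \<oplus>\<^bsub>Der A\<^esub> E) (a i)))) =
    (\<Oplus>\<^bsub>?T\<^esub>i\<in>{..n}. pure_tensor A n (a(i := D (a i))) \<oplus>\<^bsub>?T\<^esub> pure_tensor A n (a(i := E (a i))))"
    by (rule T.finsum_cong'[OF refl])
      (auto simp: Der_simps lin_add[OF pure_tensor_lin[OF mod a]] cl)
  also have "\<dots> = (\<Oplus>\<^bsub>?T\<^esub>i\<in>{..n}. pure_tensor A n (a(i := D (a i)))) \<oplus>\<^bsub>?T\<^esub> (\<Oplus>\<^bsub>?T\<^esub>i\<in>{..n}. pure_tensor A n (a(i := E (a i))))"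
    by (rule T.finsum_addf) (auto simp: cl)
  finally show "L_gamma A (D \<oplus>\<^bsub>Der A\<^esub> E) n (pure_tensor A n a) =
      L_gamma A D n (pure_tensor A n a) \<oplus>\<^bsub>?T\<^esub> L_gamma A E n (pure_tensor A n a)"
    by (simp only: L_gamma_pure[OF _ a] l)
qed

lemma L_gamma_smult:
  assumes D: "D \<in> derivations A" and t: "t \<in> carrier (tensor_power A n)"
  shows "L_gamma A (c \<odot>\<^bsub>Der A\<^esub> D) n t = c \<odot>\<^bsub>tensor_power A n\<^esub> L_gamma A D n t"
proof (rule tensor_lin_ext[OF mod module_tensor_power[OF mod] _ _ _ t])
  let ?T = "tensor_power A n"
  interpret T: module \<C> ?T by (rule module_tensor_power[OF mod])
  note l = derivation_lin[OF D] derivation_lin[OF derivation_smult[OF D]]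
  show "L_gamma A (c \<odot>\<^bsub>Der A\<^esub> D) n \<in> lin_maps ?T ?T"
    "(\<lambda>t. c \<odot>\<^bsub>?T\<^esub> L_gamma A D n t) \<in> lin_maps ?T ?T"
    by (intro lin_scale T.module_axioms L_gamma_lin l)+
  fix a assume a: "a \<in> tuples A n"
  note cl = pure_tensor_closed[OF mod tuples_upd[OF a]] derivation_closed[OF D] tuples_mem[OF a]
  have "(\<Oplus>\<^bsub>?T\<^esub>i\<in>{..n}. pure_tensor A n (a(i := (c \<odot>\<^bsub>Der A\<^esub> D) (a i)))) =
    (\<Oplus>\<^bsub>?T\<^esub>i\<in>{..n}. c \<odot>\<^bsub>?T\<^esub> pure_tensor A n (a(i := D (a i))))"
    by (rule T.finsum_cong'[OF refl])
      (auto simp: Der_simps lin_smult[OF pure_tensor_lin[OF mod a]] cl)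
  also have "\<dots> = c \<odot>\<^bsub>?T\<^esub> (\<Oplus>\<^bsub>?T\<^esub>i\<in>{..n}. pure_tensor A n (a(i := D (a i))))"
    by (rule T.finsum_smult_ldistr[symmetric]) (auto simp: cl)
  finally show "L_gamma A (c \<odot>\<^bsub>Der A\<^esub> D) n (pure_tensor A n a) = c \<odot>\<^bsub>?T\<^esub> L_gamma A D n (pure_tensor A n a)"
    by (simp only: L_gamma_pure[OF _ a] l)
qed

text \<open>In \<open>L\<^sub>D L\<^sub>E - L\<^sub>E L\<^sub>D\<close> the terms with \<open>D\<close> and \<open>E\<close> in different slots cancel.\<close>

lemma L_gamma_bracket:
  assumes D: "D \<in> derivations A" and E: "E \<in> derivations A" and t: "t \<in> carrier (tensor_power A n)"
  shows "L_gamma A (bracket (Der A) D E) n t =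
    L_gamma A D n (L_gamma A E n t) \<ominus>\<^bsub>tensor_power A n\<^esub> L_gamma A E n (L_gamma A D n t)"
proof (rule tensor_lin_ext[OF mod module_tensor_power[OF mod] _ _ _ t])
  let ?T = "tensor_power A n" and ?p = "pure_tensor A n"
  interpret T: module \<C> ?T by (rule module_tensor_power[OF mod])
  note l = derivation_lin[OF D] derivation_lin[OF E] derivation_lin[OF derivation_bracket[OF D E]]
  note L = L_gamma_lin[OF l(1), of n] L_gamma_lin[OF l(2), of n]
  show "L_gamma A (bracket (Der A) D E) n \<in> lin_maps ?T ?T"
    by (intro L_gamma_lin l)
  show "(\<lambda>t. L_gamma A D n (L_gamma A E n t) \<ominus>\<^bsub>?T\<^esub> L_gamma A E n (L_gamma A D n t)) \<in> lin_maps ?T ?T"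
    by (intro lin_diff T.module_axioms lin_comp[OF L(1) L(2)] lin_comp[OF L(2) L(1)])
  fix a assume a: "a \<in> tuples A n"
  define H where "H D E i j = (if i = j then ?p (a(i := D (E (a i)))) else ?p (a(i := E (a i), j := D (a j))))"
    for D E i j
  have Hc: "H D E i j \<in> carrier ?T" if "i \<le> n" "j \<le> n" "D \<in> derivations A" "E \<in> derivations A" for D E i j
  proof -
    have "D (E (a i)) \<in> carrier A" "E (a i) \<in> carrier A" "D (a j) \<in> carrier A"
      using that tuples_mem[OF a] derivation_closed by metis+
    then show ?thesis
      using that by (auto simp: H_def pure_tensor_closed[OF mod] tuples_upd a)
  qed
  have LL: "L_gamma A D n (L_gamma A E n (?p a)) = (\<Oplus>\<^bsub>?T\<^esub>i\<in>{..n}. \<Oplus>\<^bsub>?T\<^esub>j\<in>{..n}. H D E i j)"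
    if D: "D \<in> derivations A" and E: "E \<in> derivations A" for D E
  proof -
    note l = derivation_lin[OF D] derivation_lin[OF E]
    have up: "a(i := E (a i)) \<in> tuples A n" if "i \<le> n" for i
      using that a tuples_mem[OF a] derivation_closed[OF E] by (simp add: tuples_upd)
    have "L_gamma A D n (L_gamma A E n (?p a)) = (\<Oplus>\<^bsub>?T\<^esub>i\<in>{..n}. L_gamma A D n (?p (a(i := E (a i)))))"
      unfolding L_gamma_pure[OF l(2) a]
      by (intro lin_finsum T.module_axioms L_gamma_lin l) (auto intro!: pure_tensor_closed[OF mod] up)
    also have "\<dots> = (\<Oplus>\<^bsub>?T\<^esub>i\<in>{..n}. \<Oplus>\<^bsub>?T\<^esub>j\<in>{..n}. H D E i j)"
    proof (rule T.finsum_cong'[OF refl])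
      fix i assume "i \<in> {..n}"
      then have i: "i \<le> n" by simp
      have "(\<Oplus>\<^bsub>?T\<^esub>j\<in>{..n}. ?p ((a(i := E (a i)))(j := D ((a(i := E (a i))) j)))) = (\<Oplus>\<^bsub>?T\<^esub>j\<in>{..n}. H D E i j)"
        using Hc[OF i _ D E] by (intro T.finsum_cong') (auto simp: H_def)
      then show "L_gamma A D n (?p (a(i := E (a i)))) = (\<Oplus>\<^bsub>?T\<^esub>j\<in>{..n}. H D E i j)"
        by (simp only: L_gamma_pure[OF l(1) up[OF i]])
    qed (use Hc D E in \<open>auto intro!: T.finsum_closed\<close>)
    finally show ?thesis .
  qed
  have sym: "H E D j i = H D E i j" if "i \<noteq> j" for i j
    using that by (simp add: H_def fun_upd_twist)
  have "L_gamma A D n (L_gamma A E n (?p a)) \<ominus>\<^bsub>?T\<^esub> L_gamma A E n (L_gamma A D n (?p a)) =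
      (\<Oplus>\<^bsub>?T\<^esub>i\<in>{..n}. \<Oplus>\<^bsub>?T\<^esub>j\<in>{..n}. H D E i j) \<ominus>\<^bsub>?T\<^esub> (\<Oplus>\<^bsub>?T\<^esub>i\<in>{..n}. \<Oplus>\<^bsub>?T\<^esub>j\<in>{..n}. H E D j i)"
    unfolding LL[OF D E] LL[OF E D]
    by (subst (2) T.finsum_swap) (auto simp: Hc D E)
  also have "\<dots> = (\<Oplus>\<^bsub>?T\<^esub>i\<in>{..n}. \<Oplus>\<^bsub>?T\<^esub>j\<in>{..n}. H D E i j \<ominus>\<^bsub>?T\<^esub> H E D j i)"
    by (subst T.finsum_diff, (auto simp: Hc D E intro!: T.finsum_closed)[2])
       (intro T.finsum_cong' refl T.finsum_diff, auto simp: Hc D E intro!: T.finsum_closed)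
  also have "\<dots> = (\<Oplus>\<^bsub>?T\<^esub>i\<in>{..n}. ?p (a(i := bracket (Der A) D E (a i))))"
  proof (rule T.finsum_cong'[OF refl])
    fix i assume "i \<in> {..n}"
    then have i: "i \<le> n" by simp
    have ai: "a i \<in> carrier A" by (rule tuples_mem[OF a i])
    have "(\<Oplus>\<^bsub>?T\<^esub>j\<in>{..n}. H D E i j \<ominus>\<^bsub>?T\<^esub> H E D j i) =
        (\<Oplus>\<^bsub>?T\<^esub>j\<in>{..n}. if i = j then H D E j j \<ominus>\<^bsub>?T\<^esub> H E D j j else \<zero>\<^bsub>?T\<^esub>)"
      using i by (intro T.finsum_cong') (auto simp: Hc D E sym T.minus_eq_zero_iff)
    also have "\<dots> = H D E i i \<ominus>\<^bsub>?T\<^esub> H E D i i"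
      using i by (intro T.finsum_singleton) (auto simp: Hc D E)
    also have "\<dots> = ?p (a(i := D (E (a i)))) \<ominus>\<^bsub>?T\<^esub> ?p (a(i := E (D (a i))))"
      by (simp add: H_def)
    also have "\<dots> = ?p (a(i := bracket (Der A) D E (a i)))"
      using ai derivation_closed[OF D] derivation_closed[OF E]
      by (subst lin_minus[OF mod T.module_axioms pure_tensor_lin[OF mod a i], symmetric])
         (auto simp: Der_simps)
    finally show "(\<Oplus>\<^bsub>?T\<^esub>j\<in>{..n}. H D E i j \<ominus>\<^bsub>?T\<^esub> H E D j i) = ?p (a(i := bracket (Der A) D E (a i)))" .
  qed (auto intro!: pure_tensor_closed[OF mod] tuples_upd[OF a] derivation_closed[OF derivation_bracket[OF D E]] tuples_mem[OF a])
  finally show "L_gamma A (bracket (Der A) D E) n (?p a) =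
      L_gamma A D n (L_gamma A E n (?p a)) \<ominus>\<^bsub>?T\<^esub> L_gamma A E n (L_gamma A D n (?p a))"
    by (simp only: L_gamma_pure[OF l(3) a])
qed

end

subsection \<open>The extension to finite pointed sets\<close>

lemma over_objsI: "\<phi> \<in> pointed_maps (gamma_obj m) T \<Longrightarrow> (m, \<phi>) \<in> over_objs T"
  by (simp add: over_objs_def)

lemma pointed_maps_comp:
  assumes "\<phi> \<in> pointed_maps (gamma_obj m) S" "f \<in> pointed_maps S T"
  shows "compose {..m} f \<phi> \<in> pointed_maps (gamma_obj m) T"
  using assms by (auto simp: pointed_maps_def gamma_obj_def compose_def)

lemma over_objs_comp: "(m, \<phi>) \<in> over_objs S \<Longrightarrow> f \<in> pointed_maps S T \<Longrightarrow> (m, compose {..m} f \<phi>) \<in> over_objs T"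
  by (simp add: over_objs_def pointed_maps_comp)

lemma over_arrsE:
  assumes "(i, j, f) \<in> over_arrs A T"
  obtains m n \<phi> \<psi> where "i = (m, compose {..m} \<phi> \<psi>)" "j = (n, \<phi>)" "f = loday_gamma A m n \<psi>"
    "\<phi> \<in> pointed_maps (gamma_obj n) T" "\<psi> \<in> pointed_maps (gamma_obj m) (gamma_obj n)"
  using assms by (auto simp: over_arrs_def)

context
  fixes A :: "(complex, 'a, 'm) module_scheme"
  assumes alg: "algebra \<C> A"
begin

private lemma module_A: "module \<C> A"
  using alg by (simp add: algebra_def)

private lemma objs: "\<forall>i\<in>over_objs T. module \<C> ((\<lambda>(m, \<phi>). tensor_power A m) i)"
  using module_tensor_power[OF module_A] by auto

private lemma arrs: "\<forall>(i, j, f)\<in>over_arrs A T. i \<in> over_objs T \<and> j \<in> over_objs T \<and>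
    f \<in> lin_maps ((\<lambda>(m, \<phi>). tensor_power A m) i) ((\<lambda>(m, \<phi>). tensor_power A m) j)"
proof -
  have "i \<in> over_objs T \<and> j \<in> over_objs T \<and>
      f \<in> lin_maps ((\<lambda>(m, \<phi>). tensor_power A m) i) ((\<lambda>(m, \<phi>). tensor_power A m) j)"
    if "(i, j, f) \<in> over_arrs A T" for i j f
    using that
  proof (cases rule: over_arrsE)
    case (1 m n \<phi> \<psi>)
    then show ?thesis
      using loday_gamma_lin[OF alg pointed_maps_gammaD[OF 1(5)]]
      by (simp add: over_objsI pointed_maps_comp[OF 1(5,4)])
  qed
  then show ?thesis by blast
qed

lemma module_loday: "module \<C> (loday A T)"
  unfolding loday_def by (rule module_colim[OF objs arrs])

lemma loday_in_lin: "(m, \<phi>) \<in> over_objs T \<Longrightarrow> loday_in A T (m, \<phi>) \<in> lin_maps (tensor_power A m) (loday A T)"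
  unfolding loday_def loday_in_def using colim_in_lin[OF objs arrs, of "(m, \<phi>)" T] by simp

lemma loday_in_arrow:
  assumes "\<phi> \<in> pointed_maps (gamma_obj n) T" "\<psi> \<in> pointed_maps (gamma_obj m) (gamma_obj n)"
    and "x \<in> carrier (tensor_power A m)"
  shows "loday_in A T (n, \<phi>) (loday_gamma A m n \<psi> x) = loday_in A T (m, compose {..m} \<phi> \<psi>) x"
  unfolding loday_in_def
  by (rule colim_in_arrow[OF objs arrs]) (use assms in \<open>auto simp: over_arrs_def\<close>)

lemma loday_lin_ext:
  assumes "module \<C> N" "F \<in> lin_maps (loday A T) N" "G \<in> lin_maps (loday A T) N"
    and "\<And>m \<phi> x. (m, \<phi>) \<in> over_objs T \<Longrightarrow> x \<in> carrier (tensor_power A m) \<Longrightarrow>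
      F (loday_in A T (m, \<phi>) x) = G (loday_in A T (m, \<phi>) x)"
    and "t \<in> carrier (loday A T)"
  shows "F t = G t"
proof (rule colim_lin_ext[OF objs arrs assms(1) assms(2,3)[unfolded loday_def] _
      assms(5)[unfolded loday_def]])
  fix i x assume "i \<in> over_objs T" "x \<in> carrier ((\<lambda>(m, \<phi>). tensor_power A m) i)"
  then show "F (colim_in (over_objs T) (\<lambda>(m, \<phi>). tensor_power A m) (over_arrs A T) i x) =
      G (colim_in (over_objs T) (\<lambda>(m, \<phi>). tensor_power A m) (over_arrs A T) i x)"
    using assms(4)[unfolded loday_in_def, of "fst i" "snd i" x] by (cases i) simp
qed

context
  fixes T :: "'s pset" and N :: "(complex, 'w, 'n) module_scheme" and h :: "'s gamma_over \<Rightarrow> 'a tensor \<Rightarrow> 'w"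
  assumes N: "module \<C> N"
    and h: "\<And>m \<phi>. (m, \<phi>) \<in> over_objs T \<Longrightarrow> h (m, \<phi>) \<in> lin_maps (tensor_power A m) N"
    and cocone: "\<And>m n \<phi> \<psi> x. \<lbrakk>\<phi> \<in> pointed_maps (gamma_obj n) T;
      \<psi> \<in> pointed_maps (gamma_obj m) (gamma_obj n); x \<in> carrier (tensor_power A m)\<rbrakk> \<Longrightarrow>
      h (n, \<phi>) (loday_gamma A m n \<psi> x) = h (m, compose {..m} \<phi> \<psi>) x"
begin

private lemma h_ball: "\<forall>i\<in>over_objs T. h i \<in> lin_maps ((\<lambda>(m, \<phi>). tensor_power A m) i) N"
  using h by auto

private lemma cocone_ball:
  "\<forall>(i, j, f)\<in>over_arrs A T. \<forall>x\<in>carrier ((\<lambda>(m, \<phi>). tensor_power A m) i). h j (f x) = h i x"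
  using cocone by (auto elim!: over_arrsE)

lemma loday_lift_lin: "loday_lift A T N h \<in> lin_maps (loday A T) N"
  unfolding loday_def loday_lift_def by (rule colim_lift_lin[OF objs arrs N h_ball cocone_ball])

lemma loday_lift_in:
  "(m, \<phi>) \<in> over_objs T \<Longrightarrow> x \<in> carrier (tensor_power A m) \<Longrightarrow>
    loday_lift A T N h (loday_in A T (m, \<phi>) x) = h (m, \<phi>) x"
  unfolding loday_in_def loday_lift_def
  by (rule colim_lift_in[OF objs arrs N h_ball cocone_ball]) auto

end

lemma loday_map_lin_in:
  assumes f: "f \<in> pointed_maps S T"
  shows "loday_map A S T f \<in> lin_maps (loday A S) (loday A T)" (is ?lin)
    and "(m, \<phi>) \<in> over_objs S \<Longrightarrow> x \<in> carrier (tensor_power A m) \<Longrightarrow>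
      loday_map A S T f (loday_in A S (m, \<phi>) x) = loday_in A T (m, compose {..m} f \<phi>) x"
proof -
  let ?h = "\<lambda>(m, \<phi>). loday_in A T (m, compose {..m} f \<phi>)"
  have h: "?h (m, \<phi>) \<in> lin_maps (tensor_power A m) (loday A T)" if "(m, \<phi>) \<in> over_objs S" for m \<phi>
    using loday_in_lin[OF over_objs_comp[OF that f]] by simp
  have c: "?h (n, \<phi>) (loday_gamma A m n \<psi> x) = ?h (m, compose {..m} \<phi> \<psi>) x"
    if a: "\<phi> \<in> pointed_maps (gamma_obj n) S" "\<psi> \<in> pointed_maps (gamma_obj m) (gamma_obj n)"
      "x \<in> carrier (tensor_power A m)" for m n \<phi> \<psi> x
  proof -
    have "compose {..m} (compose {..n} f \<phi>) \<psi> = compose {..m} f (compose {..m} \<phi> \<psi>)"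
      using pointed_maps_gammaD[OF a(2)] by (auto simp: compose_def fun_eq_iff Pi_iff)
    then show ?thesis
      using loday_in_arrow[OF pointed_maps_comp[OF a(1) f] a(2,3)] by simp
  qed
  show ?lin unfolding loday_map_def by (rule loday_lift_lin[OF module_loday h c])
  show "loday_map A S T f (loday_in A S (m, \<phi>) x) = loday_in A T (m, compose {..m} f \<phi>) x"
    if "(m, \<phi>) \<in> over_objs S" "x \<in> carrier (tensor_power A m)"
    unfolding loday_map_def using loday_lift_in[where h = ?h, OF module_loday h c that] by simp
qed

lemma loday_map_comp:
  assumes S: "finite_pointed S" and f: "f \<in> pointed_maps S T" and g: "g \<in> pointed_maps T U"
    and t: "t \<in> carrier (loday A S)"
  shows "loday_map A T U g (loday_map A S T f t) = loday_map A S U (compose (fst S) g f) t"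
proof -
  have gf: "compose (fst S) g f \<in> pointed_maps S U"
    using S f g by (auto simp: pointed_maps_def compose_def finite_pointed_def)
  note F = loday_map_lin_in[OF f] and G = loday_map_lin_in[OF g] and GF = loday_map_lin_in[OF gf]
  show ?thesis
  proof (rule loday_lin_ext[OF module_loday lin_comp[OF F(1) G(1)] GF(1) _ t])
    fix m \<phi> x assume o: "(m, \<phi>) \<in> over_objs S" and x: "x \<in> carrier (tensor_power A m)"
    have "compose {..m} g (compose {..m} f \<phi>) = compose {..m} (compose (fst S) g f) \<phi>"
      using o by (auto simp: compose_def fun_eq_iff over_objs_def pointed_maps_def gamma_obj_def)
    then show "loday_map A T U g (loday_map A S T f (loday_in A S (m, \<phi>) x)) =
        loday_map A S U (compose (fst S) g f) (loday_in A S (m, \<phi>) x)"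
      by (simp add: F(2)[OF o x] G(2)[OF over_objs_comp[OF o f] x] GF(2)[OF o x])
  qed
qed

lemma L_fin_lin_in:
  assumes D: "D \<in> derivations A"
  shows "L_fin A D T \<in> lin_maps (loday A T) (loday A T)" (is ?lin)
    and "(m, \<phi>) \<in> over_objs T \<Longrightarrow> x \<in> carrier (tensor_power A m) \<Longrightarrow>
      L_fin A D T (loday_in A T (m, \<phi>) x) = loday_in A T (m, \<phi>) (L_gamma A D m x)"
proof -
  let ?h = "\<lambda>(m, \<phi>) x. loday_in A T (m, \<phi>) (L_gamma A D m x)"
  note Dl = L_gamma_lin[OF alg derivation_lin[OF D]]
  have h: "?h (m, \<phi>) \<in> lin_maps (tensor_power A m) (loday A T)" if "(m, \<phi>) \<in> over_objs T" for m \<phi>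
    using lin_comp[OF Dl loday_in_lin[OF that]] by simp
  have c: "?h (n, \<phi>) (loday_gamma A m n \<psi> x) = ?h (m, compose {..m} \<phi> \<psi>) x"
    if a: "\<phi> \<in> pointed_maps (gamma_obj n) T" "\<psi> \<in> pointed_maps (gamma_obj m) (gamma_obj n)"
      "x \<in> carrier (tensor_power A m)" for m n \<phi> \<psi> x
    using loday_in_arrow[OF a(1,2) lin_closed[OF Dl a(3)]]
      L_gamma_natural[OF alg D pointed_maps_gammaD[OF a(2)] a(3)] by simp
  show ?lin unfolding L_fin_def by (rule loday_lift_lin[OF module_loday h c])
  show "L_fin A D T (loday_in A T (m, \<phi>) x) = loday_in A T (m, \<phi>) (L_gamma A D m x)"
    if "(m, \<phi>) \<in> over_objs T" "x \<in> carrier (tensor_power A m)"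
    unfolding L_fin_def using loday_lift_in[where h = ?h, OF module_loday h c that] by simp
qed

lemma L_fin_natural:
  assumes D: "D \<in> derivations A" and f: "f \<in> pointed_maps S T" and t: "t \<in> carrier (loday A S)"
  shows "L_fin A D T (loday_map A S T f t) = loday_map A S T f (L_fin A D S t)"
proof -
  note F = loday_map_lin_in[OF f] and LS = L_fin_lin_in[where T = S, OF D] and LT = L_fin_lin_in[where T = T, OF D]
  show ?thesis
  proof (rule loday_lin_ext[OF module_loday lin_comp[OF F(1) LT(1)] lin_comp[OF LS(1) F(1)] _ t])
    fix m \<phi> x assume o: "(m, \<phi>) \<in> over_objs S" and x: "x \<in> carrier (tensor_power A m)"
    show "L_fin A D T (loday_map A S T f (loday_in A S (m, \<phi>) x)) =
        loday_map A S T f (L_fin A D S (loday_in A S (m, \<phi>) x))"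
      using lin_closed[OF L_gamma_lin[OF alg derivation_lin[OF D]] x]
      by (simp add: F(2)[OF o x] LS(2)[OF o x] LT(2)[OF over_objs_comp[OF o f] x] F(2)[OF o])
  qed
qed

lemma L_fin_add:
  assumes D: "D \<in> derivations A" and E: "E \<in> derivations A" and t: "t \<in> carrier (loday A T)"
  shows "L_fin A (D \<oplus>\<^bsub>Der A\<^esub> E) T t = L_fin A D T t \<oplus>\<^bsub>loday A T\<^esub> L_fin A E T t"
proof -
  note L = L_fin_lin_in[where T = T, OF D] L_fin_lin_in[where T = T, OF E] L_fin_lin_in[where T = T, OF derivation_add[OF alg D E]]
  note G = L_gamma_lin[OF alg derivation_lin]
  show ?thesis
    using L_gamma_add[OF alg D E] lin_add[OF loday_in_lin lin_closed[OF G[OF D]] lin_closed[OF G[OF E]]]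
    by (intro loday_lin_ext[OF module_loday L(5) lin_sum[OF module_loday L(1,3)] _ t]) (simp add: L)
qed

lemma L_fin_smult:
  assumes D: "D \<in> derivations A" and t: "t \<in> carrier (loday A T)"
  shows "L_fin A (c \<odot>\<^bsub>Der A\<^esub> D) T t = c \<odot>\<^bsub>loday A T\<^esub> L_fin A D T t"
proof -
  note L = L_fin_lin_in[where T = T, OF D] L_fin_lin_in[where T = T, OF derivation_smult[OF alg D, of c]]
  note G = L_gamma_lin[OF alg derivation_lin]
  show ?thesis
    using L_gamma_smult[OF alg D] lin_smult[OF loday_in_lin lin_closed[OF G[OF D]]]
    by (intro loday_lin_ext[OF module_loday L(3) lin_scale[OF module_loday L(1)] _ t]) (simp add: L)
qed

lemma L_fin_bracket:
  assumes D: "D \<in> derivations A" and E: "E \<in> derivations A" and t: "t \<in> carrier (loday A T)"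
  shows "L_fin A (bracket (Der A) D E) T t =
    L_fin A D T (L_fin A E T t) \<ominus>\<^bsub>loday A T\<^esub> L_fin A E T (L_fin A D T t)"
proof -
  note L = L_fin_lin_in[where T = T, OF D] L_fin_lin_in[where T = T, OF E] L_fin_lin_in[where T = T, OF derivation_bracket[OF alg D E]]
  note G = L_gamma_lin[OF alg derivation_lin]
  note Gc = lin_closed[OF G[OF D]] lin_closed[OF G[OF E]]
  show ?thesis
  proof (rule loday_lin_ext[OF module_loday L(5)
        lin_diff[OF module_loday module_loday lin_comp[OF L(3,1)] lin_comp[OF L(1,3)]] _ t])
    fix m \<phi> x assume o: "(m, \<phi>) \<in> over_objs T" and x: "x \<in> carrier (tensor_power A m)"
    have "loday_in A T (m, \<phi>) (L_gamma A (bracket (Der A) D E) m x) =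
        loday_in A T (m, \<phi>) (L_gamma A D m (L_gamma A E m x)) \<ominus>\<^bsub>loday A T\<^esub>
        loday_in A T (m, \<phi>) (L_gamma A E m (L_gamma A D m x))"
      unfolding L_gamma_bracket[OF alg D E x]
      by (rule lin_minus[OF module_tensor_power[OF module_A] module_loday loday_in_lin[OF o]
            Gc(1)[OF Gc(2)[OF x]] Gc(2)[OF Gc(1)[OF x]]])
    then show "L_fin A (bracket (Der A) D E) T (loday_in A T (m, \<phi>) x) =
        L_fin A D T (L_fin A E T (loday_in A T (m, \<phi>) x)) \<ominus>\<^bsub>loday A T\<^esub>
        L_fin A E T (L_fin A D T (loday_in A T (m, \<phi>) x))"
      by (simp only: L(6)[OF o x] L(2)[OF o x] L(4)[OF o x] L(2)[OF o Gc(2)[OF x]] L(4)[OF o Gc(1)[OF x]])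
  qed
qed

end

section \<open>Homology of \<open>N\<close>-complexes\<close>

lemma submodule_restrict:
  assumes "module \<C> M" "submodule K \<C> M" "submodule W \<C> M" "W \<subseteq> K"
  shows "submodule W \<C> (M\<lparr>carrier := K\<rparr>)"
proof (rule submoduleI_complex[OF submodule.submodule_is_module[OF assms(2,1)]])
  interpret W: additive_subgroup W M by (rule submodule_additive_subgroup[OF assms(3)])
  show "W \<subseteq> carrier (M\<lparr>carrier := K\<rparr>)" using assms(4) by simp
qed (use assms(3) in \<open>auto simp: submodule_smult additive_subgroup.a_closed[OF submodule_additive_subgroup]
      additive_subgroup.zero_closed[OF submodule_additive_subgroup]\<close>)

lemma b_power_cong:
  assumes "\<And>n x. x \<in> carrier (C n) \<Longrightarrow> b n x = b' n x"
    and "\<And>n x. x \<in> carrier (C n) \<Longrightarrow> b' n x \<in> carrier (C (n - 1))"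
    and "x \<in> carrier (C n)"
  shows "b_power b k n x = b_power b' k n x"
  using assms(3) by (induction k arbitrary: n x) (simp_all add: assms(1,2))

lemma b_power_add: "b_power b (j + k) n x = b_power b j (n - int k) (b_power b k n x)"
  by (induction k arbitrary: n x) (simp_all add: algebra_simps)

lemma b_power_lin:
  assumes "\<And>n. b n \<in> lin_maps (C n) (C (n - 1))"
  shows "b_power b k n \<in> lin_maps (C n) (C (n - int k))"
proof (induction k arbitrary: n)
  case 0
  then show ?case using lin_id[of "C n"] by (simp add: lin_maps_def)
next
  case (Suc k)
  have "n - int (Suc k) = n - 1 - int k" by simp
  moreover have "b_power b (Suc k) n = (\<lambda>x. b_power b k (n - 1) (b n x))" by auto
  ultimately show ?case using lin_comp[OF assms Suc.IH] by metis
qed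

text \<open>An \<open>N\<close>-complex of complex vector spaces.\<close>

locale n_complex =
  fixes N :: nat and C :: "int \<Rightarrow> (complex, 'v) module" and b :: "int \<Rightarrow> 'v \<Rightarrow> 'v"
  assumes module_C: "module \<C> (C n)"
    and b_lin: "b n \<in> lin_maps (C n) (C (n - 1))"
    and b_nilpotent: "x \<in> carrier (C n) \<Longrightarrow> b_power b N n x = \<zero>\<^bsub>C (n - int N)\<^esub>"
begin

lemma submodule_b_ker: "submodule (b_ker C b i n) \<C> (C n)"
  unfolding b_ker_def by (intro submodule_kernel module_C b_power_lin b_lin)

lemma submodule_b_im: "submodule (b_im C b k n) \<C> (C n)"
proof -
  have "b_power b k (n + int k) \<in> lin_maps (C (n + int k)) (C n)"
    using b_power_lin[where C = C, OF b_lin, of k "n + int k"] by simp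
  then show ?thesis
    unfolding b_im_def by (intro submodule_image module_C)
qed

lemma b_im_subset_b_ker:
  assumes "i \<le> N"
  shows "b_im C b (N - i) n \<subseteq> b_ker C b i n"
proof
  fix x assume x: "x \<in> b_im C b (N - i) n"
  then obtain y where y: "y \<in> carrier (C (n + int (N - i)))" "x = b_power b (N - i) (n + int (N - i)) y"
    by (auto simp: b_im_def)
  have "b_power b i n x = b_power b (i + (N - i)) (n + int (N - i)) y"
    unfolding y(2) b_power_add by simp
  also have "\<dots> = \<zero>\<^bsub>C (n - int i)\<^esub>"
    using b_nilpotent[OF y(1)] assms by (simp add: of_nat_diff)
  finally show "x \<in> b_ker C b i n"
    using submodule_subset[OF submodule_b_im] x by (auto simp: b_ker_def)
qed

lemma homology_part_submodules:
  assumes "i \<in> {1..N - 1}"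
  shows "module \<C> ((C n)\<lparr>carrier := b_ker C b i n\<rparr>)"
    and "submodule (b_im C b (N - i) n) \<C> ((C n)\<lparr>carrier := b_ker C b i n\<rparr>)"
proof -
  have "i \<le> N" using assms by auto
  then show "module \<C> ((C n)\<lparr>carrier := b_ker C b i n\<rparr>)"
    "submodule (b_im C b (N - i) n) \<C> ((C n)\<lparr>carrier := b_ker C b i n\<rparr>)"
    by (intro submodule.submodule_is_module submodule_restrict submodule_b_ker submodule_b_im module_C
        b_im_subset_b_ker)+
qed

lemma module_homology_part: "i \<in> {1..N - 1} \<Longrightarrow> module \<C> (homology_part N C b n i)"
  unfolding homology_part_def by (intro module_quot_mod homology_part_submodules)

lemma module_homology: "module \<C> (homology N C b n)"
  unfolding homology_def by (intro module_direct_sum ballI module_homology_part)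

lemma coset_lin:
  "i \<in> {1..N - 1} \<Longrightarrow> (\<lambda>x. b_im C b (N - i) n +>\<^bsub>C n\<^esub> x)
    \<in> lin_maps ((C n)\<lparr>carrier := b_ker C b i n\<rparr>) (homology_part N C b n i)"
  using quot_proj_lin[OF homology_part_submodules] unfolding homology_part_def coset_carrier_update .

text \<open>The families of elements \<open>x\<^sub>i \<in> Ker b\<^sup>i\<close>, \<open>1 \<le> i < N\<close>, which represent the elements of the
  homology object.\<close>

abbreviation cycles :: "int \<Rightarrow> (nat \<Rightarrow> 'v) set"
  where "cycles n \<equiv> \<Pi> i\<in>{1..N - 1}. b_ker C b i n"

lemma cycles_add: "x \<in> cycles n \<Longrightarrow> y \<in> cycles n \<Longrightarrow> (\<lambda>i. x i \<oplus>\<^bsub>C n\<^esub> y i) \<in> cycles n"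
  using additive_subgroup.a_closed[OF submodule_additive_subgroup[OF submodule_b_ker]] by (simp add: Pi_iff)

lemma cycles_smult: "x \<in> cycles n \<Longrightarrow> (\<lambda>i. c \<odot>\<^bsub>C n\<^esub> x i) \<in> cycles n"
  using submodule_smult[OF submodule_b_ker] by (simp add: Pi_iff)

lemma cycles_carrier: "x \<in> cycles n \<Longrightarrow> i \<in> {1..N - 1} \<Longrightarrow> x i \<in> carrier (C n)"
  using subsetD[OF submodule_subset[OF submodule_b_ker, of i n]] Pi_mem by fast

lemma homology_class_closed:
  assumes "x \<in> cycles n"
  shows "homology_class N C b n x \<in> carrier (homology N C b n)"
  unfolding homology_def
  using assms lin_closed[OF coset_lin]
  by (auto simp: direct_sum_simps homology_class_def Pi_iff)

lemma homology_cases: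
  assumes u: "u \<in> carrier (homology N C b n)"
  obtains x where "x \<in> cycles n" "u = homology_class N C b n x"
proof -
  have ui: "u \<in> (\<Pi>\<^sub>E i\<in>{1..N - 1}. carrier (homology_part N C b n i))"
    using u unfolding homology_def by (simp add: direct_sum_simps)
  have "\<exists>x. x \<in> b_ker C b i n \<and> u i = b_im C b (N - i) n +>\<^bsub>C n\<^esub> x" if "i \<in> {1..N - 1}" for i
  proof -
    have "u i \<in> carrier (homology_part N C b n i)" using ui that by auto
    then show ?thesis
      by (auto simp: homology_part_def quot_mod_simps coset_carrier_update)
  qed
  then obtain x where x: "\<And>i. i \<in> {1..N - 1} \<Longrightarrow> x i \<in> b_ker C b i n \<and> u i = b_im C b (N - i) n +>\<^bsub>C n\<^esub> x i"
    by metis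
  have "u = homology_class N C b n x"
    using ui x unfolding homology_class_def by (intro ext) (auto simp: PiE_iff extensional_def)
  moreover have "x \<in> cycles n" using x by (simp add: Pi_iff)
  ultimately show ?thesis using that by blast
qed

lemma homology_class_add:
  assumes "x \<in> cycles n" "y \<in> cycles n"
  shows "homology_class N C b n x \<oplus>\<^bsub>homology N C b n\<^esub> homology_class N C b n y =
    homology_class N C b n (\<lambda>i. x i \<oplus>\<^bsub>C n\<^esub> y i)"
  unfolding homology_def
  using lin_add[OF coset_lin] assms
  by (auto simp: direct_sum_simps homology_class_def Pi_iff intro!: restrict_ext)

lemma homology_class_smult:
  assumes "x \<in> cycles n"
  shows "c \<odot>\<^bsub>homology N C b n\<^esub> homology_class N C b n x =
    homology_class N C b n (\<lambda>i. c \<odot>\<^bsub>C n\<^esub> x i)"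
  unfolding homology_def
  using lin_smult[OF coset_lin] assms
  by (auto simp: direct_sum_simps homology_class_def Pi_iff intro!: restrict_ext)

text \<open>An endomorphism of the complex, as a family of linear maps commuting with \<open>b\<close>.\<close>

definition chain_endos :: "(int \<Rightarrow> 'v \<Rightarrow> 'v) set"
  where "chain_endos = {f. \<forall>n. f n \<in> lin_maps (C n) (C n) \<and>
    (\<forall>x\<in>carrier (C n). f (n - 1) (b n x) = b n (f n x))}"

context
  fixes f assumes f: "f \<in> chain_endos"
begin

lemma chain_endo_lin: "f n \<in> lin_maps (C n) (C n)"
  using f by (simp add: chain_endos_def)

lemma chain_endo_b_power:
  "x \<in> carrier (C n) \<Longrightarrow> b_power b k n (f n x) = f (n - int k) (b_power b k n x)"
proof (induction k arbitrary: n x)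
  case (Suc k)
  have "f (n - 1) (b n x) = b n (f n x)" using f Suc.prems by (simp add: chain_endos_def)
  moreover have "n - 1 - int k = n - int (Suc k)" by simp
  ultimately show ?case
    using Suc.IH[OF lin_closed[OF b_lin Suc.prems]] by (simp only: b_power.simps)
qed simp

lemma chain_endo_b_ker: "f n ` b_ker C b i n \<subseteq> b_ker C b i n"
  using chain_endo_b_power lin_zero[OF module_C module_C chain_endo_lin] lin_closed[OF chain_endo_lin]
  by (auto simp: b_ker_def)

lemma chain_endo_b_im: "f n ` b_im C b k n \<subseteq> b_im C b k n"
proof -
  have "f n (b_power b k (n + int k) y) \<in> b_im C b k n" if "y \<in> carrier (C (n + int k))" for y
    using chain_endo_b_power[OF that, of k] lin_closed[OF chain_endo_lin that]
    unfolding b_im_def by (metis add_diff_cancel_right' imageI)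
  then show ?thesis by (auto simp: b_im_def)
qed

lemma homology_map_class:
  assumes x: "x \<in> cycles n"
  shows "homology_map N C b n (f n) (homology_class N C b n x) = homology_class N C b n (\<lambda>i. f n (x i))"
proof
  fix i
  show "homology_map N C b n (f n) (homology_class N C b n x) i = homology_class N C b n (\<lambda>i. f n (x i)) i"
  proof (cases "i \<in> {1..N - 1}")
    case True
    let ?W = "b_im C b (N - i) n" and ?M = "(C n)\<lparr>carrier := b_ker C b i n\<rparr>"
    note W = homology_part_submodules[OF True]
    have "f n \<in> lin_maps ?M ?M"
      using chain_endo_lin[of n] chain_endo_b_ker submodule_subset[OF submodule_b_ker]
      by (auto simp: lin_maps_def subset_iff)
    then have l: "(\<lambda>x. ?W +>\<^bsub>C n\<^esub> f n x) \<in> lin_maps ?M (homology_part N C b n i)"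
      by (rule lin_comp[OF _ coset_lin[OF True]])
    have z: "?W +>\<^bsub>C n\<^esub> f n w = \<zero>\<^bsub>homology_part N C b n i\<^esub>" if "w \<in> ?W" for w
    proof -
      have w: "f n w \<in> ?W" using chain_endo_b_im that by blast
      then have "f n w \<in> carrier (C n)" using submodule_subset[OF submodule_b_im] by blast
      then have "?W +>\<^bsub>C n\<^esub> f n w = ?W"
        using coset_eq_zero_iff[OF module_C submodule_b_im] w by blast
      then show ?thesis by (simp add: homology_part_def quot_mod_simps)
    qed
    have "(\<lambda>x. ?W +>\<^bsub>C n\<^esub> f n x) ` (?W +>\<^bsub>C n\<^esub> x i) = {?W +>\<^bsub>C n\<^esub> f n (x i)}"
      using image_coset[OF W module_homology_part[OF True] l z, of "x i"] x True
      unfolding coset_carrier_update by (auto simp: Pi_iff)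
    then show ?thesis
      using True homology_class_closed[OF x] by (simp add: homology_map_def homology_class_def)
  next
    case False
    then show ?thesis
      using homology_class_closed[OF x]
      by (auto simp: homology_map_def homology_class_def[of N C b n "\<lambda>i. f n (x i)"])
  qed
qed

lemma homology_map_lin:
  "homology_map N C b n (f n) \<in> lin_maps (homology N C b n) (homology N C b n)"
proof (rule lin_mapsI)
  have ker: "(\<lambda>i. f n (x i)) \<in> cycles n" if "x \<in> cycles n" for x
    using that chain_endo_b_ker by (fastforce simp: Pi_iff)
  show "homology_map N C b n (f n) u \<in> carrier (homology N C b n)"
    if "u \<in> carrier (homology N C b n)" for u
    using that
  proof (cases rule: homology_cases)
    case (1 x)
    show ?thesis
      unfolding 1(2) homology_map_class[OF 1(1)] by (rule homology_class_closed[OF ker[OF 1(1)]])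
  qed
  show "homology_map N C b n (f n) (u \<oplus>\<^bsub>homology N C b n\<^esub> v) =
    homology_map N C b n (f n) u \<oplus>\<^bsub>homology N C b n\<^esub> homology_map N C b n (f n) v"
    if "u \<in> carrier (homology N C b n)" "v \<in> carrier (homology N C b n)" for u v
    using that(1)
  proof (cases rule: homology_cases)
    case x: (1 x)
    show ?thesis
      using that(2)
    proof (cases rule: homology_cases)
      case y: (1 y)
      have "homology_class N C b n (\<lambda>i. f n (x i \<oplus>\<^bsub>C n\<^esub> y i)) =
          homology_class N C b n (\<lambda>i. f n (x i) \<oplus>\<^bsub>C n\<^esub> f n (y i))"
        using cycles_carrier[OF x(1)] cycles_carrier[OF y(1)] lin_add[OF chain_endo_lin]
        by (auto simp: homology_class_def intro!: restrict_ext)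
      then show ?thesis
        unfolding x(2) y(2) homology_class_add[OF x(1) y(1)] homology_map_class[OF x(1)]
          homology_map_class[OF y(1)] homology_map_class[OF cycles_add[OF x(1) y(1)]]
          homology_class_add[OF ker[OF x(1)] ker[OF y(1)]] .
    qed
  qed
  show "homology_map N C b n (f n) (c \<odot>\<^bsub>homology N C b n\<^esub> u) =
    c \<odot>\<^bsub>homology N C b n\<^esub> homology_map N C b n (f n) u"
    if "u \<in> carrier (homology N C b n)" for c u
    using that
  proof (cases rule: homology_cases)
    case x: (1 x)
    have "homology_class N C b n (\<lambda>i. f n (c \<odot>\<^bsub>C n\<^esub> x i)) =
        homology_class N C b n (\<lambda>i. c \<odot>\<^bsub>C n\<^esub> f n (x i))"
      using cycles_carrier[OF x(1)] lin_smult[OF chain_endo_lin]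
      by (auto simp: homology_class_def intro!: restrict_ext)
    then show ?thesis
      unfolding x(2) homology_class_smult[OF x(1)] homology_map_class[OF x(1)]
        homology_map_class[OF cycles_smult[OF x(1)]] homology_class_smult[OF ker[OF x(1)]] .
  qed
qed

end

end

section \<open>The \<open>q\<close>-differential\<close>

lemma (in abelian_group) minus_zero_right: "x \<in> carrier G \<Longrightarrow> x \<ominus> \<zero> = x"
  by (simp add: a_minus_def)

lemma (in abelian_group) minus_minus_eq:
  assumes "x \<in> carrier G" "y \<in> carrier G" "z \<in> carrier G"
  shows "x \<ominus> y \<ominus> z = x \<ominus> (y \<oplus> z)"
  using assms by (simp add: a_minus_def a_assoc minus_add)

text \<open>If \<open>B = X + Y\<close> and \<open>Y X = q B Y\<close>, then \<open>X\<^sup>m = B\<^sup>m - [m]\<^sub>q B\<^bsup>m-1\<^esup> Y\<close> with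
  \<open>[m]\<^sub>q = 1 + q + \<dots> + q\<^bsup>m-1\<^esup>\<close>.\<close>

lemma b_power_q_commuting:
  fixes C :: "int \<Rightarrow> (complex, 'v) module" and Bf Xf Yf :: "int \<Rightarrow> 'v \<Rightarrow> 'v"
  assumes C: "\<And>n. module \<C> (C n)"
    and lin: "\<And>n. Bf n \<in> lin_maps (C n) (C (n - 1))" "\<And>n. Xf n \<in> lin_maps (C n) (C (n - 1))"
      "\<And>n. Yf n \<in> lin_maps (C n) (C (n - 1))"
    and sum: "\<And>n x. x \<in> carrier (C n) \<Longrightarrow> Bf n x = Xf n x \<oplus>\<^bsub>C (n - 1)\<^esub> Yf n x"
    and comm: "\<And>n x. x \<in> carrier (C n) \<Longrightarrow>
      Yf (n - 1) (Xf n x) = q \<odot>\<^bsub>C (n - 1 - 1)\<^esub> Bf (n - 1) (Yf n x)"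
    and x: "x \<in> carrier (C n)"
  shows "b_power Xf (Suc m) n x = b_power Bf (Suc m) n x \<ominus>\<^bsub>C (n - int (Suc m))\<^esub>
    (\<Sum>i<Suc m. q ^ i) \<odot>\<^bsub>C (n - int (Suc m))\<^esub> b_power Bf m (n - 1) (Yf n x)"
  using x
proof (induction m arbitrary: n x)
  case 0
  interpret M: module \<C> "C (n - 1)" by (rule C)
  have "Xf n x \<in> carrier (C (n - 1))" "Yf n x \<in> carrier (C (n - 1))"
    using 0 lin by (auto intro: lin_closed)
  then show ?case
    using sum[OF 0] M.smult_one[of "Yf n x"] by (simp add: a_minus_def M.a_assoc M.r_neg)
next
  case (Suc m)
  let ?M = "C (n - int (Suc (Suc m)))" and ?k = "\<Sum>i<Suc m. q ^ i"
  interpret M: module \<C> ?M by (rule C)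
  have idx: "n - 1 - int (Suc m) = n - int (Suc (Suc m))" "n - 1 - 1 - int m = n - int (Suc (Suc m))" by auto
  have cl: "Xf n x \<in> carrier (C (n - 1))" "Yf n x \<in> carrier (C (n - 1))" "Bf n x \<in> carrier (C (n - 1))"
    using Suc.prems lin by (auto intro: lin_closed)
  have P: "b_power Bf (Suc m) (n - 1) \<in> lin_maps (C (n - 1)) ?M"
    using b_power_lin[where C = C and b = Bf, OF lin(1), of "Suc m" "n - 1"] unfolding idx .
  have Q: "b_power Bf m (n - 1 - 1) \<in> lin_maps (C (n - 1 - 1)) ?M"
    using b_power_lin[where C = C and b = Bf, OF lin(1), of m "n - 1 - 1"] unfolding idx .
  define u where "u = b_power Bf (Suc m) (n - 1) (Yf n x)"
  have u: "u \<in> carrier ?M" unfolding u_def by (rule lin_closed[OF P cl(2)])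
  have Bx: "b_power Bf (Suc (Suc m)) n x \<in> carrier ?M"
    using lin_closed[OF P cl(3)] by simp
  have X_eq: "Xf n x = Bf n x \<ominus>\<^bsub>C (n - 1)\<^esub> Yf n x"
  proof -
    interpret M1: module \<C> "C (n - 1)" by (rule C)
    show ?thesis using cl sum[OF Suc.prems] by (simp add: a_minus_def M1.a_assoc M1.r_neg)
  qed
  have "b_power Xf (Suc (Suc m)) n x = b_power Bf (Suc m) (n - 1) (Xf n x) \<ominus>\<^bsub>?M\<^esub>
      ?k \<odot>\<^bsub>?M\<^esub> b_power Bf m (n - 1 - 1) (Yf (n - 1) (Xf n x))"
    using Suc.IH[OF cl(1)] unfolding idx by simp
  also have "b_power Bf (Suc m) (n - 1) (Xf n x) = b_power Bf (Suc (Suc m)) n x \<ominus>\<^bsub>?M\<^esub> u"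
    unfolding X_eq lin_minus[OF C C P cl(3,2)] u_def by simp
  also have "b_power Bf m (n - 1 - 1) (Yf (n - 1) (Xf n x)) = q \<odot>\<^bsub>?M\<^esub> u"
    unfolding comm[OF Suc.prems] lin_smult[OF Q lin_closed[OF lin(1) cl(2)]] u_def by simp
  also have "?k \<odot>\<^bsub>?M\<^esub> (q \<odot>\<^bsub>?M\<^esub> u) = (?k * q) \<odot>\<^bsub>?M\<^esub> u"
    using M.smult_assoc1[of ?k q u] u by simp
  also have "b_power Bf (Suc (Suc m)) n x \<ominus>\<^bsub>?M\<^esub> u \<ominus>\<^bsub>?M\<^esub> (?k * q) \<odot>\<^bsub>?M\<^esub> u =
      b_power Bf (Suc (Suc m)) n x \<ominus>\<^bsub>?M\<^esub> (u \<oplus>\<^bsub>?M\<^esub> (?k * q) \<odot>\<^bsub>?M\<^esub> u)"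
    using u Bx M.smult_closed[of "?k * q" u] by (intro M.minus_minus_eq) simp_all
  also have "u \<oplus>\<^bsub>?M\<^esub> (?k * q) \<odot>\<^bsub>?M\<^esub> u = (1 + ?k * q) \<odot>\<^bsub>?M\<^esub> u"
    using u M.smult_l_distr[of 1 "?k * q" u] M.smult_one[OF u] by simp
  also have "1 + ?k * q = (\<Sum>i<Suc (Suc m). q ^ i)"
    by (subst sum.lessThan_Suc_shift[of _ "Suc m"]) (simp add: sum_distrib_left algebra_simps)
  finally show ?case unfolding u_def .
qed

lemma q_number_eq_zero:
  fixes q :: complex
  assumes "N \<ge> 2" "q ^ N = 1" "q \<noteq> 1"
  shows "(\<Sum>i<N. q ^ i) = 0"
  using geometric_sum[OF assms(3), of N] assms(2) by simp

text \<open>A presimplicial vector space, with faces \<open>d n i : C\<^sub>n \<rightarrow> C\<^bsub>n-1\<^esub>\<close> that vanish outside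
  \<open>0 \<le> i \<le> n\<close>, \<open>n \<ge> 1\<close>. If \<open>q\<^sup>N = 1\<close> and \<open>q \<noteq> 1\<close>, then the partial sums
  \<open>B\<^sub>j = \<Sum>\<^bsub>i\<ge>j\<^esub> q\<^sup>i d\<^sub>i\<close> satisfy \<open>B\<^sub>j\<^sup>N = B\<^bsub>j+1\<^esub>\<^sup>N\<close>.\<close>

locale presimplicial =
  fixes C :: "int \<Rightarrow> (complex, 'v) module" and d :: "int \<Rightarrow> nat \<Rightarrow> 'v \<Rightarrow> 'v"
  assumes module_C: "module \<C> (C n)"
    and d_lin: "d n i \<in> lin_maps (C n) (C (n - 1))"
    and d_zero: "n \<le> 0 \<or> int i > n \<Longrightarrow> x \<in> carrier (C n) \<Longrightarrow> d n i x = \<zero>\<^bsub>C (n - 1)\<^esub>"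
    and d_comm: "i < k \<Longrightarrow> x \<in> carrier (C n) \<Longrightarrow> d (n - 1) i (d n k x) = d (n - 1) (k - 1) (d n i x)"
begin

text \<open>The sum \<open>B\<^sub>j\<close> above in degree \<open>n\<close>. For \<open>n \<le> 0\<close> the range \<open>{j..nat n}\<close> need not be empty, but its
  terms vanish.\<close>

definition partial_sum :: "complex \<Rightarrow> nat \<Rightarrow> int \<Rightarrow> 'v \<Rightarrow> 'v"
  where "partial_sum q j n x = (\<Oplus>\<^bsub>C (n - 1)\<^esub>i\<in>{j..nat n}. q ^ i \<odot>\<^bsub>C (n - 1)\<^esub> d n i x)"

lemma partial_sum_lin: "partial_sum q j n \<in> lin_maps (C n) (C (n - 1))"
proof -
  have "(\<lambda>x. \<Oplus>\<^bsub>C (n - 1)\<^esub>i\<in>{j..nat n}. q ^ i \<odot>\<^bsub>C (n - 1)\<^esub> d n i x) \<in> lin_maps (C n) (C (n - 1))"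
    by (rule lin_finsum_maps[OF module_C module_C lin_scale[OF module_C d_lin]])
  then show ?thesis by (simp add: partial_sum_def[abs_def])
qed

lemma scaled_face_closed: "x \<in> carrier (C n) \<Longrightarrow> c \<odot>\<^bsub>C (n - 1)\<^esub> d n i x \<in> carrier (C (n - 1))"
  by (rule lin_closed[OF lin_scale[OF module_C d_lin]])

lemma partial_sum_split:
  assumes x: "x \<in> carrier (C n)"
  shows "partial_sum q j n x = partial_sum q (Suc j) n x \<oplus>\<^bsub>C (n - 1)\<^esub> q ^ j \<odot>\<^bsub>C (n - 1)\<^esub> d n j x"
proof -
  interpret M: module \<C> "C (n - 1)" by (rule module_C)
  note cl = scaled_face_closed[OF x]
  show ?thesis
  proof (cases "j \<le> nat n")
    case True
    have "{j..nat n} = insert j {Suc j..nat n}" using True by auto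
    then have "partial_sum q j n x = q ^ j \<odot>\<^bsub>C (n - 1)\<^esub> d n j x \<oplus>\<^bsub>C (n - 1)\<^esub> partial_sum q (Suc j) n x"
      unfolding partial_sum_def by (simp only:) (rule M.finsum_insert, auto simp: cl)
    also have "\<dots> = partial_sum q (Suc j) n x \<oplus>\<^bsub>C (n - 1)\<^esub> q ^ j \<odot>\<^bsub>C (n - 1)\<^esub> d n j x"
      by (rule M.a_comm[OF cl lin_closed[OF partial_sum_lin x]])
    finally show ?thesis .
  next
    case False
    then have "d n j x = \<zero>\<^bsub>C (n - 1)\<^esub>" using x by (intro d_zero) auto
    moreover have "{j..nat n} = {}" "{Suc j..nat n} = {}" using False by auto
    ultimately show ?thesis using M.smult_r_null[of "q ^ j"] by (simp add: partial_sum_def)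
  qed
qed

text \<open>The relation \<open>Y B\<^bsub>j+1\<^esub> = q B\<^sub>j Y\<close> for \<open>Y = q\<^sup>j d\<^sub>j\<close>, from \<open>d\<^sub>j d\<^sub>k = d\<^bsub>k-1\<^esub> d\<^sub>j\<close> for \<open>k > j\<close>; the
  factor \<open>q\<close> comes from the index shift.\<close>

lemma face_partial_sum:
  assumes x: "x \<in> carrier (C n)"
  shows "q ^ j \<odot>\<^bsub>C (n - 1 - 1)\<^esub> d (n - 1) j (partial_sum q (Suc j) n x) =
    q \<odot>\<^bsub>C (n - 1 - 1)\<^esub> partial_sum q j (n - 1) (q ^ j \<odot>\<^bsub>C (n - 1)\<^esub> d n j x)"
proof -
  define m where "m = n - 1"
  define M where "M = C (m - 1)"
  have module_M: "module \<C> M" unfolding M_def by (rule module_C)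
  interpret M: module \<C> M by (rule module_M)
  have dm_lin: "d m i \<in> lin_maps (C m) M" for i unfolding M_def by (rule d_lin)
  have dx: "d n i x \<in> carrier (C m)" for i
    using lin_closed[OF d_lin x] by (simp add: m_def)
  have qx: "c \<odot>\<^bsub>C m\<^esub> d n i x \<in> carrier (C m)" for c i
    using scaled_face_closed[OF x] by (simp add: m_def)
  have scale: "a \<odot>\<^bsub>M\<^esub> (c \<odot>\<^bsub>M\<^esub> y) = (a * c) \<odot>\<^bsub>M\<^esub> y" if "y \<in> carrier M" for a c y
    using M.smult_assoc1[of a c y] that by simp
  define F where "F i = (q ^ j * q ^ Suc i) \<odot>\<^bsub>M\<^esub> d m i (d n j x)" for i
  have F: "F i \<in> carrier M" for i
    unfolding F_def by (rule lin_closed[OF lin_scale[OF module_M dm_lin] dx])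
  have "q ^ j \<odot>\<^bsub>M\<^esub> d m j (partial_sum q (Suc j) n x) =
      (\<Oplus>\<^bsub>M\<^esub>k\<in>{Suc j..nat n}. q ^ j \<odot>\<^bsub>M\<^esub> d m j (q ^ k \<odot>\<^bsub>C m\<^esub> d n k x))"
    unfolding partial_sum_def m_def[symmetric]
    by (rule lin_finsum[OF module_C module_M lin_scale[OF module_M dm_lin]]) (simp add: qx)
  also have "\<dots> = (\<Oplus>\<^bsub>M\<^esub>k\<in>{Suc j..nat n}. F (k - 1))"
  proof (rule M.finsum_cong'[OF refl])
    fix k assume "k \<in> {Suc j..nat n}"
    then have k: "j < k" "Suc (k - 1) = k" by auto
    show "q ^ j \<odot>\<^bsub>M\<^esub> d m j (q ^ k \<odot>\<^bsub>C m\<^esub> d n k x) = F (k - 1)"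
      unfolding F_def lin_smult[OF dm_lin dx] d_comm[OF k(1) x, folded m_def] k(2)
      by (rule scale[OF lin_closed[OF dm_lin dx]])
  qed (simp add: F)
  also have "\<dots> = (\<Oplus>\<^bsub>M\<^esub>i\<in>{j..nat m}. F i)"
  proof (cases "n \<le> 0")
    case True
    then have "d n j x = \<zero>\<^bsub>C m\<^esub>" using x unfolding m_def by (intro d_zero) auto
    then have "F i = \<zero>\<^bsub>M\<^esub>" for i
      using lin_zero[OF module_C module_M lin_scale[OF module_M dm_lin]] by (simp add: F_def)
    then show ?thesis by simp
  next
    case False
    then have "{Suc j..nat n} = Suc ` {j..nat m}"
      by (simp add: image_Suc_atLeastAtMost nat_diff_distrib' m_def)
    then show ?thesis
      by (simp only:) (subst M.finsum_reindex, auto simp: F)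
  qed
  also have "\<dots> = (\<Oplus>\<^bsub>M\<^esub>i\<in>{j..nat m}. q \<odot>\<^bsub>M\<^esub> (q ^ i \<odot>\<^bsub>M\<^esub> d m i (q ^ j \<odot>\<^bsub>C m\<^esub> d n j x)))"
  proof (rule M.finsum_cong'[OF refl])
    fix i
    show "F i = q \<odot>\<^bsub>M\<^esub> (q ^ i \<odot>\<^bsub>M\<^esub> d m i (q ^ j \<odot>\<^bsub>C m\<^esub> d n j x))"
      unfolding F_def lin_smult[OF dm_lin dx]
      by (simp add: scale lin_closed[OF dm_lin dx] M.smult_closed mult_ac)
  qed (auto intro!: M.smult_closed lin_closed[OF dm_lin qx])
  also have "\<dots> = q \<odot>\<^bsub>M\<^esub> partial_sum q j m (q ^ j \<odot>\<^bsub>C m\<^esub> d n j x)"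
    unfolding partial_sum_def M_def[symmetric]
    by (rule M.finsum_smult_ldistr[symmetric]) (auto intro!: M.smult_closed lin_closed[OF dm_lin qx])
  finally show ?thesis unfolding M_def m_def .
qed

lemma partial_sum_power:
  assumes N: "N \<ge> 2" and q: "q ^ N = 1" "q \<noteq> 1" and x: "x \<in> carrier (C n)"
  shows "b_power (partial_sum q 0) N n x = \<zero>\<^bsub>C (n - int N)\<^esub>"
proof -
  obtain m where m: "N = Suc m" using N by (cases N) auto
  have step: "b_power (partial_sum q (Suc j)) N n x = b_power (partial_sum q j) N n x" for j
  proof -
    interpret M: module \<C> "C (n - int (Suc m))" by (rule module_C)
    have cl: "b_power (partial_sum q j) m (n - 1) (q ^ j \<odot>\<^bsub>C (n - 1)\<^esub> d n j x) \<in> carrier (C (n - int (Suc m)))"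
      "b_power (partial_sum q j) (Suc m) n x \<in> carrier (C (n - int (Suc m)))"
      using lin_closed[OF b_power_lin[where C = C and b = "partial_sum q j" and k = m, OF partial_sum_lin]
            scaled_face_closed[OF x]]
        lin_closed[OF b_power_lin[where C = C and b = "partial_sum q j" and k = "Suc m", OF partial_sum_lin] x]
      by (simp_all add: algebra_simps)
    have eq: "b_power (partial_sum q (Suc j)) (Suc m) n x = b_power (partial_sum q j) (Suc m) n x
        \<ominus>\<^bsub>C (n - int (Suc m))\<^esub> (\<Sum>i<Suc m. q ^ i) \<odot>\<^bsub>C (n - int (Suc m))\<^esub>
          b_power (partial_sum q j) m (n - 1) (q ^ j \<odot>\<^bsub>C (n - 1)\<^esub> d n j x)"
      by (rule b_power_q_commuting[where C = C and Yf = "\<lambda>n x. q ^ j \<odot>\<^bsub>C (n - 1)\<^esub> d n j x" and q = q,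
            OF module_C partial_sum_lin partial_sum_lin lin_scale[OF module_C d_lin] partial_sum_split
            face_partial_sum x])
    have "(\<Sum>i<Suc m. q ^ i) = 0" using q_number_eq_zero[OF N q] by (simp only: m)
    with eq show ?thesis
      unfolding m by (simp only: M.smult_l_null[OF cl(1), unfolded complex_ring_simps] M.minus_zero_right[OF cl(2)])
  qed
  have "b_power (partial_sum q 0) N n x = b_power (partial_sum q j) N n x" for j
    by (induction j) (simp_all add: step)
  \<comment> \<open>for \<open>j > n\<close> the sum \<open>B\<^sub>j\<close> is empty in degree \<open>n\<close>\<close>
  also have "b_power (partial_sum q (Suc (nat n))) N n x =
      b_power (partial_sum q (Suc (nat n))) m (n - 1) \<zero>\<^bsub>C (n - 1)\<^esub>"
  proof -
    interpret M: module \<C> "C (n - 1)" by (rule module_C)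
    show ?thesis unfolding m by (simp add: partial_sum_def)
  qed
  also have "\<dots> = \<zero>\<^bsub>C (n - 1 - int m)\<^esub>"
    by (rule lin_zero[OF module_C module_C
        b_power_lin[where C = C and b = "partial_sum q (Suc (nat n))", OF partial_sum_lin]])
  finally show ?thesis by (simp add: m algebra_simps)
qed

end

section \<open>The complex of a pointed simplicial finite set\<close>

lemma coface_simplex_map:
  assumes "n \<ge> 1"
  shows "coface n i \<in> simplex_maps (n - 1) n"
  using assms by (auto simp: coface_def simplex_maps_def mono_on_def)

lemma coface_comp:
  assumes "i < k" "n \<ge> 2"
  shows "compose {..n - 1 - 1} (coface n k) (coface (n - 1) i) =
    compose {..n - 1 - 1} (coface n i) (coface (n - 1) (k - 1))"
  using assms by (auto simp: compose_def coface_def fun_eq_iff)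

context
  fixes A :: "(complex, 'a, 'm) module_scheme" and Y :: "'s simplicial_pset"
  assumes alg: "algebra \<C> A" and Y: "pointed_simplicial_finite_set Y"
begin

interpretation Y: pointed_simplicial_finite_set Y by (rule Y)

lemma sarr_face: "n \<ge> 1 \<Longrightarrow> sarr Y (n - 1) n (coface n i) \<in> pointed_maps (sobj Y n) (sobj Y (n - 1))"
  by (intro Y.sarr coface_simplex_map)

lemma loday_face_lin:
  "n \<ge> 1 \<Longrightarrow> loday_face A Y n i \<in> lin_maps (loday A (sobj Y n)) (loday A (sobj Y (n - 1)))"
  unfolding loday_face_def by (rule loday_map_lin_in(1)[OF alg sarr_face])

lemma loday_face_comm:
  assumes "i < k" "n \<ge> 2" "x \<in> carrier (loday A (sobj Y n))"
  shows "loday_face A Y (n - 1) i (loday_face A Y n k x) = loday_face A Y (n - 1) (k - 1) (loday_face A Y n i x)"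
proof -
  have n: "n \<ge> 1" "n - 1 \<ge> 1" using assms(2) by auto
  have "loday_face A Y (n - 1) i (loday_face A Y n k x) =
      loday_map A (sobj Y n) (sobj Y (n - 1 - 1))
        (sarr Y (n - 1 - 1) n (compose {..n - 1 - 1} (coface n k) (coface (n - 1) i))) x" for i k
    unfolding loday_face_def
    using loday_map_comp[OF alg Y.sobj sarr_face[OF n(1)] sarr_face[OF n(2)] assms(3)]
      Y.sarr_comp[OF coface_simplex_map[OF n(2)] coface_simplex_map[OF n(1)]] by simp
  then show ?thesis using coface_comp[OF assms(1,2)] by simp
qed

lemma module_loday_complex: "module \<C> (loday_complex A Y n)"
proof (cases "n < 0")
  case True
  interpret M: module \<C> "loday A (sobj Y 0)" by (rule module_loday[OF alg])
  have "submodule {\<zero>\<^bsub>loday A (sobj Y 0)\<^esub>} \<C> (loday A (sobj Y 0))"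
    using M.smult_r_null by (intro submoduleI_complex M.module_axioms) auto
  then show ?thesis
    using True submodule.submodule_is_module[OF _ M.module_axioms] by (simp add: loday_complex_def)
qed (simp add: loday_complex_def module_loday[OF alg])

text \<open>The face maps, set to zero outside the range \<open>0 \<le> i \<le> n\<close>, \<open>n \<ge> 1\<close>, so that the simplicial
  identities hold in all integer degrees.\<close>

definition complex_face :: "int \<Rightarrow> nat \<Rightarrow> ('s, 'a) loday \<Rightarrow> ('s, 'a) loday"
  where "complex_face n i x = (if n \<le> 0 \<or> int i > n then \<zero>\<^bsub>loday_complex A Y (n - 1)\<^esub>
    else loday_face A Y (nat n) i x)"

lemma complex_face_lin: "complex_face n i \<in> lin_maps (loday_complex A Y n) (loday_complex A Y (n - 1))"
proof (cases "n \<le> 0 \<or> int i > n")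
  case True
  then show ?thesis
    using lin_const_zero[OF module_loday_complex] by (simp add: complex_face_def[abs_def])
next
  case False
  then have "nat n \<ge> 1" "nat n - 1 = nat (n - 1)" by auto
  then show ?thesis
    using False loday_face_lin[of "nat n" i] by (simp add: complex_face_def[abs_def] loday_complex_def)
qed

lemma presimplicial_loday: "presimplicial (loday_complex A Y) complex_face"
proof (rule presimplicial.intro)
  fix n :: int and i k :: nat and x assume ik: "i < k" and x: "x \<in> carrier (loday_complex A Y n)"
  note z = lin_zero[OF module_loday_complex module_loday_complex complex_face_lin]
  consider "n \<le> 0 \<or> n < int k" | "n = 1" | "n \<ge> 2" "int k \<le> n" by linarith
  then show "complex_face (n - 1) i (complex_face n k x) = complex_face (n - 1) (k - 1) (complex_face n i x)"
  proof cases
    case 1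
    then show ?thesis
    proof
      assume "n < int k"
      then have "n - 1 < int (k - 1)" using ik by auto
      moreover have "complex_face n k x = \<zero>\<^bsub>loday_complex A Y (n - 1)\<^esub>"
        using \<open>n < int k\<close> by (simp add: complex_face_def)
      ultimately show ?thesis by (simp add: z) (simp add: complex_face_def)
    qed (simp add: complex_face_def)
  next
    case 2
    then show ?thesis by (simp add: complex_face_def)
  next
    case 3
    then have "nat (n - 1) = nat n - 1" "int (k - 1) \<le> n - 1" "int i \<le> n - 1" "nat n \<ge> 2" using ik by auto
    then show ?thesis
      using 3 ik x loday_face_comm[of i k "nat n" x] by (simp add: complex_face_def loday_complex_def)
  qed
qed (auto simp: module_loday_complex complex_face_lin complex_face_def)

interpretation P: presimplicial "loday_complex A Y" complex_face
  by (rule presimplicial_loday)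

lemma q_differential_eq:
  assumes x: "x \<in> carrier (loday_complex A Y n)"
  shows "q_differential A Y q n x = P.partial_sum q 0 n x"
proof -
  interpret M: module \<C> "loday_complex A Y (n - 1)" by (rule module_loday_complex)
  show ?thesis
  proof (cases "n \<le> 0")
    case True
    then show ?thesis
      using M.smult_r_null by (simp add: q_differential_def P.partial_sum_def complex_face_def)
  next
    case False
    have "(\<Oplus>\<^bsub>loday_complex A Y (n - 1)\<^esub>i\<in>{..nat n}.
       (q ^ i) \<odot>\<^bsub>loday_complex A Y (n - 1)\<^esub> loday_face A Y (nat n) i x) = P.partial_sum q 0 n x"
      unfolding P.partial_sum_def
      using False P.scaled_face_closed[OF x]
      by (intro M.finsum_cong') (auto simp: complex_face_def)
    then show ?thesis using False by (simp add: q_differential_def)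
  qed
qed

lemma q_differential_lin: "q_differential A Y q n \<in> lin_maps (loday_complex A Y n) (loday_complex A Y (n - 1))"
  by (rule lin_cong[OF P.partial_sum_lin _ module_loday_complex]) (simp add: q_differential_eq)

lemma n_complex_loday:
  assumes "N \<ge> 2" "q ^ N = 1" "q \<noteq> 1"
  shows "n_complex N (loday_complex A Y) (q_differential A Y q)"
proof (rule n_complex.intro)
  fix n x assume x: "x \<in> carrier (loday_complex A Y n)"
  have "b_power (q_differential A Y q) N n x = b_power (P.partial_sum q 0) N n x"
    by (rule b_power_cong[where C = "loday_complex A Y", OF q_differential_eq lin_closed[OF P.partial_sum_lin] x])
  also have "\<dots> = \<zero>\<^bsub>loday_complex A Y (n - int N)\<^esub>"
    by (rule P.partial_sum_power[OF assms x])
  finally show "b_power (q_differential A Y q) N n x = \<zero>\<^bsub>loday_complex A Y (n - int N)\<^esub>" .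
qed (rule module_loday_complex q_differential_lin)+

lemma L_level_lin:
  assumes D: "D \<in> derivations A"
  shows "L_level A Y D (nat n) \<in> lin_maps (loday_complex A Y n) (loday_complex A Y n)"
proof -
  note L = L_fin_lin_in(1)[OF alg D]
  show ?thesis
  proof (cases "n < 0")
    case True
    interpret M: module \<C> "loday A (sobj Y 0)" by (rule module_loday[OF alg])
    have "L_fin A D (sobj Y 0) \<zero>\<^bsub>loday A (sobj Y 0)\<^esub> = \<zero>\<^bsub>loday A (sobj Y 0)\<^esub>"
      by (rule lin_zero[OF M.module_axioms M.module_axioms L])
    then show ?thesis
      using True L[of "sobj Y 0"] by (auto simp: loday_complex_def L_level_def lin_maps_def)
  qed (use L in \<open>simp add: loday_complex_def L_level_def\<close>)
qed

lemma L_level_face: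
  assumes D: "D \<in> derivations A" and x: "x \<in> carrier (loday_complex A Y n)"
  shows "L_level A Y D (nat (n - 1)) (complex_face n i x) = complex_face n i (L_level A Y D (nat n) x)"
proof (cases "n \<le> 0 \<or> int i > n")
  case True
  then show ?thesis
    using lin_zero[OF module_loday_complex module_loday_complex L_level_lin[OF D]]
    by (simp add: complex_face_def)
next
  case False
  then have n: "nat n \<ge> 1" "nat (n - 1) = nat n - 1" by auto
  then show ?thesis
    using False x L_fin_natural[OF alg D sarr_face[OF n(1)]]
    by (simp add: complex_face_def L_level_def loday_face_def loday_complex_def)
qed

lemma chain_endo_L:
  assumes N: "N \<ge> 2" "q ^ N = 1" "q \<noteq> 1" and D: "D \<in> derivations A"
  shows "(\<lambda>n. L_level A Y D (nat n))
    \<in> n_complex.chain_endos (loday_complex A Y) (q_differential A Y q)"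
proof -
  have "L_level A Y D (nat (n - 1)) (q_differential A Y q n x) = q_differential A Y q n (L_level A Y D (nat n) x)"
    if x: "x \<in> carrier (loday_complex A Y n)" for n x
  proof -
    let ?M = "loday_complex A Y (n - 1)"
    interpret M: module \<C> ?M by (rule module_loday_complex)
    note L = L_level_lin[OF D]
    note cl = P.scaled_face_closed[OF x] P.scaled_face_closed[OF lin_closed[OF L x]]
    have "L_level A Y D (nat (n - 1)) (P.partial_sum q 0 n x) =
        (\<Oplus>\<^bsub>?M\<^esub>i\<in>{0..nat n}. L_level A Y D (nat (n - 1)) (q ^ i \<odot>\<^bsub>?M\<^esub> complex_face n i x))"
      unfolding P.partial_sum_def
      by (rule lin_finsum[OF module_loday_complex module_loday_complex L]) (simp add: cl)
    also have "\<dots> = P.partial_sum q 0 n (L_level A Y D (nat n) x)"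
      unfolding P.partial_sum_def
      by (rule M.finsum_cong'[OF refl])
        (simp_all add: cl lin_smult[OF L lin_closed[OF complex_face_lin x]] L_level_face[OF D x])
    finally show ?thesis
      by (simp add: q_differential_eq[OF x] q_differential_eq[OF lin_closed[OF L x]])
  qed
  then show ?thesis
    unfolding n_complex.chain_endos_def[OF n_complex_loday[OF N]]
    using L_level_lin[OF D] by simp
qed

end

section \<open>Associative algebras and their representations\<close>

text \<open>A unital associative algebra. Scalars are only assumed to be compatible with the first factor
  of a product; this is what makes ideals subspaces.\<close>

locale assoc_algebra =
  fixes R :: "(complex, 'r, 'm) module_scheme"
  assumes ring_R: "ring R" and module_R: "module \<C> R"
    and smult_mult: "x \<in> carrier R \<Longrightarrow> y \<in> carrier R \<Longrightarrow>
      (c \<odot>\<^bsub>R\<^esub> x) \<otimes>\<^bsub>R\<^esub> y = c \<odot>\<^bsub>R\<^esub> (x \<otimes>\<^bsub>R\<^esub> y)"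
begin

lemma ideal_submodule:
  assumes I: "ideal I R"
  shows "submodule I \<C> R"
proof -
  interpret R: ring R by (rule ring_R)
  interpret M: module \<C> R by (rule module_R)
  interpret I: ideal I R by (rule I)
  show ?thesis
  proof (rule submoduleI_complex[OF module_R I.a_subset])
    fix c x assume x: "x \<in> I"
    have "c \<odot>\<^bsub>R\<^esub> x = (c \<odot>\<^bsub>R\<^esub> \<one>\<^bsub>R\<^esub>) \<otimes>\<^bsub>R\<^esub> x"
      using x by (simp add: smult_mult)
    also have "\<dots> \<in> I"
      using x by (intro I.I_l_closed) (auto intro!: M.smult_closed)
    finally show "c \<odot>\<^bsub>R\<^esub> x \<in> I" .
  qed auto
qed

lemma quot_mod_mult:
  assumes "ideal I R" "x \<in> carrier R" "y \<in> carrier R"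
  shows "(I +>\<^bsub>R\<^esub> x) \<otimes>\<^bsub>quot_mod R I\<^esub> (I +>\<^bsub>R\<^esub> y) = I +>\<^bsub>R\<^esub> (x \<otimes>\<^bsub>R\<^esub> y)"
  using ideal.rcoset_mult_add[OF assms] by (simp add: quot_mod_simps)

lemma assoc_algebra_quot_mod:
  assumes I: "ideal I R"
  shows "assoc_algebra (quot_mod R I)"
proof -
  interpret R: ring R by (rule ring_R)
  interpret M: module \<C> R by (rule module_R)
  note W = module_R ideal_submodule[OF I]
  note simps = quot_mod_mult[OF I] quot_mod_add[OF W] quot_mod_smult[OF W] quot_mod_simps(3)
  note cl = coset_in_quot[OF W]
  have mod: "module \<C> (quot_mod R I)" by (rule module_quot_mod[OF W])
  have "ring (quot_mod R I)"
  proof (rule ringI)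
    show "abelian_group (quot_mod R I)" using mod by (simp add: module_def)
    show "Group.monoid (quot_mod R I)"
      by (rule monoidI) (auto elim!: quot_cases[OF W] simp: simps cl R.m_assoc)
    show "(x \<oplus>\<^bsub>quot_mod R I\<^esub> y) \<otimes>\<^bsub>quot_mod R I\<^esub> z =
        x \<otimes>\<^bsub>quot_mod R I\<^esub> z \<oplus>\<^bsub>quot_mod R I\<^esub> y \<otimes>\<^bsub>quot_mod R I\<^esub> z"
      "z \<otimes>\<^bsub>quot_mod R I\<^esub> (x \<oplus>\<^bsub>quot_mod R I\<^esub> y) =
        z \<otimes>\<^bsub>quot_mod R I\<^esub> x \<oplus>\<^bsub>quot_mod R I\<^esub> z \<otimes>\<^bsub>quot_mod R I\<^esub> y"
      if "x \<in> carrier (quot_mod R I)" "y \<in> carrier (quot_mod R I)" "z \<in> carrier (quot_mod R I)" for x y z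
      using that by (auto elim!: quot_cases[OF W] simp: simps R.l_distr R.r_distr)
  qed
  then show ?thesis
    using mod by (rule assoc_algebra.intro)
      (auto elim!: quot_cases[OF W] simp: simps smult_mult M.smult_closed)
qed

end

text \<open>A representation of \<open>R\<close> on a vector space \<open>V\<close>, with \<open>r\<close> acting by the linear map \<open>act r\<close>.\<close>

locale algebra_rep = assoc_algebra R
  for R :: "(complex, 'r, 'm) module_scheme" and V :: "(complex, 'v, 'n) module_scheme"
    and act :: "'r \<Rightarrow> 'v \<Rightarrow> 'v" +
  assumes module_V: "module \<C> V"
    and act_lin: "r \<in> carrier R \<Longrightarrow> act r \<in> lin_maps V V"
    and act_arg_lin: "v \<in> carrier V \<Longrightarrow> (\<lambda>r. act r v) \<in> lin_maps R V"
    and act_mult: "r \<in> carrier R \<Longrightarrow> s \<in> carrier R \<Longrightarrow> v \<in> carrier V \<Longrightarrow> act (r \<otimes>\<^bsub>R\<^esub> s) v = act r (act s v)"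
    and act_id: "v \<in> carrier V \<Longrightarrow> act \<one>\<^bsub>R\<^esub> v = v"
begin

lemma left_module: "left_module R V act"
  using ring_R module_V lin_closed[OF act_lin] lin_add[OF act_lin] lin_add[OF act_arg_lin] act_mult act_id
  by (intro left_module.intro left_module_axioms.intro) (auto simp: module_def)

lemma genideal_acts_zero:
  assumes S: "S \<subseteq> carrier R" and zero: "\<And>s v. s \<in> S \<Longrightarrow> v \<in> carrier V \<Longrightarrow> act s v = \<zero>\<^bsub>V\<^esub>"
    and r: "r \<in> Idl\<^bsub>R\<^esub> S" and v: "v \<in> carrier V"
  shows "act r v = \<zero>\<^bsub>V\<^esub>"
proof -
  interpret R: ring R by (rule ring_R)
  interpret V: module \<C> V by (rule module_V)
  \<comment> \<open>the annihilator of \<open>V\<close> is a two-sided ideal\<close>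
  let ?K = "{r \<in> carrier R. \<forall>v\<in>carrier V. act r v = \<zero>\<^bsub>V\<^esub>}"
  have "submodule ?K \<C> R"
    using lin_zero[OF module_R module_V act_arg_lin] V.smult_r_null
      module.smult_closed[OF module_R]
    by (intro submoduleI_complex module_R) (auto simp: lin_add[OF act_arg_lin] lin_smult[OF act_arg_lin])
  then have "ideal ?K R"
    using lin_zero[OF module_V module_V act_lin] lin_closed[OF act_lin]
    by (intro idealI ring_R) (auto simp: submodule_def act_mult)
  then have "Idl\<^bsub>R\<^esub> S \<subseteq> ?K"
    using S zero by (intro R.genideal_minimal) auto
  then show ?thesis using r v by auto
qed

text \<open>If an ideal acts by zero, then the quotient acts by representatives.\<close>

lemma quot_act:
  assumes I: "ideal I R" and zero: "\<And>r v. r \<in> I \<Longrightarrow> v \<in> carrier V \<Longrightarrow> act r v = \<zero>\<^bsub>V\<^esub>"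
    and r: "r \<in> carrier R" and v: "v \<in> carrier V"
  shows "act (SOME s. s \<in> I +>\<^bsub>R\<^esub> r) v = act r v"
proof -
  note W = module_R ideal_submodule[OF I]
  have "r \<in> I +>\<^bsub>R\<^esub> r"
    by (rule abelian_subgroup.a_rcos_self[OF submodule_abelian_subgroup[OF W] r])
  then have "(SOME s. s \<in> I +>\<^bsub>R\<^esub> r) \<in> I +>\<^bsub>R\<^esub> r" by (rule someI)
  moreover have "(\<lambda>r. act r v) ` (I +>\<^bsub>R\<^esub> r) = {act r v}"
    by (rule image_coset[OF W module_V act_arg_lin[OF v] zero[OF _ v] r])
  ultimately show ?thesis by blast
qed

lemma algebra_rep_quot_mod:
  assumes I: "ideal I R" and zero: "\<And>r v. r \<in> I \<Longrightarrow> v \<in> carrier V \<Longrightarrow> act r v = \<zero>\<^bsub>V\<^esub>"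
  shows "algebra_rep (quot_mod R I) V (\<lambda>K. act (SOME r. r \<in> K))"
proof -
  interpret R: ring R by (rule ring_R)
  note W = module_R ideal_submodule[OF I]
  note qa = quot_act[OF I zero]
  show ?thesis
  proof (rule algebra_rep.intro[OF assoc_algebra_quot_mod[OF I] algebra_rep_axioms.intro])
    show "module \<C> V" by (rule module_V)
    show "act (SOME r. r \<in> K) \<in> lin_maps V V" if "K \<in> carrier (quot_mod R I)" for K
      using that
    proof (cases rule: quot_cases[OF W, consumes 1])
      case (1 r)
      show ?thesis
        unfolding 1(2) by (rule lin_cong[OF act_lin[OF 1(1)] _ module_V]) (simp add: qa[OF _ _ 1(1)])
    qed
    show "(\<lambda>K. act (SOME r. r \<in> K) v) \<in> lin_maps (quot_mod R I) V" if "v \<in> carrier V" for v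
      by (rule lin_from_quot[OF W act_arg_lin[OF that]]) (simp add: qa that)
    show "act (SOME r. r \<in> K \<otimes>\<^bsub>quot_mod R I\<^esub> L) v = act (SOME r. r \<in> K) (act (SOME r. r \<in> L) v)"
      if "K \<in> carrier (quot_mod R I)" "L \<in> carrier (quot_mod R I)" "v \<in> carrier V" for K L v
      using that by (auto elim!: quot_cases[OF W] simp: quot_mod_mult[OF I] qa act_mult lin_closed[OF act_lin])
    show "act (SOME r. r \<in> \<one>\<^bsub>quot_mod R I\<^esub>) v = v" if "v \<in> carrier V" for v
      using that by (simp add: quot_mod_simps qa act_id)
  qed
qed

end

section \<open>Free algebras\<close>

lemma free_algebra_simps:
  "carrier (free_algebra S) = carrier (free_space (lists S))"
  "\<zero>\<^bsub>free_algebra S\<^esub> = \<zero>\<^bsub>free_space (lists S)\<^esub>"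
  "add (free_algebra S) = add (free_space (lists S))"
  "module.smult (free_algebra S) = module.smult (free_space (lists S))"
  "\<one>\<^bsub>free_algebra S\<^esub> = free_basis []"
  "f \<otimes>\<^bsub>free_algebra S\<^esub> g = (\<lambda>w. \<Sum>k\<le>length w. f (take k w) * g (drop k w))"
  by (simp_all add: free_algebra_def)

lemma lin_maps_free_algebra: "lin_maps (free_algebra S) N = lin_maps (free_space (lists S)) N"
  "lin_maps N (free_algebra S) = lin_maps N (free_space (lists S))"
  by (simp_all add: lin_maps_def free_algebra_simps)

lemma module_free_algebra: "module \<C> (free_algebra S)"
proof -
  interpret F: module \<C> "free_space (lists S)" by (rule module_free_space)
  have "(-1) \<odot>\<^bsub>free_space (lists S)\<^esub> f \<oplus>\<^bsub>free_space (lists S)\<^esub> f = \<zero>\<^bsub>free_space (lists S)\<^esub>" for f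
    by (simp add: free_space_simps)
  then show ?thesis
    using F.smult_l_distr F.smult_assoc1 F.smult_one F.smult_closed
    by (intro vector_spaceI) (auto simp: free_algebra_simps F.a_ac F.smult_r_distr)
qed

context
  fixes S :: "'x set"
begin

abbreviation (input) free_mult :: "('x list \<Rightarrow> complex) \<Rightarrow> ('x list \<Rightarrow> complex) \<Rightarrow> 'x list \<Rightarrow> complex"
  where "free_mult f g \<equiv> f \<otimes>\<^bsub>free_algebra S\<^esub> g"

lemma free_mult_closed:
  assumes f: "f \<in> carrier (free_algebra S)" and g: "g \<in> carrier (free_algebra S)"
  shows "free_mult f g \<in> carrier (free_algebra S)"
proof -
  let ?P = "{u. f u \<noteq> 0} \<times> {v. g v \<noteq> 0}"
  have split: "w \<in> (\<lambda>(u, v). u @ v) ` ?P" "w \<in> lists S" if w: "free_mult f g w \<noteq> 0" for w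
  proof -
    obtain k where "f (take k w) * g (drop k w) \<noteq> 0"
      using w unfolding free_algebra_simps by (auto elim: sum.not_neutral_contains_not_neutral)
    then have k: "f (take k w) \<noteq> 0" "g (drop k w) \<noteq> 0" by auto
    then show "w \<in> (\<lambda>(u, v). u @ v) ` ?P"
      by (intro image_eqI[of _ _ "(take k w, drop k w)"]) auto
    have "take k w \<in> lists S" "drop k w \<in> lists S"
      using f g k unfolding free_algebra_simps(1) free_space_simps(1) by blast+
    then show "w \<in> lists S"
      by (metis append_in_lists_conv append_take_drop_id)
  qed
  have "finite ?P" using f g by (simp add: free_algebra_simps free_space_simps)
  then have "finite {w. free_mult f g w \<noteq> 0}"
    by (rule finite_surj[where f = "\<lambda>(u, v). u @ v"]) (use split(1) in blast)
  then show ?thesis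
    using split(2) unfolding free_algebra_simps(1) free_space_simps(1) by blast
qed

lemma free_mult_lin_left:
  "g \<in> carrier (free_algebra S) \<Longrightarrow> (\<lambda>f. free_mult f g) \<in> lin_maps (free_algebra S) (free_algebra S)"
  by (rule lin_mapsI, erule (1) free_mult_closed[rotated])
    (auto simp: free_algebra_simps free_space_simps sum.distrib sum_distrib_left algebra_simps)

lemma free_mult_lin_right:
  "f \<in> carrier (free_algebra S) \<Longrightarrow> (\<lambda>g. free_mult f g) \<in> lin_maps (free_algebra S) (free_algebra S)"
  by (rule lin_mapsI, erule (1) free_mult_closed)
    (auto simp: free_algebra_simps free_space_simps sum.distrib sum_distrib_left algebra_simps)

lemma free_mult_basis: "free_mult (free_basis u) (free_basis v) = free_basis (u @ v)"
proof
  fix w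
  have "(\<Sum>k\<le>length w. free_basis u (take k w) * free_basis v (drop k w)) =
      (\<Sum>k\<le>length w. if k = length u \<and> w = u @ v then 1 else 0)"
  proof (rule sum.cong[OF refl])
    fix k assume "k \<in> {..length w}"
    then have "take k w = u \<and> drop k w = v \<longleftrightarrow> k = length u \<and> w = u @ v"
      by (metis append_eq_conv_conj append_take_drop_id atMost_iff length_take min.absorb2)
    then show "free_basis u (take k w) * free_basis v (drop k w) = (if k = length u \<and> w = u @ v then 1 else 0)"
      by (auto simp: free_basis_def)
  qed
  also have "\<dots> = free_basis (u @ v) w"
    by (auto simp: free_basis_def)
  finally show "free_mult (free_basis u) (free_basis v) w = free_basis (u @ v) w"
    by (simp add: free_algebra_simps)
qed

lemma free_algebra_lin_ext:
  assumes "module \<C> N" "F \<in> lin_maps (free_algebra S) N" "G \<in> lin_maps (free_algebra S) N"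
    and "\<And>w. w \<in> lists S \<Longrightarrow> F (free_basis w) = G (free_basis w)" and "f \<in> carrier (free_algebra S)"
  shows "F f = G f"
  using free_space_lin_ext[OF assms(1) assms(2,3)[unfolded lin_maps_free_algebra] assms(4)
      assms(5)[unfolded free_algebra_simps]] .

lemma free_algebra_basis_closed: "w \<in> lists S \<Longrightarrow> free_basis w \<in> carrier (free_algebra S)"
  unfolding free_algebra_simps by (rule free_basis_closed)

text \<open>The product is bilinear and concatenates basis words, so that the ring laws hold because they
  hold for words.\<close>

lemma assoc_algebra_free_algebra: "assoc_algebra (free_algebra S)"
proof -
  let ?F = "free_algebra S"
  interpret F: module \<C> ?F by (rule module_free_algebra)
  note cl = free_mult_closed and b = free_algebra_basis_closed
  note ll = free_mult_lin_left and lr = free_mult_lin_right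
  note ext = free_algebra_lin_ext[OF module_free_algebra]
  have assoc: "free_mult (free_mult f g) h = free_mult f (free_mult g h)"
    if f: "f \<in> carrier ?F" and g: "g \<in> carrier ?F" and h: "h \<in> carrier ?F" for f g h
  proof (rule ext[OF lin_comp[OF ll[OF g] ll[OF h]] ll[OF cl[OF g h]] _ f])
    fix u assume u: "u \<in> lists S"
    show "free_mult (free_mult (free_basis u) g) h = free_mult (free_basis u) (free_mult g h)"
    proof (rule ext[OF lin_comp[OF lr[OF b[OF u]] ll[OF h]] lin_comp[OF ll[OF h] lr[OF b[OF u]]] _ g])
      fix v assume v: "v \<in> lists S"
      show "free_mult (free_mult (free_basis u) (free_basis v)) h = free_mult (free_basis u) (free_mult (free_basis v) h)"
        by (rule ext[OF lr[OF cl[OF b[OF u] b[OF v]]] lin_comp[OF lr[OF b[OF v]] lr[OF b[OF u]]] _ h])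
          (simp add: free_mult_basis)
    qed
  qed
  have one: "\<one>\<^bsub>?F\<^esub> \<in> carrier ?F"
    unfolding free_algebra_simps(5) by (rule b) simp
  have l_one: "free_mult \<one>\<^bsub>?F\<^esub> f = f" and r_one: "free_mult f \<one>\<^bsub>?F\<^esub> = f" if f: "f \<in> carrier ?F" for f
    by (rule ext[OF lr[OF one] lin_id _ f], simp add: free_algebra_simps(5) free_mult_basis)
      (rule ext[OF ll[OF one] lin_id _ f], simp add: free_algebra_simps(5) free_mult_basis)
  have "ring ?F"
  proof (rule ringI)
    show "abelian_group ?F" by (rule F.abelian_group_axioms)
    show "Group.monoid ?F"
      by (rule monoidI) (simp_all add: cl one assoc l_one r_one)
  qed (auto simp: lin_add[OF ll] lin_add[OF lr])
  then show ?thesis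
    using module_free_algebra by (rule assoc_algebra.intro) (simp add: lin_smult[OF ll])
qed

text \<open>The representation of the free algebra that extends a family of linear maps \<open>\<rho> s\<close>, with the
  word \<open>s\<^sub>1 \<dots> s\<^sub>k\<close> acting by \<open>\<rho> s\<^sub>1 \<circ> \<dots> \<circ> \<rho> s\<^sub>k\<close>.\<close>

definition free_act :: "(complex, 'v, 'n) module_scheme \<Rightarrow> ('x \<Rightarrow> 'v \<Rightarrow> 'v) \<Rightarrow> ('x list \<Rightarrow> complex) \<Rightarrow> 'v \<Rightarrow> 'v"
  where "free_act V \<rho> f v = (\<Oplus>\<^bsub>V\<^esub>w\<in>{w. f w \<noteq> 0}. f w \<odot>\<^bsub>V\<^esub> foldr \<rho> w v)"

context
  fixes V :: "(complex, 'v, 'n) module_scheme" and \<rho> :: "'x \<Rightarrow> 'v \<Rightarrow> 'v"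
  assumes V: "module \<C> V" and \<rho>: "\<And>s. s \<in> S \<Longrightarrow> \<rho> s \<in> lin_maps V V"
begin

lemma foldr_lin: "w \<in> lists S \<Longrightarrow> foldr \<rho> w \<in> lin_maps V V"
proof (induction w)
  case Nil
  then show ?case using lin_id by (simp add: id_def)
next
  case (Cons s w)
  then show ?case using lin_comp[of "foldr \<rho> w" V V "\<rho> s" V] \<rho> by (simp add: comp_def)
qed

lemma free_act_basis: "w \<in> lists S \<Longrightarrow> v \<in> carrier V \<Longrightarrow> free_act V \<rho> (free_basis w) v = foldr \<rho> w v"
  unfolding free_act_def by (rule free_lift_basis[where g = "\<lambda>w. foldr \<rho> w v", OF V]) (rule lin_closed[OF foldr_lin])

lemma algebra_rep_free_act: "algebra_rep (free_algebra S) V (free_act V \<rho>)"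
proof (rule algebra_rep.intro[OF assoc_algebra_free_algebra algebra_rep_axioms.intro])
  let ?F = "free_algebra S"
  show "module \<C> V" by (rule V)
  show al: "(\<lambda>f. free_act V \<rho> f v) \<in> lin_maps ?F V" if "v \<in> carrier V" for v
    unfolding free_act_def lin_maps_free_algebra
    using that by (intro free_lift_lin V) (auto intro: lin_closed[OF foldr_lin])
  show l: "free_act V \<rho> f \<in> lin_maps V V" if "f \<in> carrier ?F" for f
  proof -
    have "(\<lambda>v. \<Oplus>\<^bsub>V\<^esub>w\<in>{w. f w \<noteq> 0}. f w \<odot>\<^bsub>V\<^esub> foldr \<rho> w v) \<in> lin_maps V V"
      using that by (intro lin_finsum_maps V lin_scale foldr_lin) (auto simp: free_algebra_simps free_space_simps)
    then show ?thesis by (simp add: free_act_def[abs_def])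
  qed
  note b = free_algebra_basis_closed
  show "free_act V \<rho> (free_mult f g) v = free_act V \<rho> f (free_act V \<rho> g v)"
    if f: "f \<in> carrier ?F" and g: "g \<in> carrier ?F" and v: "v \<in> carrier V" for f g v
  proof (rule free_algebra_lin_ext[OF V lin_comp[OF free_mult_lin_left[OF g] al[OF v]] al[OF lin_closed[OF l[OF g] v]] _ f])
    fix u assume u: "u \<in> lists S"
    show "free_act V \<rho> (free_mult (free_basis u) g) v = free_act V \<rho> (free_basis u) (free_act V \<rho> g v)"
    proof (rule free_algebra_lin_ext[OF V lin_comp[OF free_mult_lin_right[OF b[OF u]] al[OF v]]
          lin_comp[OF al[OF v] l[OF b[OF u]]] _ g])
      fix w assume w: "w \<in> lists S"
      show "free_act V \<rho> (free_mult (free_basis u) (free_basis w)) v =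
          free_act V \<rho> (free_basis u) (free_act V \<rho> (free_basis w) v)"
        using u w v lin_closed[OF foldr_lin[OF w] v] by (simp add: free_mult_basis free_act_basis)
    qed
  qed
  show "free_act V \<rho> \<one>\<^bsub>?F\<^esub> v = v" if "v \<in> carrier V" for v
    using free_act_basis[of "[]" v] that by (simp add: free_algebra_simps)
qed

end

end

section \<open>Universal enveloping algebras\<close>

text \<open>A linear map \<open>\<rho>\<close> to the endomorphisms of \<open>V\<close> that carries brackets to commutators extends to the
  universal enveloping algebra; \<open>L\<close> may be any structure that is closed under its operations.\<close>

lemma universal_env_rep:
  fixes L :: "(complex, 'g, 'm) lie_algebra_scheme" and V :: "(complex, 'v, 'n) module_scheme"
  assumes V: "module \<C> V"
    and Lc: "\<And>x y. x \<in> carrier L \<Longrightarrow> y \<in> carrier L \<Longrightarrow> x \<oplus>\<^bsub>L\<^esub> y \<in> carrier L"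
      "\<And>c x. x \<in> carrier L \<Longrightarrow> c \<odot>\<^bsub>L\<^esub> x \<in> carrier L"
      "\<And>x y. x \<in> carrier L \<Longrightarrow> y \<in> carrier L \<Longrightarrow> bracket L x y \<in> carrier L"
    and \<rho>: "\<And>x. x \<in> carrier L \<Longrightarrow> \<rho> x \<in> lin_maps V V"
    and \<rho>_add: "\<And>x y v. x \<in> carrier L \<Longrightarrow> y \<in> carrier L \<Longrightarrow> v \<in> carrier V \<Longrightarrow> \<rho> (x \<oplus>\<^bsub>L\<^esub> y) v = \<rho> x v \<oplus>\<^bsub>V\<^esub> \<rho> y v"
    and \<rho>_smult: "\<And>c x v. x \<in> carrier L \<Longrightarrow> v \<in> carrier V \<Longrightarrow> \<rho> (c \<odot>\<^bsub>L\<^esub> x) v = c \<odot>\<^bsub>V\<^esub> \<rho> x v"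
    and \<rho>_bracket: "\<And>x y v. x \<in> carrier L \<Longrightarrow> y \<in> carrier L \<Longrightarrow> v \<in> carrier V \<Longrightarrow>
      \<rho> (bracket L x y) v = \<rho> x (\<rho> y v) \<ominus>\<^bsub>V\<^esub> \<rho> y (\<rho> x v)"
  obtains act where "algebra_rep (universal_env L) V act"
    "\<And>x v. x \<in> carrier L \<Longrightarrow> v \<in> carrier V \<Longrightarrow> act (env_in L x) v = \<rho> x v"
proof -
  interpret V: module \<C> V by (rule V)
  note \<rho>c = lin_closed[OF \<rho>]

  \<comment> \<open>the free algebra acts by words, and the linearity relations act by zero\<close>
  let ?F = "free_algebra (carrier L)"
  let ?a = "free_act V \<rho>"
  interpret F: algebra_rep ?F V ?a by (rule algebra_rep_free_act[OF V \<rho>])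
  interpret FR: ring ?F by (rule F.ring_R)
  interpret FM: module \<C> ?F by (rule F.module_R)
  have bc: "free_basis [x] \<in> carrier ?F" if "x \<in> carrier L" for x
    using that by (intro free_algebra_basis_closed) simp
  have ab: "?a (free_basis [x]) v = \<rho> x v" if "x \<in> carrier L" "v \<in> carrier V" for x v
    using free_act_basis[where S = "carrier L" and w = "[x]" and v = v, OF V \<rho>] that by simp
  define G where "G = {free_basis [x \<oplus>\<^bsub>L\<^esub> y] \<ominus>\<^bsub>?F\<^esub> (free_basis [x] \<oplus>\<^bsub>?F\<^esub> free_basis [y])
        | x y. x \<in> carrier L \<and> y \<in> carrier L} \<union>
     {free_basis [c \<odot>\<^bsub>L\<^esub> x] \<ominus>\<^bsub>?F\<^esub> (c \<odot>\<^bsub>?F\<^esub> free_basis [x]) | c x. x \<in> carrier L}"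
  define I where "I = tensor_algebra_rels L"
  have I_eq: "I = Idl\<^bsub>?F\<^esub> G"
    by (simp add: I_def tensor_algebra_rels_def G_def Let_def)
  have G: "G \<subseteq> carrier ?F"
    using FM.smult_closed by (auto simp: G_def bc Lc)
  have I: "ideal I ?F" unfolding I_eq by (rule FR.genideal_ideal[OF G])
  have I_zero: "?a r v = \<zero>\<^bsub>V\<^esub>" if "r \<in> I" "v \<in> carrier V" for r v
  proof (rule F.genideal_acts_zero[OF G _ that(1)[unfolded I_eq] that(2)])
    fix s v assume s: "s \<in> G" and v: "v \<in> carrier V"
    note al = F.act_arg_lin[OF v]
    from s show "?a s v = \<zero>\<^bsub>V\<^esub>"
      unfolding G_def
    proof (elim UnE CollectE exE conjE)
      fix x y assume s: "s = free_basis [x \<oplus>\<^bsub>L\<^esub> y] \<ominus>\<^bsub>?F\<^esub> (free_basis [x] \<oplus>\<^bsub>?F\<^esub> free_basis [y])"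
        and xy: "x \<in> carrier L" "y \<in> carrier L"
      have "?a s v = \<rho> (x \<oplus>\<^bsub>L\<^esub> y) v \<ominus>\<^bsub>V\<^esub> (\<rho> x v \<oplus>\<^bsub>V\<^esub> \<rho> y v)"
        unfolding s using xy v
        by (simp add: lin_minus[OF F.module_R V al] lin_add[OF al] bc Lc ab)
      then show ?thesis using xy v by (simp add: \<rho>_add \<rho>c V.minus_eq_zero_iff)
    next
      fix c x assume s: "s = free_basis [c \<odot>\<^bsub>L\<^esub> x] \<ominus>\<^bsub>?F\<^esub> (c \<odot>\<^bsub>?F\<^esub> free_basis [x])"
        and x: "x \<in> carrier L"
      have "?a s v = \<rho> (c \<odot>\<^bsub>L\<^esub> x) v \<ominus>\<^bsub>V\<^esub> c \<odot>\<^bsub>V\<^esub> \<rho> x v"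
        unfolding s using x v FM.smult_closed[of c "free_basis [x]"]
        by (simp add: lin_minus[OF F.module_R V al] lin_smult[OF al] bc Lc ab)
      then show ?thesis using x v V.smult_closed[of c "\<rho> x v"] by (simp add: \<rho>_smult \<rho>c V.minus_eq_zero_iff)
    qed
  qed

  \<comment> \<open>the tensor algebra acts, and the commutator relations act by zero\<close>
  let ?T = "tensor_algebra L"
  define t where "t = (\<lambda>K. ?a (SOME r. r \<in> K))"
  have T_eq: "?T = quot_mod ?F I" by (simp add: tensor_algebra_def I_def)
  have T_rep: "algebra_rep ?T V t"
    unfolding T_eq t_def by (rule F.algebra_rep_quot_mod[OF I I_zero])
  interpret T: algebra_rep ?T V t by (rule T_rep)
  interpret TR: ring ?T by (rule T.ring_R)
  have tc: "tensor_algebra_in L x \<in> carrier ?T" if "x \<in> carrier L" for x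
    unfolding T_eq tensor_algebra_in_def I_def[symmetric]
    by (rule coset_in_quot[OF F.module_R F.ideal_submodule[OF I] bc[OF that]])
  have tb: "t (tensor_algebra_in L x) v = \<rho> x v" if "x \<in> carrier L" "v \<in> carrier V" for x v
    unfolding t_def tensor_algebra_in_def I_def[symmetric]
    using F.quot_act[OF I I_zero bc[OF that(1)] that(2)] ab[OF that] by simp
  define H where "H = {(tensor_algebra_in L x \<otimes>\<^bsub>?T\<^esub> tensor_algebra_in L y \<ominus>\<^bsub>?T\<^esub>
      tensor_algebra_in L y \<otimes>\<^bsub>?T\<^esub> tensor_algebra_in L x) \<ominus>\<^bsub>?T\<^esub> tensor_algebra_in L (bracket L x y)
      | x y. x \<in> carrier L \<and> y \<in> carrier L}"
  define J where "J = env_rels L"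
  have J_eq: "J = Idl\<^bsub>?T\<^esub> H"
    by (simp add: J_def env_rels_def H_def Let_def)
  have H: "H \<subseteq> carrier ?T"
    by (auto simp: H_def tc Lc)
  have J: "ideal J ?T" unfolding J_eq by (rule TR.genideal_ideal[OF H])
  have J_zero: "t r v = \<zero>\<^bsub>V\<^esub>" if "r \<in> J" "v \<in> carrier V" for r v
  proof (rule T.genideal_acts_zero[OF H _ that(1)[unfolded J_eq] that(2)])
    fix s v assume s: "s \<in> H" and v: "v \<in> carrier V"
    note al = T.act_arg_lin[OF v]
    from s obtain x y where xy: "x \<in> carrier L" "y \<in> carrier L"
      and s: "s = (tensor_algebra_in L x \<otimes>\<^bsub>?T\<^esub> tensor_algebra_in L y \<ominus>\<^bsub>?T\<^esub>
        tensor_algebra_in L y \<otimes>\<^bsub>?T\<^esub> tensor_algebra_in L x) \<ominus>\<^bsub>?T\<^esub> tensor_algebra_in L (bracket L x y)"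
      unfolding H_def by blast
    have "t s v = (\<rho> x (\<rho> y v) \<ominus>\<^bsub>V\<^esub> \<rho> y (\<rho> x v)) \<ominus>\<^bsub>V\<^esub> \<rho> (bracket L x y) v"
      unfolding s using xy v
      by (simp add: lin_minus[OF T.module_R V al] T.act_mult tc Lc tb \<rho>c)
    then show "t s v = \<zero>\<^bsub>V\<^esub>"
      using xy v by (simp add: \<rho>_bracket \<rho>c V.minus_eq_zero_iff)
  qed

  define e where "e = (\<lambda>K. t (SOME r. r \<in> K))"
  have "algebra_rep (universal_env L) V e"
    unfolding e_def universal_env_def J_def[symmetric] by (rule T.algebra_rep_quot_mod[OF J J_zero])
  moreover have "e (env_in L x) v = \<rho> x v" if "x \<in> carrier L" "v \<in> carrier V" for x v
    unfolding e_def env_in_def J_def[symmetric]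
    using T.quot_act[OF J J_zero tc[OF that(1)] that(2)] tb[OF that] by simp
  ultimately show ?thesis by (rule that)
qed

section \<open>The action on \<open>q\<close>-Hochschild homology\<close>

context
  fixes A :: "(complex, 'a, 'm) module_scheme" and Y :: "'s simplicial_pset"
    and N :: nat and q :: complex
  assumes alg: "algebra \<C> A" and Y: "pointed_simplicial_finite_set Y"
    and N: "N \<ge> 2" and q: "q ^ N = 1" "q \<noteq> 1"
begin

interpretation NC: n_complex N "loday_complex A Y" "q_differential A Y q"
  by (rule n_complex_loday[OF alg Y N q])

private lemma endo: "D \<in> derivations A \<Longrightarrow> (\<lambda>n. L_level A Y D (nat n)) \<in> NC.chain_endos"
  by (rule chain_endo_L[OF alg Y N q])

lemma module_qHH: "module \<C> (qHH A Y N q n)"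
  unfolding qHH_def by (rule NC.module_homology)

lemma L_qHH_lin: "D \<in> derivations A \<Longrightarrow> L_qHH A Y N q D n \<in> lin_maps (qHH A Y N q n) (qHH A Y N q n)"
  using NC.homology_map_lin[OF endo, of D "int n"] by (simp add: L_qHH_def qHH_def)

lemma L_level_b_ker: "D \<in> derivations A \<Longrightarrow>
    L_level A Y D n ` b_ker (loday_complex A Y) (q_differential A Y q) i (int n)
      \<subseteq> b_ker (loday_complex A Y) (q_differential A Y q) i (int n)"
  using NC.chain_endo_b_ker[OF endo, of D "int n" i] by simp

lemma L_level_b_im: "D \<in> derivations A \<Longrightarrow>
    L_level A Y D n ` b_im (loday_complex A Y) (q_differential A Y q) k (int n)
      \<subseteq> b_im (loday_complex A Y) (q_differential A Y q) k (int n)"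
  using NC.chain_endo_b_im[OF endo, of D "int n" k] by simp

lemma L_qHH_class: "D \<in> derivations A \<Longrightarrow> x \<in> NC.cycles (int n) \<Longrightarrow>
    L_qHH A Y N q D n (homology_class N (loday_complex A Y) (q_differential A Y q) (int n) x) =
      homology_class N (loday_complex A Y) (q_differential A Y q) (int n) (\<lambda>i. L_level A Y D n (x i))"
  using NC.homology_map_class[OF endo, of D x "int n"] by (simp add: L_qHH_def)

private lemma L_cycles: "D \<in> derivations A \<Longrightarrow> x \<in> NC.cycles (int n) \<Longrightarrow>
    (\<lambda>i. L_level A Y D n (x i)) \<in> NC.cycles (int n)"
  using L_level_b_ker by (fastforce simp: Pi_iff)

private lemma cycles_loday: "x \<in> NC.cycles (int n) \<Longrightarrow> i \<in> {1..N - 1} \<Longrightarrow> x i \<in> carrier (loday A (sobj Y n))"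
  using NC.cycles_carrier[of x "int n" i] by (simp add: loday_complex_def)

private lemma class_cong: "(\<And>i. i \<in> {1..N - 1} \<Longrightarrow> x i = y i) \<Longrightarrow>
    homology_class N C b n x = homology_class N C b n y"
  unfolding homology_class_def by (rule restrict_ext) simp

lemma L_qHH_add:
  assumes D: "D \<in> derivations A" and E: "E \<in> derivations A" and u: "u \<in> carrier (qHH A Y N q n)"
  shows "L_qHH A Y N q (D \<oplus>\<^bsub>Der A\<^esub> E) n u = L_qHH A Y N q D n u \<oplus>\<^bsub>qHH A Y N q n\<^esub> L_qHH A Y N q E n u"
  using u[unfolded qHH_def]
proof (cases rule: NC.homology_cases)
  case (1 x)
  show ?thesis
    unfolding 1(2) L_qHH_class[OF D 1(1)] L_qHH_class[OF E 1(1)] L_qHH_class[OF derivation_add[OF alg D E] 1(1)]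
      qHH_def NC.homology_class_add[OF L_cycles[OF D 1(1)] L_cycles[OF E 1(1)]]
    using L_fin_add[OF alg D E cycles_loday[OF 1(1)]]
    by (intro class_cong) (simp add: L_level_def loday_complex_def)
qed

lemma L_qHH_smult:
  assumes D: "D \<in> derivations A" and u: "u \<in> carrier (qHH A Y N q n)"
  shows "L_qHH A Y N q (c \<odot>\<^bsub>Der A\<^esub> D) n u = c \<odot>\<^bsub>qHH A Y N q n\<^esub> L_qHH A Y N q D n u"
  using u[unfolded qHH_def]
proof (cases rule: NC.homology_cases)
  case (1 x)
  show ?thesis
    unfolding 1(2) L_qHH_class[OF D 1(1)] L_qHH_class[OF derivation_smult[OF alg D] 1(1)]
      qHH_def NC.homology_class_smult[OF L_cycles[OF D 1(1)]]
    using L_fin_smult[OF alg D cycles_loday[OF 1(1)]]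
    by (intro class_cong) (simp add: L_level_def loday_complex_def)
qed

lemma L_qHH_bracket:
  assumes D: "D \<in> derivations A" and E: "E \<in> derivations A" and u: "u \<in> carrier (qHH A Y N q n)"
  shows "L_qHH A Y N q (bracket (Der A) D E) n u =
    L_qHH A Y N q D n (L_qHH A Y N q E n u) \<ominus>\<^bsub>qHH A Y N q n\<^esub> L_qHH A Y N q E n (L_qHH A Y N q D n u)"
proof -
  let ?V = "qHH A Y N q n" and ?L = "\<lambda>D. L_qHH A Y N q D n"
  interpret V: module \<C> ?V by (rule module_qHH)
  have B: "bracket (Der A) D E \<in> derivations A" by (rule derivation_bracket[OF alg D E])
  note c = lin_closed[OF L_qHH_lin[OF D]] lin_closed[OF L_qHH_lin[OF E]] lin_closed[OF L_qHH_lin[OF B]]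
  have "?L (bracket (Der A) D E) u \<oplus>\<^bsub>?V\<^esub> ?L E (?L D u) = ?L D (?L E u)"
    using u[unfolded qHH_def]
  proof (cases rule: NC.homology_cases)
    case (1 x)
    note cy = L_cycles[OF D 1(1)] L_cycles[OF E 1(1)] L_cycles[OF B 1(1)]
    have "L_level A Y (bracket (Der A) D E) n (x i) \<oplus>\<^bsub>loday_complex A Y (int n)\<^esub>
        L_level A Y E n (L_level A Y D n (x i)) = L_level A Y D n (L_level A Y E n (x i))"
      if i: "i \<in> {1..N - 1}" for i
    proof -
      interpret M: module \<C> "loday A (sobj Y n)" by (rule module_loday[OF alg])
      note xi = cycles_loday[OF 1(1) i]
      note L = lin_closed[OF L_fin_lin_in(1)[OF alg D]] lin_closed[OF L_fin_lin_in(1)[OF alg E]]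
      show ?thesis
        unfolding L_level_def L_fin_bracket[OF alg D E xi]
        using L(1)[OF L(2)[OF xi]] L(2)[OF L(1)[OF xi]]
        by (simp add: loday_complex_def a_minus_def M.a_assoc M.l_neg)
    qed
    then show ?thesis
      unfolding 1(2) L_qHH_class[OF D 1(1)] L_qHH_class[OF E 1(1)] L_qHH_class[OF B 1(1)]
        L_qHH_class[OF E cy(1)] L_qHH_class[OF D cy(2)]
        qHH_def NC.homology_class_add[OF cy(3) L_cycles[OF E cy(1)]]
      by (rule class_cong)
  qed
  then have "?L D (?L E u) = ?L (bracket (Der A) D E) u \<oplus>\<^bsub>?V\<^esub> ?L E (?L D u)" ..
  then show ?thesis
    using c(3)[OF u] c(2)[OF c(1)[OF u]] by (simp add: a_minus_def V.a_assoc V.r_neg)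
qed

end

theorem theorem1p1:
  fixes A :: "(complex, 'a, 'm) module_scheme"
    and Y :: "'s simplicial_pset"
    and N :: nat and q :: complex and D :: "'a \<Rightarrow> 'a"
  assumes "algebra \<C> A"
    and "pointed_simplicial_finite_set Y"
    and "N \<ge> 2"
    and "q ^ N = 1" and "\<And>k. \<lbrakk>0 < k; k < N\<rbrakk> \<Longrightarrow> q ^ k \<noteq> 1"
    and "D \<in> carrier (Der A)"
  shows
    "let C = loday_complex A Y; b = q_differential A Y q in
     (\<forall>n::nat.
        module \<C> (qHH A Y N q n) \<and>
        L_qHH A Y N q D n \<in> lin_maps (qHH A Y N q n) (qHH A Y N q n) \<and>
        (\<forall>i\<in>{1..N - 1}.
           L_level A Y D n ` b_ker C b i (int n) \<subseteq> b_ker C b i (int n) \<and>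
           L_level A Y D n ` b_im C b (N - i) (int n) \<subseteq> b_im C b (N - i) (int n)) \<and>
        (\<forall>x. (\<forall>i\<in>{1..N - 1}. x i \<in> b_ker C b i (int n)) \<longrightarrow>
           L_qHH A Y N q D n (homology_class N C b (int n) x) =
             homology_class N C b (int n) (\<lambda>i. L_level A Y D n (x i)))) \<and>
     (\<forall>n::nat. \<exists>act.
        left_module (universal_env (Der A)) (qHH A Y N q n) act \<and>
        (\<forall>h\<in>carrier (universal_env (Der A)).
           act h \<in> lin_maps (qHH A Y N q n) (qHH A Y N q n)) \<and>
        (\<forall>c. \<forall>h\<in>carrier (universal_env (Der A)). \<forall>x\<in>carrier (qHH A Y N q n).
           act (c \<odot>\<^bsub>universal_env (Der A)\<^esub> h) x = c \<odot>\<^bsub>qHH A Y N q n\<^esub> act h x) \<and>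
        (\<forall>E\<in>carrier (Der A). \<forall>x\<in>carrier (qHH A Y N q n).
           act (env_in (Der A) E) x = L_qHH A Y N q E n x))"
proof -
  have q: "q \<noteq> 1" using assms(5)[of 1] assms(3) by simp
  note c = assms(1-4) q
  have D: "D \<in> derivations A" using assms(6) by (simp add: Der_simps)
  have part1: "module \<C> (qHH A Y N q n) \<and>
      L_qHH A Y N q D n \<in> lin_maps (qHH A Y N q n) (qHH A Y N q n) \<and>
      (\<forall>i\<in>{1..N - 1}.
         L_level A Y D n ` b_ker (loday_complex A Y) (q_differential A Y q) i (int n)
           \<subseteq> b_ker (loday_complex A Y) (q_differential A Y q) i (int n) \<and>
         L_level A Y D n ` b_im (loday_complex A Y) (q_differential A Y q) (N - i) (int n)
           \<subseteq> b_im (loday_complex A Y) (q_differential A Y q) (N - i) (int n)) \<and>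
      (\<forall>x. (\<forall>i\<in>{1..N - 1}. x i \<in> b_ker (loday_complex A Y) (q_differential A Y q) i (int n)) \<longrightarrow>
         L_qHH A Y N q D n (homology_class N (loday_complex A Y) (q_differential A Y q) (int n) x) =
           homology_class N (loday_complex A Y) (q_differential A Y q) (int n) (\<lambda>i. L_level A Y D n (x i)))"
    for n
    using module_qHH[OF c] L_qHH_lin[OF c D] L_level_b_ker[OF c D] L_level_b_im[OF c D] L_qHH_class[OF c D]
    by (auto simp: Pi_iff)
  have part2: "\<exists>act.
      left_module (universal_env (Der A)) (qHH A Y N q n) act \<and>
      (\<forall>h\<in>carrier (universal_env (Der A)). act h \<in> lin_maps (qHH A Y N q n) (qHH A Y N q n)) \<and>
      (\<forall>c. \<forall>h\<in>carrier (universal_env (Der A)). \<forall>x\<in>carrier (qHH A Y N q n).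
         act (c \<odot>\<^bsub>universal_env (Der A)\<^esub> h) x = c \<odot>\<^bsub>qHH A Y N q n\<^esub> act h x) \<and>
      (\<forall>E\<in>carrier (Der A). \<forall>x\<in>carrier (qHH A Y N q n).
         act (env_in (Der A) E) x = L_qHH A Y N q E n x)" for n
  proof (rule universal_env_rep[where L = "Der A" and V = "qHH A Y N q n" and \<rho> = "\<lambda>E. L_qHH A Y N q E n"])
    fix act assume rep: "algebra_rep (universal_env (Der A)) (qHH A Y N q n) act"
      and eq: "\<And>x v. x \<in> carrier (Der A) \<Longrightarrow> v \<in> carrier (qHH A Y N q n) \<Longrightarrow>
        act (env_in (Der A) x) v = L_qHH A Y N q x n v"
    show ?thesis
      using algebra_rep.left_module[OF rep] algebra_rep.act_lin[OF rep]
        lin_smult[OF algebra_rep.act_arg_lin[OF rep]] eq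
      by (intro exI[of _ act]) blast
  qed (simp_all add: Der_simps(1) module_qHH[OF c] L_qHH_lin[OF c] L_qHH_add[OF c] L_qHH_smult[OF c]
      L_qHH_bracket[OF c] derivation_add[OF assms(1)] derivation_smult[OF assms(1)] derivation_bracket[OF assms(1)])
  show ?thesis
    unfolding Let_def using part1 part2 by blast
qed

end
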